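(* Let $G$ be a finite simple connected vertex-transitive graph with undirected edges, with $N$ vertices and normalized graph Laplacian $L$. Consider the linear-quadratic game on $G$ described in the context, and assume $q^2=\varepsilon$. Then for any $T>0$ the solution $R:[0,T]\to\mathscr{X}$ to the ODE $$R'(t)=\frac1c\,\mathrm{Tr}\left[Q'(R(t))\,e^{-t(a+q)L}\right]e^{-t(a+q)L},\qquad R(0)=0,$$ exists and is unique, where $Q:\mathscr{X}\to\mathbb{R}$, $Q(X):=[\det(I+cXL)]^{1/N}$. The solution $(F^1,\dots,F^N)$ to the coupled Riccati system (R) of the context is given by $$F^i_t=\frac{1}{\frac{\mathrm{Tr}(P_t)-(a+q)\mathrm{Tr}(L)}{N}}\,[P_t-(a+q)L]\,e_ie_i^{\top}\,[P_t-(a+q)L],\qquad i\in[N],\ t\in[0,T],$$ where $P$ is constructed from $R$ by $$P_t=(a+q)L+R'(T-t)\,cL\,[I+R(T-t)\,cL]^{-1}.$$ The Markovian Nash equilibrium strategy of player $i$ is given by $$\hat\alpha^i(t,x)=-q e_i^{\top}Lx-e_i^{\top}F^i_t x.$$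
   Context: Notation: $[N]=\{1,\dots,N\}$; $\mathbb{S}^{N\times N}$ is the set of real symmetric $N\times N$ matrices; $A\ge B$ for symmetric matrices means $A-B$ is positive semi-definite; $e_1,\dots,e_N$ is the standard basis of $\mathbb{R}^N$. Graph: $G=(V,E)$, $V=\{v_1,\dots,v_N\}$, $d_v$ is the degree of $v$, $u\sim v$ means adjacency. $G$ is vertex-transitive if for all $v_i,v_j\in V$ there is a graph automorphism (a bijection $\varphi:V\to V$ with $(u,v)\in E\iff(\varphi(u),\varphi(v))\in E$) with $\varphi(v_i)=v_j$. The normalized Laplacian $L\in\mathbb{S}^{N\times N}$ is $L_{ii}=1$, $L_{ij}=-1/\sqrt{d_{v_i}d_{v_j}}$ if $i\ne j$ and $v_i\sim v_j$, $L_{ij}=0$ otherwise. $\mathscr{X}\subset\mathbb{S}^{N\times N}$ is the set $\{X: X\ge 0,\ X\text{ is a polynomial of }L\}$. $Q'(X)$ denotes the matrix derivative of $Q$, i.e. $Q'(X)=\frac1N[\det(I+cXL)]^{1/N}(I+cXL)^{-1}cL$ for $X\in\mathscr{X}$. Game: parameters $T>0$, $a\ge0$, $q\ge 0$, $\varepsilon\ge 0$, $c>0$, $\sigma>0$ with $q^2\le\varepsilon$. On a filtered probability space supporting independent Brownian motions $W^1,\dots,W^N$, with $(\mathcal{F}_t)$ the filtration they generate, player $i$ has real-valued state $$dX^i_t=(\alpha^i_t-a e_i^{\top}LX_t)\,dt+\sigma\,dW^i_t,\qquad X_t=[X^1_t,\dots,X^N_t]^{\top},\quad X_0=x_0\in\mathbb{R}^N,$$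 and chooses $\alpha^i$ in $\mathcal{A}=\{\alpha:\ \alpha \text{ progressively measurable with respect to }(\mathcal{F}_t),\ \mathbb{E}\int_0^T|\alpha_t|^2dt<\infty\}$ to minimize $$J^i(\alpha)=\mathbb{E}\left[\int_0^T \left(\tfrac12(\alpha^i_t)^2+q\alpha^i_t\, e_i^{\top}LX_t+\tfrac{\varepsilon}{2}(e_i^{\top}LX_t)^2\right)dt+\tfrac{c}{2}(e_i^{\top}LX_T)^2\right],\quad \alpha=(\alpha^1,\dots,\alpha^N).$$ A Markovian strategy is $\alpha^i_t=\phi^i(t,X_t)$ with $\phi^i:[0,T]\times\mathbb{R}^N\to\mathbb{R}$ Borel and $\sup_{t,x}|\phi^i(t,x)|/(1+\|x\|)<\infty$. A collection $\hat\alpha=(\hat\alpha^1,\dots,\hat\alpha^N)$ of Markovian strategies is a Markovian Nash equilibrium if $J^i((\alpha,\hat\alpha^{-i}))\ge J^i(\hat\alpha)$ for all $i\in[N]$ and $\alpha\in\mathcal{A}$, where $(\alpha,\hat\alpha^{-i})$ is obtained by replacing player $i$'s strategy by $\alpha$ while all other players keep their (feedback) strategies. Coupled Riccati system (R) for $F^i:[0,T]\to\mathbb{S}^{N\times N}$, $i\in[N]$: $$\dot F^i_t+\sum_{j=1}^N[-(a+q)L-F^j_t]e_je_j^{\top}F^i_t+\sum_{j=1}^N F^i_te_je_j^{\top}[-(a+q)L-F^j_t]+(\varepsilon-q^2)Le_ie_i^{\top}L+F^i_te_ie_i^{\top}F^i_t=0,\quad F^i_T=cLe_ie_i^{\top}L.$$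 *)

theory Defs
  imports "HOL-Probability.Probability" "HOL-Computational_Algebra.Polynomial"
begin

text \<open>
  The vertex set is identified with a finite type \<open>'n\<close>, so that \<open>N = CARD('n)\<close> and
  matrices indexed by vertices have type \<open>real^'n^'n\<close>; a graph is given by its
  adjacency relation.
\<close>

subsection \<open>Graphs\<close>

definition simple_graph :: "('n \<Rightarrow> 'n \<Rightarrow> bool) \<Rightarrow> bool" where
  "simple_graph adj \<longleftrightarrow> symp adj \<and> irreflp adj"

definition connected_graph :: "('n \<Rightarrow> 'n \<Rightarrow> bool) \<Rightarrow> bool" where
  "connected_graph adj \<longleftrightarrow> (\<forall>u v. adj\<^sup>*\<^sup>* u v)"

definition graph_automorphism :: "('n \<Rightarrow> 'n \<Rightarrow> bool) \<Rightarrow> ('n \<Rightarrow> 'n) \<Rightarrow> bool" where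
  "graph_automorphism adj f \<longleftrightarrow> bij f \<and> (\<forall>u v. adj u v \<longleftrightarrow> adj (f u) (f v))"

definition vertex_transitive :: "('n \<Rightarrow> 'n \<Rightarrow> bool) \<Rightarrow> bool" where
  "vertex_transitive adj \<longleftrightarrow> (\<forall>u v. \<exists>f. graph_automorphism adj f \<and> f u = v)"

definition vertex_degree :: "('n \<Rightarrow> 'n \<Rightarrow> bool) \<Rightarrow> 'n \<Rightarrow> nat" where
  "vertex_degree adj v = card {u. adj v u}"

definition normalized_laplacian :: "('n::finite \<Rightarrow> 'n \<Rightarrow> bool) \<Rightarrow> real^'n^'n" where
  "normalized_laplacian adj =
    (\<chi> i j. if i = j then 1
            else if adj i j
              then - 1 / sqrt (real (vertex_degree adj i) * real (vertex_degree adj j))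
            else 0)"


subsection \<open>Matrices\<close>

text \<open>The library's \<open>(^)\<close> (and \<open>(*)\<close>) on vectors and matrices is componentwise,
  so powers with respect to the matrix product \<open>(**)\<close> are defined separately.\<close>

primrec mat_pow :: "real^'n^'n \<Rightarrow> nat \<Rightarrow> real^'n^'n" where
  "mat_pow A 0 = mat 1"
| "mat_pow A (Suc k) = A ** mat_pow A k"

definition mat_exp :: "real^'n^'n \<Rightarrow> real^'n^'n" where
  "mat_exp A = (\<Sum>k. (1 / fact k) *\<^sub>R mat_pow A k)"

definition mat_poly :: "real poly \<Rightarrow> real^'n^'n \<Rightarrow> real^'n^'n" where
  "mat_poly p A = (\<Sum>k\<le>degree p. coeff p k *\<^sub>R mat_pow A k)"

definition pos_semidef :: "real^'n^'n \<Rightarrow> bool" where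
  "pos_semidef A \<longleftrightarrow> transpose A = A \<and> (\<forall>x. 0 \<le> x \<bullet> (A *v x))"

text \<open>The matrix \<open>e\<^sub>i e\<^sub>i\<^sup>T\<close>.\<close>

definition unit_outer :: "'n::finite \<Rightarrow> real^'n^'n" where
  "unit_outer i = (\<chi> k l. axis i 1 $ k * axis i 1 $ l)"

definition psd_polys :: "real^'n^'n \<Rightarrow> (real^'n^'n) set" where
  "psd_polys L = {X. pos_semidef X \<and> (\<exists>p. X = mat_poly p L)}"


subsection \<open>The ODE for \<open>R\<close> and the coupled Riccati system\<close>

definition Q_fun :: "real^'n^'n \<Rightarrow> real \<Rightarrow> real^'n^'n \<Rightarrow> real" where
  "Q_fun L c X = root (CARD('n)) (det (mat 1 + c *\<^sub>R (X ** L)))"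

text \<open>The matrix derivative \<open>Q'\<close> of \<open>Q_fun\<close> on \<open>psd_polys L\<close>, by Jacobi's formula.\<close>

definition Q_deriv :: "real^'n^'n \<Rightarrow> real \<Rightarrow> real^'n^'n \<Rightarrow> real^'n^'n" where
  "Q_deriv L c X =
    (1 / real (CARD('n)) * Q_fun L c X) *\<^sub>R
      (matrix_inv (mat 1 + c *\<^sub>R (X ** L)) ** (c *\<^sub>R L))"

definition solves_R_ode ::
  "real^'n^'n \<Rightarrow> real \<Rightarrow> real \<Rightarrow> real \<Rightarrow> real \<Rightarrow> (real \<Rightarrow> real^'n^'n) \<Rightarrow> bool" where
  "solves_R_ode L a q c T R \<longleftrightarrow>
    (\<forall>t\<in>{0..T}. R t \<in> psd_polys L) \<and> R 0 = 0 \<and>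
    (\<forall>t\<in>{0..T}.
      (R has_vector_derivative
        (1 / c * trace (Q_deriv L c (R t) ** mat_exp (- (t * (a + q)) *\<^sub>R L)))
          *\<^sub>R mat_exp (- (t * (a + q)) *\<^sub>R L))
      (at t within {0..T}))"

definition P_of ::
  "real^'n^'n \<Rightarrow> real \<Rightarrow> real \<Rightarrow> real \<Rightarrow> real \<Rightarrow> (real \<Rightarrow> real^'n^'n) \<Rightarrow> real \<Rightarrow> real^'n^'n" where
  "P_of L a q c T R t =
    (a + q) *\<^sub>R L +
    vector_derivative R (at (T - t) within {0..T}) ** (c *\<^sub>R L)
      ** matrix_inv (mat 1 + R (T - t) ** (c *\<^sub>R L))"

definition F_of ::
  "real^'n^'n \<Rightarrow> real \<Rightarrow> real \<Rightarrow> (real \<Rightarrow> real^'n^'n) \<Rightarrow> 'n \<Rightarrow> real \<Rightarrow> real^'n^'n" where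
  "F_of L a q P i t =
    (1 / ((trace (P t) - (a + q) * trace L) / real (CARD('n)))) *\<^sub>R
      ((P t - (a + q) *\<^sub>R L) ** unit_outer i ** (P t - (a + q) *\<^sub>R L))"

definition solves_riccati ::
  "real^'n^'n \<Rightarrow> real \<Rightarrow> real \<Rightarrow> real \<Rightarrow> real \<Rightarrow> real \<Rightarrow> ('n \<Rightarrow> real \<Rightarrow> real^'n^'n) \<Rightarrow> bool" where
  "solves_riccati L a q \<epsilon> c T F \<longleftrightarrow>
    (\<forall>i. \<forall>t\<in>{0..T}. transpose (F i t) = F i t) \<and>
    (\<forall>i. F i T = c *\<^sub>R (L ** unit_outer i ** L)) \<and>
    (\<forall>i. \<forall>t\<in>{0..T}. \<exists>D.
      (F i has_vector_derivative D) (at t within {0..T}) \<and>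
      D + (\<Sum>j\<in>UNIV. (- ((a + q) *\<^sub>R L) - F j t) ** unit_outer j ** F i t)
        + (\<Sum>j\<in>UNIV. F i t ** unit_outer j ** (- ((a + q) *\<^sub>R L) - F j t))
        + (\<epsilon> - q\<^sup>2) *\<^sub>R (L ** unit_outer i ** L)
        + F i t ** unit_outer i ** F i t = 0)"


subsection \<open>Brownian motion and progressive measurability\<close>

text \<open>Processes are functions of time and sample point; only times \<open>t \<ge> 0\<close> matter.\<close>

definition brownian_motion :: "'w measure \<Rightarrow> (real \<Rightarrow> 'w \<Rightarrow> real) \<Rightarrow> bool" where
  "brownian_motion M B \<longleftrightarrow>
    (\<forall>t\<ge>0. B t \<in> borel_measurable M) \<and>
    (AE \<omega> in M. B 0 \<omega> = 0) \<and>
    (\<forall>\<omega>\<in>space M. continuous_on {0..} (\<lambda>t. B t \<omega>)) \<and>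
    (\<forall>s t. 0 \<le> s \<and> s < t \<longrightarrow>
      distributed M lborel (\<lambda>\<omega>. B t \<omega> - B s \<omega>) (normal_density 0 (sqrt (t - s)))) \<and>
    (\<forall>n (\<tau>::nat \<Rightarrow> real). 0 \<le> \<tau> 0 \<and> (\<forall>k<n. \<tau> k \<le> \<tau> (Suc k)) \<longrightarrow>
      prob_space.indep_vars M (\<lambda>_. borel) (\<lambda>k \<omega>. B (\<tau> (Suc k)) \<omega> - B (\<tau> k) \<omega>) {..<n})"

text \<open>Independence of the processes is independence of the paths, viewed as random
  elements of \<open>\<real>\<^bsup>[0,\<infinity>)\<^esup>\<close> with the product \<open>\<sigma>\<close>-algebra.\<close>

definition independent_brownian_motions ::
  "'w measure \<Rightarrow> ('n \<Rightarrow> real \<Rightarrow> 'w \<Rightarrow> real) \<Rightarrow> bool" where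
  "independent_brownian_motions M W \<longleftrightarrow>
    (\<forall>i. brownian_motion M (W i)) \<and>
    prob_space.indep_vars M (\<lambda>_. PiM {0..} (\<lambda>_. borel)) (\<lambda>i \<omega>. \<lambda>t\<in>{0..}. W i t \<omega>) UNIV"

text \<open>The raw (not augmented) filtration generated by the family \<open>W\<close>. Each \<open>\<sigma>\<close>-algebra is
  represented as a measure space; its measure is irrelevant.\<close>

definition natural_filtration ::
  "'w measure \<Rightarrow> ('n \<Rightarrow> real \<Rightarrow> 'w \<Rightarrow> real) \<Rightarrow> real \<Rightarrow> 'w measure" where
  "natural_filtration M W t =
    sigma (space M) (\<Union>j. \<Union>s\<in>{0..t}. {W j s -` A \<inter> space M | A. A \<in> sets borel})"

definition progressively_measurable ::
  "real \<Rightarrow> (real \<Rightarrow> 'w measure) \<Rightarrow> (real \<Rightarrow> 'w \<Rightarrow> 'b::topological_space) \<Rightarrow> bool" where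
  "progressively_measurable T \<F> Y \<longleftrightarrow>
    (\<forall>t\<in>{0..T}. (\<lambda>(s, \<omega>). Y s \<omega>) \<in> borel_measurable (restrict_space borel {0..t} \<Otimes>\<^sub>M \<F> t))"


subsection \<open>The game\<close>

definition admissible_controls ::
  "real \<Rightarrow> 'w measure \<Rightarrow> ('n \<Rightarrow> real \<Rightarrow> 'w \<Rightarrow> real) \<Rightarrow> (real \<Rightarrow> 'w \<Rightarrow> real) set" where
  "admissible_controls T M W =
    {\<alpha>. progressively_measurable T (natural_filtration M W) \<alpha> \<and>
        (\<integral>\<^sup>+\<omega>. (\<integral>\<^sup>+t\<in>{0..T}. ennreal ((\<alpha> t \<omega>)\<^sup>2) \<partial>lborel) \<partial>M) < \<infinity>}"

definition markovian_strategy :: "real \<Rightarrow> (real \<Rightarrow> real^'n \<Rightarrow> real) \<Rightarrow> bool" where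
  "markovian_strategy T \<phi> \<longleftrightarrow>
    (\<lambda>(t, x). \<phi> t x) \<in> borel_measurable (restrict_space borel ({0..T} \<times> UNIV)) \<and>
    bdd_above ((\<lambda>(t, x). \<bar>\<phi> t x\<bar> / (1 + norm x)) ` ({0..T} \<times> UNIV))"

text \<open>\<open>X\<close> is a state process for the realised controls \<open>\<beta>\<close>. As the noise is additive, the
  SDE is a pathwise integral equation and no stochastic integral is needed; almost sure
  continuity of \<open>X\<close> is a consequence of the equation.\<close>

definition state_process ::
  "'w measure \<Rightarrow> ('n::finite \<Rightarrow> real \<Rightarrow> 'w \<Rightarrow> real) \<Rightarrow> real^'n^'n \<Rightarrow> real \<Rightarrow> real \<Rightarrow> real \<Rightarrow> real^'n
    \<Rightarrow> ('n \<Rightarrow> real \<Rightarrow> 'w \<Rightarrow> real) \<Rightarrow> (real \<Rightarrow> 'w \<Rightarrow> real^'n) \<Rightarrow> bool" where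
  "state_process M W L a \<sigma> T x0 \<beta> X \<longleftrightarrow>
    progressively_measurable T (natural_filtration M W) X \<and>
    (AE \<omega> in M. \<forall>i. \<forall>t\<in>{0..T}.
      set_integrable lborel {0..t} (\<lambda>s. \<beta> i s \<omega> - a * (L *v X s \<omega>) $ i) \<and>
      X t \<omega> $ i =
        x0 $ i + (LINT s:{0..t}|lborel. \<beta> i s \<omega> - a * (L *v X s \<omega>) $ i) + \<sigma> * W i t \<omega>)"

text \<open>A strategy profile is a map from state processes to realised controls: feedback players
  react to the state, while a deviating player uses a fixed process. It is well posed if the
  state equation has a solution, unique up to indistinguishability, so that costs are well
  defined.\<close>

definition well_posed ::
  "'w measure \<Rightarrow> ('n::finite \<Rightarrow> real \<Rightarrow> 'w \<Rightarrow> real) \<Rightarrow> real^'n^'n \<Rightarrow> real \<Rightarrow> real \<Rightarrow> real \<Rightarrow> real^'n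
    \<Rightarrow> ((real \<Rightarrow> 'w \<Rightarrow> real^'n) \<Rightarrow> 'n \<Rightarrow> real \<Rightarrow> 'w \<Rightarrow> real) \<Rightarrow> bool" where
  "well_posed M W L a \<sigma> T x0 \<Phi> \<longleftrightarrow>
    (\<exists>X. state_process M W L a \<sigma> T x0 (\<Phi> X) X \<and>
      (\<forall>Y. state_process M W L a \<sigma> T x0 (\<Phi> Y) Y \<longrightarrow>
        (AE \<omega> in M. \<forall>t\<in>{0..T}. Y t \<omega> = X t \<omega>)))"

definition feedback ::
  "('n \<Rightarrow> real \<Rightarrow> real^'n \<Rightarrow> real) \<Rightarrow> (real \<Rightarrow> 'w \<Rightarrow> real^'n) \<Rightarrow> 'n \<Rightarrow> real \<Rightarrow> 'w \<Rightarrow> real" where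
  "feedback \<phi> X j t \<omega> = \<phi> j t (X t \<omega>)"

definition deviate ::
  "('n \<Rightarrow> real \<Rightarrow> real^'n \<Rightarrow> real) \<Rightarrow> 'n \<Rightarrow> (real \<Rightarrow> 'w \<Rightarrow> real)
    \<Rightarrow> (real \<Rightarrow> 'w \<Rightarrow> real^'n) \<Rightarrow> 'n \<Rightarrow> real \<Rightarrow> 'w \<Rightarrow> real" where
  "deviate \<phi> i \<alpha> X = (feedback \<phi> X)(i := \<alpha>)"

text \<open>The cost of player \<open>i\<close>, as a \<open>[0,\<infinity>]\<close>-valued expectation. Since \<open>q\<^sup>2 \<le> \<epsilon>\<close> and \<open>c > 0\<close>, the
  running and terminal costs are nonnegative, so \<open>ennreal\<close> truncates nothing.\<close>

definition cost ::
  "'w measure \<Rightarrow> real^'n^'n \<Rightarrow> real \<Rightarrow> real \<Rightarrow> real \<Rightarrow> real \<Rightarrow> 'n::finite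
    \<Rightarrow> ('n \<Rightarrow> real \<Rightarrow> 'w \<Rightarrow> real) \<Rightarrow> (real \<Rightarrow> 'w \<Rightarrow> real^'n) \<Rightarrow> ennreal" where
  "cost M L q \<epsilon> c T i \<beta> X =
    (\<integral>\<^sup>+\<omega>. (\<integral>\<^sup>+t\<in>{0..T}. ennreal (1 / 2 * (\<beta> i t \<omega>)\<^sup>2 + q * \<beta> i t \<omega> * (L *v X t \<omega>) $ i
                + \<epsilon> / 2 * ((L *v X t \<omega>) $ i)\<^sup>2) \<partial>lborel)
          + ennreal (c / 2 * ((L *v X T \<omega>) $ i)\<^sup>2) \<partial>M)"

definition markovian_nash_equilibrium ::
  "'w measure \<Rightarrow> ('n::finite \<Rightarrow> real \<Rightarrow> 'w \<Rightarrow> real) \<Rightarrow> real^'n^'n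
    \<Rightarrow> real \<Rightarrow> real \<Rightarrow> real \<Rightarrow> real \<Rightarrow> real \<Rightarrow> real \<Rightarrow> real^'n
    \<Rightarrow> ('n \<Rightarrow> real \<Rightarrow> real^'n \<Rightarrow> real) \<Rightarrow> bool" where
  "markovian_nash_equilibrium M W L a q \<epsilon> c \<sigma> T x0 \<phi> \<longleftrightarrow>
    (\<forall>i. markovian_strategy T (\<phi> i)) \<and>
    well_posed M W L a \<sigma> T x0 (feedback \<phi>) \<and>
    (\<forall>i. \<forall>\<alpha>\<in>admissible_controls T M W.
      well_posed M W L a \<sigma> T x0 (deviate \<phi> i \<alpha>) \<and>
      (\<forall>X Y. state_process M W L a \<sigma> T x0 (feedback \<phi> X) X \<longrightarrow>
             state_process M W L a \<sigma> T x0 (deviate \<phi> i \<alpha> Y) Y \<longrightarrow>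
             cost M L q \<epsilon> c T i (deviate \<phi> i \<alpha> Y) Y \<ge> cost M L q \<epsilon> c T i (feedback \<phi> X) X))"

end

theory Submission
  imports Defs
begin

text \<open>
  Write \<open>b = a + q\<close>. The Laplacian is symmetric and positive semidefinite, so by
  \<open>spectral_theorem\<close> it is \<open>L = \<Sum>\<^sub>k l\<^sub>k e\<^sub>k e\<^sub>k\<^sup>T\<close> for an orthonormal frame \<open>e\<close>, and the polynomials
  of \<open>L\<close> are the matrices \<open>\<Sum>\<^sub>k f\<^sub>k e\<^sub>k e\<^sub>k\<^sup>T\<close> with \<open>f\<close> constant on eigenspaces. In these coordinates
  the equation for \<open>R\<close> reads \<open>\<rho>\<^sub>k' = r(t, \<rho>) exp (- t b l\<^sub>k)\<close> with one scalar speed \<open>r\<close> for all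
  eigenvalues. Its right-hand side is Lipschitz on boxes, and \<open>r\<close> grows at most linearly because a
  geometric mean is at most the sum of its factors; hence there is exactly one solution on all of
  \<open>[0, T]\<close> (\<open>solves_rate_exists\<close>, \<open>solves_rate_unique\<close>).

  Put \<open>A = P - b L\<close>. In reversed time its eigenvalues are \<open>r g\<^sub>k\<close>, where
  \<open>g\<^sub>k = c l\<^sub>k exp (- s b l\<^sub>k) / (1 + c l\<^sub>k \<rho>\<^sub>k)\<close>. With \<open>\<gamma>\<close> the mean of the \<open>g\<^sub>k\<close>, the definition of \<open>r\<close>
  says \<open>c r = Q \<gamma>\<close>, and differentiating \<open>log Q\<close> gives \<open>dQ/ds = Q r \<gamma>\<close>. From these two relations one
  finds, for a common scalar function \<open>\<kappa>\<close> and back in the original time, that \<open>A' = (b L + A) A - \<kappa> A\<close> and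
  \<open>\<lambda>' = \<lambda> (\<lambda> - 2 \<kappa>)\<close> for the mean \<open>\<lambda>\<close> of the eigenvalues of \<open>A\<close>. By vertex-transitivity
  all diagonal entries of a polynomial of \<open>L\<close> agree, so those of \<open>A\<close> equal \<open>\<lambda>\<close>. Hence
  \<open>F\<^sup>j e\<^sub>j = A e\<^sub>j\<close> for \<open>F\<^sup>j = A e\<^sub>j e\<^sub>j\<^sup>T A / \<lambda>\<close>, the coupling sums of the Riccati system collapse to \<open>A\<close>
  (\<open>rank_one_riccati\<close>), and the product rule verifies the system (\<open>F_of_solves_riccati\<close>). Its
  right-hand side is quadratic, which gives uniqueness (\<open>solves_riccati_unique\<close>).

  That a Riccati solution yields an equilibrium is true for every symmetric \<open>L\<close>
  (\<open>riccati_solution_nash\<close>), and the proof needs no stochastic integral. Let \<open>X\<close> be the equilibrium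
  state, \<open>Y\<close> the state when player \<open>i\<close> deviates, and \<open>D = Y - X\<close>. The noise cancels in \<open>D\<close>, so
  \<open>D\<close> is the integral of an adapted process \<open>d\<close>. Because \<open>\<epsilon> = q\<^sup>2\<close>, the running cost is a perfect
  square, and the cost difference is a nonnegative quadratic term in \<open>D\<close> and the deviation plus a
  cross term. The only probabilistic fact needed for the cross term is that \<open>d\<^sub>s\<close> is uncorrelated
  with the future increment \<open>W\<^sub>t - W\<^sub>s\<close> (\<open>expectation_times_increment\<close>). Together with pathwise
  integration by parts it gives a product rule for \<open>E[D\<^sub>t X\<^sub>t\<^sup>T]\<close> (\<open>expectation_product_rule\<close>);
  integrating this against \<open>F\<^sup>i\<close> and inserting the Riccati equation shows that the terminal part
  \<open>E[D\<^sub>T \<bullet> F\<^sup>i\<^sub>T X\<^sub>T]\<close> of the cross term cancels its running part.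
\<close>

section \<open>Ordinary differential equations and linear Volterra equations\<close>

text \<open>The hypothesis makes \<open>exp (- 2 C t) (f t \<bullet> f t)\<close> nonincreasing. All uniqueness statements for
  differential equations below are instances of this.\<close>

lemma gronwall_zero:
  fixes f :: "real \<Rightarrow> 'a::real_inner"
  assumes deriv: "\<And>t. t \<in> {0..T} \<Longrightarrow> (f has_vector_derivative f' t) (at t within {0..T})"
    and bound: "\<And>t. t \<in> {0..T} \<Longrightarrow> norm (f' t) \<le> C * norm (f t)"
    and "f 0 = 0" and t: "t \<in> {0..T}"
  shows "f t = 0"
proof (cases "t = 0")
  case False
  define g where "g s = exp (- 2 * C * s) * (f s \<bullet> f s)" for s
  define g' where "g' s = exp (- 2 * C * s) * (2 * (f s \<bullet> f' s) - 2 * C * (f s \<bullet> f s))" for s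
  have g_deriv: "(g has_derivative (\<lambda>h. h * g' s)) (at s within {0..t})" if "s \<in> {0..t}" for s
  proof -
    have "(f has_derivative (\<lambda>h. h *\<^sub>R f' s)) (at s within {0..t})"
      using deriv[of s] that t unfolding has_vector_derivative_def
      by (auto intro: has_derivative_subset)
    then show ?thesis
      unfolding g_def g'_def
      by (auto intro!: derivative_eq_intros simp: fun_eq_iff algebra_simps inner_commute)
  qed
  obtain s where s: "s \<in> {0<..<t}" "g t - g 0 = (t - 0) * g' s"
    using mvt_simple[of 0 t g "\<lambda>s h. h * g' s"] g_deriv False t by auto
  have "f s \<bullet> f' s \<le> norm (f s) * norm (f' s)" by (rule norm_cauchy_schwarz)
  also have "\<dots> \<le> norm (f s) * (C * norm (f s))"
    using bound[of s] s t by (intro mult_left_mono) auto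
  also have "\<dots> = C * (f s \<bullet> f s)" by (simp add: dot_square_norm power2_eq_square)
  finally have "g' s \<le> 0" unfolding g'_def by (simp add: mult_nonneg_nonpos)
  moreover have "t \<ge> 0" using t by simp
  ultimately have "t * g' s \<le> 0" by (rule mult_nonneg_nonpos[rotated])
  with s have "g t \<le> g 0" by simp
  then have "f t \<bullet> f t \<le> 0" using \<open>f 0 = 0\<close> by (simp add: g_def mult_le_0_iff)
  then show ?thesis by (metis inner_gt_zero_iff not_less)
qed (use assms in auto)

text \<open>Picard iteration in one stroke: with the weight \<open>exp (2 k t)\<close> factored out, the integral
  operator is a contraction of the space of bounded continuous functions on the whole line, so no
  subdivision of \<open>[0, T]\<close> is needed. Functions on \<open>[0, T]\<close> are extended constantly.\<close>

lemma global_ode_solution: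
  fixes f :: "real \<Rightarrow> 'a::banach \<Rightarrow> 'a"
  assumes "T \<ge> 0"
    and cont: "continuous_on ({0..T} \<times> UNIV) (\<lambda>(t, x). f t x)"
    and lip: "\<And>t x y. t \<in> {0..T} \<Longrightarrow> norm (f t x - f t y) \<le> K * norm (x - y)"
  obtains x where "x 0 = x0"
    and "\<And>t. t \<in> {0..T} \<Longrightarrow> (x has_vector_derivative f t (x t)) (at t within {0..T})"
proof -
  define k where "k = max K 1"
  have k: "k > 0" and lipk: "\<And>t x y. t \<in> {0..T} \<Longrightarrow> norm (f t x - f t y) \<le> k * norm (x - y)"
    using order_trans[OF lip mult_right_mono[of K "max K 1"]] by (auto simp: k_def)
  define J :: "(real \<Rightarrow>\<^sub>C 'a) \<Rightarrow> real \<Rightarrow> 'a"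
    where "J y t = integral {0..t} (\<lambda>s. f s (exp (2 * k * s) *\<^sub>R apply_bcontfun y s))" for y t
  define H where "H y t = exp (- (2 * k * t)) *\<^sub>R (x0 + J y t)" for y t
  have cont_f: "continuous_on {0..T} (\<lambda>s. f s (exp (2 * k * s) *\<^sub>R apply_bcontfun y s))" for y
  proof -
    have "continuous_on {0..T} ((\<lambda>(t, x). f t x) \<circ> (\<lambda>s. (s, exp (2 * k * s) *\<^sub>R apply_bcontfun y s)))"
      by (intro continuous_on_compose continuous_intros continuous_on_subset[OF cont]) auto
    then show ?thesis by (simp add: o_def)
  qed
  have cont_J: "continuous_on {0..T} (J y)" for y
    unfolding J_def using cont_f by (intro indefinite_integral_continuous_1 integrable_continuous_interval)
  then have cont_H: "continuous_on {0..T} (H y)" for y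
    unfolding H_def by (intro continuous_intros) auto
  define \<Phi> where "\<Phi> y = Bcontfun (ext_cont (H y) 0 T)" for y
  have \<Phi>: "apply_bcontfun (\<Phi> y) = ext_cont (H y) 0 T" for y
  proof -
    have "ext_cont (H y) 0 T \<in> bcontfun"
    proof -
      have "bounded (H y ` {0..T})" using cont_H compact_continuous_image compact_imp_bounded by blast
      moreover have "range (ext_cont (H y) 0 T) \<subseteq> H y ` {0..T}"
        using \<open>T \<ge> 0\<close> clamp_in_interval[of 0 T] by (auto simp: ext_cont_def)
      moreover have "continuous_on UNIV (ext_cont (H y) 0 T)"
        by (rule continuous_on_ext_cont) (use cont_H in simp)
      ultimately show ?thesis
        unfolding bcontfun_def using bounded_subset by blast
    qed
    then show ?thesis by (simp add: \<Phi>_def Bcontfun_inverse)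
  qed
  have contract: "dist (\<Phi> y) (\<Phi> z) \<le> 1/2 * dist y z" for y z
  proof (rule dist_bound)
    fix t0 :: real
    define t where "t = clamp 0 T t0"
    have t: "t \<in> {0..T}" using clamp_in_interval[of 0 T t0] \<open>T \<ge> 0\<close> by (auto simp: t_def)
    then have sub: "{0..t} \<subseteq> {0..T}" by auto
    have int_exp: "((\<lambda>s. k * exp (2 * k * s) * dist y z) has_integral (exp (2 * k * t) - 1) / 2 * dist y z) {0..t}"
    proof -
      have "((\<lambda>s. k * exp (2 * k * s) * dist y z) has_integral
          (exp (2 * k * t) / 2 * dist y z - exp (2 * k * 0) / 2 * dist y z)) {0..t}"
        by (intro fundamental_theorem_of_calculus)
          (use t in \<open>auto intro!: derivative_eq_intros simp: has_real_derivative_iff_has_vector_derivative[symmetric]\<close>)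
      then show ?thesis by (simp add: algebra_simps diff_divide_distrib)
    qed
    have integr: "(\<lambda>s. f s (exp (2 * k * s) *\<^sub>R apply_bcontfun y s)) integrable_on {0..t}" for y
      using cont_f sub by (intro integrable_continuous_interval) (rule continuous_on_subset)
    have "norm (J y t - J z t) = norm (integral {0..t} (\<lambda>s. f s (exp (2 * k * s) *\<^sub>R apply_bcontfun y s)
        - f s (exp (2 * k * s) *\<^sub>R apply_bcontfun z s)))"
      unfolding J_def using integr by (subst Henstock_Kurzweil_Integration.integral_diff) auto
    also have "\<dots> \<le> integral {0..t} (\<lambda>s. k * exp (2 * k * s) * dist y z)"
    proof (rule integral_norm_bound_integral)
      fix s assume "s \<in> {0..t}"
      then have "norm (f s (exp (2 * k * s) *\<^sub>R apply_bcontfun y s) - f s (exp (2 * k * s) *\<^sub>R apply_bcontfun z s))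
         \<le> k * norm (exp (2 * k * s) *\<^sub>R apply_bcontfun y s - exp (2 * k * s) *\<^sub>R apply_bcontfun z s)"
        using sub by (intro lipk) auto
      also have "\<dots> = k * exp (2 * k * s) * dist (apply_bcontfun y s) (apply_bcontfun z s)"
        by (simp add: scaleR_diff_right[symmetric] dist_norm)
      also have "\<dots> \<le> k * exp (2 * k * s) * dist y z"
        using k by (intro mult_left_mono dist_bounded) auto
      finally show "norm (f s (exp (2 * k * s) *\<^sub>R apply_bcontfun y s) - f s (exp (2 * k * s) *\<^sub>R apply_bcontfun z s))
         \<le> k * exp (2 * k * s) * dist y z" .
    qed (use integr int_exp in \<open>auto intro!: Henstock_Kurzweil_Integration.integrable_diff intro: has_integral_integrable\<close>)
    also have "\<dots> = (exp (2 * k * t) - 1) / 2 * dist y z" using int_exp by (rule integral_unique)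
    finally have J: "norm (J y t - J z t) \<le> (exp (2 * k * t) - 1) / 2 * dist y z" .
    have "dist (apply_bcontfun (\<Phi> y) t0) (apply_bcontfun (\<Phi> z) t0) = exp (- (2 * k * t)) * norm (J y t - J z t)"
      unfolding \<Phi> ext_cont_def t_def[symmetric] H_def dist_norm by (simp add: scaleR_diff_right[symmetric])
    also have "\<dots> \<le> exp (- (2 * k * t)) * ((exp (2 * k * t) - 1) / 2 * dist y z)"
      using J by (intro mult_left_mono) auto
    also have "\<dots> = (1 - exp (- (2 * k * t))) / 2 * dist y z"
      by (simp add: field_simps exp_minus)
    also have "\<dots> \<le> 1/2 * dist y z" by (intro mult_right_mono) auto
    finally show "dist (apply_bcontfun (\<Phi> y) t0) (apply_bcontfun (\<Phi> z) t0) \<le> 1/2 * dist y z" .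
  qed
  obtain y where y: "\<Phi> y = y"
    using banach_fix_type[of "1/2" \<Phi>] contract by auto
  define x where "x t = x0 + J y t" for t
  have yx: "exp (2 * k * t) *\<^sub>R apply_bcontfun y t = x t" if "t \<in> {0..T}" for t
  proof -
    have "apply_bcontfun y t = H y t"
      using that \<Phi>[of y] y by simp
    then show ?thesis by (simp add: H_def x_def exp_minus)
  qed
  show ?thesis
  proof
    show "x 0 = x0" by (simp add: x_def J_def)
    fix t assume t: "t \<in> {0..T}"
    have "(J y has_vector_derivative f t (exp (2 * k * t) *\<^sub>R apply_bcontfun y t)) (at t within {0..T})"
      unfolding J_def by (intro integral_has_vector_derivative cont_f t)
    then show "(x has_vector_derivative f t (x t)) (at t within {0..T})"
      unfolding x_def[abs_def] using yx[OF t] by (auto simp: x_def intro!: derivative_eq_intros)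
  qed
qed

interpretation matrix_vector: bounded_bilinear "(*v) :: real^'n^'m \<Rightarrow> real^'n \<Rightarrow> real^'m"
  by (rule bilinear_conv_bounded_bilinear[THEN iffD1])
    (auto simp: bilinear_def vec_eq_iff matrix_vector_mult_def sum.distrib sum_distrib_left algebra_simps intro!: linearI)

interpretation matrix_mult: bounded_bilinear "(**) :: real^'n^'m \<Rightarrow> real^'k^'n \<Rightarrow> real^'k^'m"
  by (rule bilinear_conv_bounded_bilinear[THEN iffD1])
    (auto simp: bilinear_def vec_eq_iff matrix_matrix_mult_def sum.distrib sum_distrib_left algebra_simps intro!: linearI)

lemma continuous_on_interval_bound:
  fixes f :: "real \<Rightarrow> 'a::real_normed_vector"
  assumes "continuous_on {0..T} f"
  obtains b where "b \<ge> 0" "\<And>t. t \<in> {0..T} \<Longrightarrow> norm (f t) \<le> b"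
proof -
  obtain b where "\<forall>x\<in>f ` {0..T}. norm x \<le> b"
    using compact_imp_bounded[OF compact_continuous_image[OF assms compact_Icc]]
    unfolding bounded_iff by blast
  then show ?thesis by (intro that[of "max b 0"]) (auto simp: le_max_iff_disj)
qed

text \<open>The inverse of the fundamental matrix solves the adjoint equation; the product of the two
  solutions in the order \<open>\<Psi>i \<Psi>\<close> has derivative zero.\<close>

lemma matrix_fundamental_solution:
  fixes B :: "real \<Rightarrow> real^'n^'n"
  assumes "T \<ge> 0" and B: "continuous_on {0..T} B"
  obtains \<Psi> \<Psi>i :: "real \<Rightarrow> real^'n^'n" where
    "\<And>t. t \<in> {0..T} \<Longrightarrow> (\<Psi> has_vector_derivative B t ** \<Psi> t) (at t within {0..T})"
    "\<And>t. t \<in> {0..T} \<Longrightarrow> (\<Psi>i has_vector_derivative - (\<Psi>i t ** B t)) (at t within {0..T})"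
    "\<And>t. t \<in> {0..T} \<Longrightarrow> \<Psi> t ** \<Psi>i t = mat 1"
proof -
  obtain b where b: "b \<ge> 0" "\<And>t. t \<in> {0..T} \<Longrightarrow> norm (B t) \<le> b"
    using continuous_on_interval_bound[OF B] by metis
  obtain K where K: "K \<ge> 0" "\<And>(A::real^'n^'n) (X::real^'n^'n). norm (A ** X) \<le> norm A * norm X * K"
    using matrix_mult.nonneg_bounded by blast
  have lip: "norm (B t ** X - B t ** Y) \<le> b * K * norm (X - Y)"
    "norm (- (X ** B t) - - (Y ** B t)) \<le> b * K * norm (X - Y)" if "t \<in> {0..T}" for t and X Y :: "real^'n^'n"
  proof -
    have "B t ** X - B t ** Y = B t ** (X - Y)" by (simp add: matrix_mult.diff_right)
    moreover have "norm (B t ** (X - Y)) \<le> norm (B t) * norm (X - Y) * K" by (rule K)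
    moreover have "norm (B t) * norm (X - Y) * K \<le> b * norm (X - Y) * K"
      using b(2)[OF that] K(1) by (intro mult_right_mono) auto
    ultimately show "norm (B t ** X - B t ** Y) \<le> b * K * norm (X - Y)" by (simp add: ac_simps)
    have "norm (- (X ** B t) - - (Y ** B t)) = norm ((X - Y) ** B t)"
      by (simp add: matrix_mult.diff_left norm_minus_commute)
    moreover have "norm ((X - Y) ** B t) \<le> norm (X - Y) * norm (B t) * K" by (rule K)
    moreover have "norm (X - Y) * norm (B t) * K \<le> norm (X - Y) * b * K"
      using b(2)[OF that] K(1) by (intro mult_right_mono mult_left_mono) auto
    ultimately show "norm (- (X ** B t) - - (Y ** B t)) \<le> b * K * norm (X - Y)" by (simp add: ac_simps)
  qed
  have Bfst: "continuous_on ({0..T} \<times> UNIV) (\<lambda>z. B (fst z))"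
    by (rule continuous_on_compose2[OF B]) (auto intro!: continuous_intros)
  have c1: "continuous_on ({0..T} \<times> (UNIV :: (real^'n^'n) set)) (\<lambda>(t, X). B t ** X)"
    unfolding case_prod_unfold
    by (intro matrix_mult.continuous_on Bfst continuous_intros)
  have c2: "continuous_on ({0..T} \<times> (UNIV :: (real^'n^'n) set)) (\<lambda>(t, X). - (X ** B t))"
    unfolding case_prod_unfold
    by (intro continuous_on_minus matrix_mult.continuous_on Bfst continuous_intros)
  obtain \<Psi> where \<Psi>: "\<Psi> 0 = mat 1"
    "\<And>t. t \<in> {0..T} \<Longrightarrow> (\<Psi> has_vector_derivative B t ** \<Psi> t) (at t within {0..T})"
    using global_ode_solution[OF \<open>T \<ge> 0\<close> c1 lip(1), of "mat 1"] by auto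
  obtain \<Psi>i where \<Psi>i: "\<Psi>i 0 = mat 1"
    "\<And>t. t \<in> {0..T} \<Longrightarrow> (\<Psi>i has_vector_derivative - (\<Psi>i t ** B t)) (at t within {0..T})"
    using global_ode_solution[OF \<open>T \<ge> 0\<close> c2 lip(2), of "mat 1"] by auto
  have "\<Psi>i t ** \<Psi> t - mat 1 = 0" if t: "t \<in> {0..T}" for t
  proof (rule gronwall_zero[where C = 0 and f' = "\<lambda>_. 0", OF _ _ _ t])
    fix s assume s: "s \<in> {0..T}"
    show "((\<lambda>t. \<Psi>i t ** \<Psi> t - mat 1) has_vector_derivative 0) (at s within {0..T})"
      using matrix_mult.has_vector_derivative[OF \<Psi>i(2)[OF s] \<Psi>(2)[OF s]]
      by (auto intro!: derivative_eq_intros simp: matrix_mul_assoc matrix_mult.minus_left)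
  qed (auto simp: \<Psi>(1) \<Psi>i(1))
  then have "\<Psi> t ** \<Psi>i t = mat 1" if "t \<in> {0..T}" for t
    using that by (metis eq_iff_diff_eq_0 matrix_left_right_inverse)
  with \<Psi>(2) \<Psi>i(2) show ?thesis by (rule that)
qed

text \<open>Variation of constants for \<open>x = h + \<integral> B x\<close> with a forcing \<open>h\<close> that is merely continuous, as it
  contains a Brownian path. The difference \<open>x - h\<close> is continuously differentiable, so the classical
  theory applies to it. The solution is an explicit functional of \<open>h\<close>, which is what makes it
  progressively measurable later.\<close>

lemma linear_volterra_equation:
  fixes B :: "real \<Rightarrow> real^'n^'n"
  assumes "T \<ge> 0" and B: "continuous_on {0..T} B"
  obtains \<Psi> \<Theta> :: "real \<Rightarrow> real^'n^'n" where
    "continuous_on {0..T} \<Psi>" "continuous_on {0..T} \<Theta>"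
    "\<And>h x. continuous_on {0..T} h \<Longrightarrow>
      (continuous_on {0..T} x \<and> (\<forall>t\<in>{0..T}. x t = h t + integral {0..t} (\<lambda>s. B s *v x s)))
        \<longleftrightarrow> (\<forall>t\<in>{0..T}. x t = h t + \<Psi> t *v integral {0..t} (\<lambda>s. \<Theta> s *v h s))"
proof -
  obtain \<Psi> \<Psi>i :: "real \<Rightarrow> real^'n^'n" where
    \<Psi>: "\<And>t. t \<in> {0..T} \<Longrightarrow> (\<Psi> has_vector_derivative B t ** \<Psi> t) (at t within {0..T})" and
    \<Psi>i: "\<And>t. t \<in> {0..T} \<Longrightarrow> (\<Psi>i has_vector_derivative - (\<Psi>i t ** B t)) (at t within {0..T})" and
    inv: "\<And>t. t \<in> {0..T} \<Longrightarrow> \<Psi> t ** \<Psi>i t = mat 1"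
    using matrix_fundamental_solution[OF assms] by metis
  have c: "continuous_on {0..T} \<Psi>" "continuous_on {0..T} \<Psi>i"
    by (rule continuous_on_vector_derivative, erule \<Psi>, rule continuous_on_vector_derivative, erule \<Psi>i)
  note mvc = matrix_vector.continuous_on
  define \<Theta> where "\<Theta> s = \<Psi>i s ** B s" for s
  have c\<Theta>: "continuous_on {0..T} \<Theta>"
    unfolding \<Theta>_def by (intro matrix_mult.continuous_on c B)
  obtain b where b: "b \<ge> 0" "\<And>t. t \<in> {0..T} \<Longrightarrow> norm (B t) \<le> b"
    using continuous_on_interval_bound[OF B] by metis
  obtain K where K: "K \<ge> 0" "\<And>(A::real^'n^'n) (X::real^'n). norm (A *v X) \<le> norm A * norm X * K"
    using matrix_vector.nonneg_bounded by blast
  show ?thesis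
  proof (rule that[OF c(1) c\<Theta>])
    fix h x :: "real \<Rightarrow> real^'n" assume h: "continuous_on {0..T} h"
    define y where "y t = \<Psi> t *v integral {0..t} (\<lambda>s. \<Theta> s *v h s)" for t
    have y': "(y has_vector_derivative B t *v (h t + y t)) (at t within {0..T})" if t: "t \<in> {0..T}" for t
    proof -
      have "((\<lambda>t. integral {0..t} (\<lambda>s. \<Theta> s *v h s)) has_vector_derivative \<Theta> t *v h t) (at t within {0..T})"
        by (intro integral_has_vector_derivative mvc c\<Theta> h t)
      from matrix_vector.has_vector_derivative[OF \<Psi>[OF t] this]
      have "(y has_vector_derivative \<Psi> t *v (\<Theta> t *v h t) +
          (B t ** \<Psi> t) *v integral {0..t} (\<lambda>s. \<Theta> s *v h s)) (at t within {0..T})"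
        unfolding y_def .
      moreover have "\<Psi> t *v (\<Theta> t *v h t) = B t *v h t"
        using inv[OF t] by (simp add: matrix_vector_mul_assoc \<Theta>_def matrix_mul_assoc)
      ultimately show ?thesis
        by (simp add: y_def matrix_vector_right_distrib matrix_vector_mul_assoc)
    qed
    then have cy: "continuous_on {0..T} y" by (rule continuous_on_vector_derivative)
    have y: "y t = integral {0..t} (\<lambda>s. B s *v (h s + y s))" if t: "t \<in> {0..T}" for t
    proof -
      have "((\<lambda>s. B s *v (h s + y s)) has_integral y t - y 0) {0..t}"
        using t by (intro fundamental_theorem_of_calculus)
          (auto intro!: has_vector_derivative_within_subset[OF y'])
      then show ?thesis by (simp add: integral_unique y_def)
    qed
    show "(continuous_on {0..T} x \<and> (\<forall>t\<in>{0..T}. x t = h t + integral {0..t} (\<lambda>s. B s *v x s)))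
        \<longleftrightarrow> (\<forall>t\<in>{0..T}. x t = h t + \<Psi> t *v integral {0..t} (\<lambda>s. \<Theta> s *v h s))"
      (is "?L \<longleftrightarrow> ?R")
    proof
      assume ?R
      then have x: "x t = h t + y t" if "t \<in> {0..T}" for t using that by (simp add: y_def)
      have "x t = h t + integral {0..t} (\<lambda>s. B s *v x s)" if t: "t \<in> {0..T}" for t
      proof -
        have "integral {0..t} (\<lambda>s. B s *v x s) = integral {0..t} (\<lambda>s. B s *v (h s + y s))"
          using t by (intro integral_cong) (auto simp: x)
        then show ?thesis using x[OF t] y[OF t] by simp
      qed
      moreover have "continuous_on {0..T} x"
        by (rule continuous_on_eq[OF continuous_on_add[OF h cy]]) (simp add: x)
      ultimately show ?L by blast
    next
      assume L: ?L
      define z where "z t = integral {0..t} (\<lambda>s. B s *v x s) - y t" for t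
      have "z t = 0" if t: "t \<in> {0..T}" for t
      proof (rule gronwall_zero[where f = z and f' = "\<lambda>t. B t *v z t" and C = "b * K", OF _ _ _ t])
        fix s assume s: "s \<in> {0..T}"
        have "((\<lambda>t. integral {0..t} (\<lambda>s. B s *v x s)) has_vector_derivative B s *v x s) (at s within {0..T})"
          by (intro integral_has_vector_derivative mvc B s conjunct1[OF L])
        from has_vector_derivative_diff[OF this y'[OF s]]
        show "(z has_vector_derivative B s *v z s) (at s within {0..T})"
          using L s by (simp add: z_def[abs_def] matrix_vector_mult_diff_distrib[symmetric])
        have "norm (B s *v z s) \<le> norm (B s) * norm (z s) * K" by (rule K)
        also have "\<dots> \<le> b * norm (z s) * K"
          using b(2)[OF s] K(1) by (intro mult_right_mono) auto
        finally show "norm (B s *v z s) \<le> b * K * norm (z s)" by (simp add: ac_simps)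
      qed (simp add: z_def y_def)
      then show ?R using L by (simp add: z_def y_def)
    qed
  qed
qed

lemma linear_volterra_bound:
  fixes B :: "real \<Rightarrow> real^'n^'n"
  assumes "T \<ge> 0" and B: "continuous_on {0..T} B"
  obtains C where "C \<ge> 0"
    "\<And>h x t. \<lbrakk>continuous_on {0..T} h; continuous_on {0..T} x;
       \<And>t. t \<in> {0..T} \<Longrightarrow> x t = h t + integral {0..t} (\<lambda>s. B s *v x s); t \<in> {0..T}\<rbrakk>
      \<Longrightarrow> norm (x t) \<le> norm (h t) + C * integral {0..T} (\<lambda>s. norm (h s))"
proof (rule linear_volterra_equation[OF assms])
  fix \<Psi> \<Theta> :: "real \<Rightarrow> real^'n^'n"
  assume c: "continuous_on {0..T} \<Psi>" "continuous_on {0..T} \<Theta>" and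
    eq: "\<And>h x. continuous_on {0..T} h \<Longrightarrow>
      (continuous_on {0..T} x \<and> (\<forall>t\<in>{0..T}. x t = h t + integral {0..t} (\<lambda>s. B s *v x s)))
        \<longleftrightarrow> (\<forall>t\<in>{0..T}. x t = h t + \<Psi> t *v integral {0..t} (\<lambda>s. \<Theta> s *v h s))"
  obtain b where b: "b \<ge> 0" "\<And>t. t \<in> {0..T} \<Longrightarrow> norm (\<Psi> t) \<le> b"
    using continuous_on_interval_bound[OF c(1)] by metis
  obtain b' where b': "b' \<ge> 0" "\<And>t. t \<in> {0..T} \<Longrightarrow> norm (\<Theta> t) \<le> b'"
    using continuous_on_interval_bound[OF c(2)] by metis
  obtain K where K: "K \<ge> 0" "\<And>(A::real^'n^'n) (X::real^'n). norm (A *v X) \<le> norm A * norm X * K"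
    using matrix_vector.nonneg_bounded by blast
  note nn = b(1) b'(1)
  note mvc = matrix_vector.continuous_on
  show ?thesis
  proof (rule that[of "b * K * b' * K"])
    show "b * K * b' * K \<ge> 0" using nn K(1) by simp
    fix h x :: "real \<Rightarrow> real^'n" and t
    assume h: "continuous_on {0..T} h" and x: "continuous_on {0..T} x"
      "\<And>t. t \<in> {0..T} \<Longrightarrow> x t = h t + integral {0..t} (\<lambda>s. B s *v x s)" and t: "t \<in> {0..T}"
    have sub: "{0..t} \<subseteq> {0..T}" using t by auto
    have "norm (integral {0..t} (\<lambda>s. \<Theta> s *v h s)) \<le> integral {0..t} (\<lambda>s. b' * K * norm (h s))"
    proof (rule integral_norm_bound_integral)
      show "(\<lambda>s. \<Theta> s *v h s) integrable_on {0..t}"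
        by (intro integrable_continuous_interval mvc continuous_on_subset[OF c(2) sub] continuous_on_subset[OF h sub])
      show "(\<lambda>s. b' * K * norm (h s)) integrable_on {0..t}"
        by (intro integrable_continuous_interval continuous_intros continuous_on_subset[OF h sub])
      fix s assume s: "s \<in> {0..t}"
      have "norm (\<Theta> s *v h s) \<le> norm (\<Theta> s) * norm (h s) * K" by (rule K)
      also have "\<dots> \<le> b' * norm (h s) * K"
        using b'(2)[of s] s sub K(1) by (intro mult_right_mono) auto
      finally show "norm (\<Theta> s *v h s) \<le> b' * K * norm (h s)" by (simp add: ac_simps)
    qed
    also have "\<dots> \<le> integral {0..T} (\<lambda>s. b' * K * norm (h s))"
    proof (rule integral_subset_le[OF sub])
      have c': "continuous_on {0..T} (\<lambda>s. b' * K * norm (h s))" by (intro continuous_intros h)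
      show "(\<lambda>s. b' * K * norm (h s)) integrable_on {0..T}"
        "(\<lambda>s. b' * K * norm (h s)) integrable_on {0..t}"
        by (intro integrable_continuous_interval c' continuous_on_subset[OF c' sub])+
    qed (use nn K(1) in auto)
    finally have 1: "norm (integral {0..t} (\<lambda>s. \<Theta> s *v h s)) \<le> b' * K * integral {0..T} (\<lambda>s. norm (h s))"
      by simp
    have "x t = h t + \<Psi> t *v integral {0..t} (\<lambda>s. \<Theta> s *v h s)"
      by (rule bspec[OF eq[OF h, THEN iffD1, OF conjI[OF x(1) ballI[OF x(2)]]] t])
    then have "norm (x t) \<le> norm (h t) + norm (\<Psi> t *v integral {0..t} (\<lambda>s. \<Theta> s *v h s))"
      by (simp add: norm_triangle_ineq)
    also have "norm (\<Psi> t *v integral {0..t} (\<lambda>s. \<Theta> s *v h s))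
        \<le> norm (\<Psi> t) * norm (integral {0..t} (\<lambda>s. \<Theta> s *v h s)) * K" by (rule K)
    also have "\<dots> \<le> b * (b' * K * integral {0..T} (\<lambda>s. norm (h s))) * K"
      using b(2)[OF t] 1 K(1) nn by (intro mult_right_mono mult_mono) auto
    finally show "norm (x t) \<le> norm (h t) + b * K * b' * K * integral {0..T} (\<lambda>s. norm (h s))"
      by (simp add: ac_simps)
  qed
qed

text \<open>Integration by parts when one factor is only an indefinite integral. The double integral of
  \<open>f' r * w s\<close> over the triangle \<open>s \<le> r\<close>, taken in the two orders, equals both
  \<open>\<integral> (f t - f s) w s ds\<close> and the last integral.\<close>

lemma absolutely_continuous_by_parts:
  fixes f f' w :: "real \<Rightarrow> real"
  assumes f: "\<And>s. s \<in> {0..t} \<Longrightarrow> (f has_real_derivative f' s) (at s within {0..t})"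
    and f': "continuous_on {0..t} f'"
    and w: "set_integrable lborel {0..t} w" and "t \<ge> 0"
  shows "set_integrable lborel {0..t} (\<lambda>s. f s * w s)"
    and "set_integrable lborel {0..t} (\<lambda>s. f' s * (LINT r:{0..s}|lborel. w r))"
    and "f t * (LINT s:{0..t}|lborel. w s)
      = (LINT s:{0..t}|lborel. f s * w s) + (LINT s:{0..t}|lborel. f' s * (LINT r:{0..s}|lborel. w r))"
proof -
  define w0 where "w0 s = indicator {0..t} s * w s" for s :: real
  define g where "g r = indicator {0..t} r * f' r" for r :: real
  have w0: "integrable lborel w0" using w by (simp add: set_integrable_def w0_def[abs_def])
  have g: "integrable lborel g"
    using borel_integrable_atLeastAtMost'[OF f'] by (simp add: set_integrable_def g_def[abs_def])
  have [measurable]: "w0 \<in> borel_measurable borel" "g \<in> borel_measurable borel"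
    using borel_measurable_integrable[OF w0] borel_measurable_integrable[OF g] by simp_all
  define k where "k s r = indicator {s..} r * (w0 s * g r)" for s r
  have k_meas: "case_prod k \<in> borel_measurable (lborel \<Otimes>\<^sub>M lborel)"
  proof -
    have "(\<lambda>z. indicator {z :: real \<times> real. fst z \<le> snd z} z * (w0 (fst z) * g (snd z))) \<in> borel_measurable (lborel \<Otimes>\<^sub>M lborel)"
      by measurable
    then show ?thesis by (simp add: k_def case_prod_unfold indicator_def of_bool_def)
  qed
  have wg: "integrable (lborel \<Otimes>\<^sub>M lborel) (\<lambda>(s, r). w0 s * g r)"
  proof (rule lborel_pair.Fubini_integrable)
    show "(\<lambda>(s, r). w0 s * g r) \<in> borel_measurable (lborel \<Otimes>\<^sub>M lborel)" by measurable
    show "integrable lborel (\<lambda>s. \<integral>r. norm (case (s, r) of (s, r) \<Rightarrow> w0 s * g r) \<partial>lborel)"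
      using integrable_norm[OF w0] by (simp add: abs_mult)
    show "AE s in lborel. integrable lborel (\<lambda>r. case (s, r) of (s, r) \<Rightarrow> w0 s * g r)"
      using g by simp
  qed
  have k: "integrable (lborel \<Otimes>\<^sub>M lborel) (case_prod k)"
    by (rule Bochner_Integration.integrable_bound[OF wg k_meas]) (auto simp: k_def indicator_def)
  have fub: "(\<integral>r. (\<integral>s. k s r \<partial>lborel) \<partial>lborel) = (\<integral>s. (\<integral>r. k s r \<partial>lborel) \<partial>lborel)"
    by (rule lborel_pair.Fubini_integral[OF k])
  have 1: "(\<integral>s. k s r \<partial>lborel) = indicator {0..t} r * (f' r * (LINT u:{0..r}|lborel. w u))" for r
  proof -
    have "(\<integral>s. k s r \<partial>lborel) = (\<integral>s. g r * (indicator {0..r} s * w s) \<partial>lborel)"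
      by (rule Bochner_Integration.integral_cong)
        (auto simp: k_def w0_def g_def indicator_def)
    then show ?thesis by (simp add: g_def set_lebesgue_integral_def)
  qed
  have 2: "(\<integral>r. k s r \<partial>lborel) = w0 s * (f t - f s)" for s
  proof (cases "s \<in> {0..t}")
    case True
    have "(\<integral>r. k s r \<partial>lborel) = (\<integral>r. w0 s * (indicator {s..t} r * f' r) \<partial>lborel)"
      using True by (intro Bochner_Integration.integral_cong) (auto simp: k_def g_def indicator_def)
    also have "\<dots> = w0 s * (\<integral>r. indicator {s..t} r *\<^sub>R f' r \<partial>lborel)" by simp
    also have "(\<integral>r. indicator {s..t} r *\<^sub>R f' r \<partial>lborel) = f t - f s"
      using True by (intro integral_FTC_atLeastAtMost continuous_on_subset[OF f'])
        (auto intro!: has_field_derivative_subset[OF f]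
          simp: has_real_derivative_iff_has_vector_derivative[symmetric])
    finally show ?thesis .
  qed (simp add: k_def w0_def)
  have fc: "continuous_on {0..t} f" by (rule DERIV_continuous_on[OF f])
  obtain b where b: "b \<ge> 0" "\<And>s. s \<in> {0..t} \<Longrightarrow> norm (f s) \<le> b"
    using continuous_on_interval_bound[OF fc] by metis
  have f0 [measurable]: "(\<lambda>s. indicator {0..t} s * f s) \<in> borel_measurable borel"
    using borel_measurable_integrable[OF borel_integrable_atLeastAtMost'[OF fc, unfolded set_integrable_def]]
    by simp
  have fw: "integrable lborel (\<lambda>s. f s * w0 s)"
  proof -
    have "integrable lborel (\<lambda>s. (indicator {0..t} s * f s) * w0 s)"
    proof (rule Bochner_Integration.integrable_bound[where f = "\<lambda>s. b * w0 s"])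
      show "AE s in lborel. norm ((indicator {0..t} s * f s) * w0 s) \<le> norm (b * w0 s)"
        by (intro AE_I2) (use b in \<open>auto simp: w0_def indicator_def abs_mult intro!: mult_right_mono\<close>)
    qed (use w0 in simp_all)
    moreover have "(\<lambda>s. (indicator {0..t} s * f s) * w0 s) = (\<lambda>s. f s * w0 s)"
      by (auto simp: w0_def indicator_def)
    ultimately show ?thesis by simp
  qed
  then show i1: "set_integrable lborel {0..t} (\<lambda>s. f s * w s)"
    by (simp only: set_integrable_def w0_def mult.left_commute real_scaleR_def)
  show i2: "set_integrable lborel {0..t} (\<lambda>s. f' s * (LINT r:{0..s}|lborel. w r))"
    using lborel_pair.integrable_snd[OF k] unfolding set_integrable_def real_scaleR_def 1 .
  have "(LINT s:{0..t}|lborel. f' s * (LINT r:{0..s}|lborel. w r)) = (\<integral>s. w0 s * (f t - f s) \<partial>lborel)"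
    using fub unfolding 1 2 set_lebesgue_integral_def real_scaleR_def .
  also have "\<dots> = (\<integral>s. f t * w0 s \<partial>lborel) - (\<integral>s. f s * w0 s \<partial>lborel)"
    using w0 fw by (subst Bochner_Integration.integral_diff[symmetric])
      (simp_all add: algebra_simps)
  finally show "f t * (LINT s:{0..t}|lborel. w s)
      = (LINT s:{0..t}|lborel. f s * w s) + (LINT s:{0..t}|lborel. f' s * (LINT r:{0..s}|lborel. w r))"
    by (simp add: set_lebesgue_integral_def w0_def mult.left_commute)
qed

section \<open>Rank-one matrices and the spectral theorem\<close>

lemma unit_outer_mult_vector: "unit_outer i *v x = x $ i *\<^sub>R axis i 1"
proof -
  have "axis i 1 $ k * axis i 1 $ m * x $ m = (if m = i then axis i 1 $ k * x $ i else 0)" for k m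
    by (simp add: axis_def)
  then show ?thesis by (simp add: vec_eq_iff unit_outer_def matrix_vector_mult_def)
qed

lemma inner_matrix_vector_transpose: "x \<bullet> (A *v y) = (transpose A *v x) \<bullet> y" for A :: "real^'n^'m"
  by (simp add: dot_lmul_matrix[symmetric] transpose_matrix_vector)

lemma inner_rank_one:
  "x \<bullet> ((A ** unit_outer i ** B) *v y) = (transpose A *v x) $ i * (B *v y) $ i" for A B :: "real^'n^'n"
  unfolding matrix_vector_mul_assoc[symmetric] inner_matrix_vector_transpose[of x A]
  by (simp add: unit_outer_mult_vector inner_axis)

lemma matrix_mult_unit_outer:
  "(A ** unit_outer j) $ k $ l = (if j = l then A $ k $ j else 0)"
  "(unit_outer j ** A) $ k $ l = (if j = k then A $ j $ l else 0)" for A :: "real^'n^'n"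
proof -
  have "A $ k $ m * (axis j 1 $ m * axis j 1 $ l) = (if m = j then A $ k $ j * axis j 1 $ l else 0)" for m
    by (simp add: axis_def)
  then show "(A ** unit_outer j) $ k $ l = (if j = l then A $ k $ j else 0)"
    by (simp add: unit_outer_def matrix_matrix_mult_def) (simp add: axis_def)
  have "axis j 1 $ k * axis j 1 $ m * A $ m $ l = (if m = j then axis j 1 $ k * A $ j $ l else 0)" for m
    by (simp add: axis_def)
  then show "(unit_outer j ** A) $ k $ l = (if j = k then A $ j $ l else 0)"
    by (simp add: unit_outer_def matrix_matrix_mult_def) (simp add: axis_def)
qed

lemma sum_mult_unit_outer:
  "(\<Sum>j\<in>UNIV. A j ** unit_outer j) = transpose (\<chi> j. transpose (A j) $ j)"
  "(\<Sum>j\<in>UNIV. unit_outer j ** A j) = (\<chi> j. A j $ j)" for A :: "'n::finite \<Rightarrow> real^'n^'n"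
  by (simp_all add: vec_eq_iff matrix_mult_unit_outer transpose_def)

lemma symmetric_inner: "transpose A = A \<Longrightarrow> x \<bullet> (A *v y) = (A *v x) \<bullet> y" for A :: "real^'n^'n"
  by (metis dot_lmul_matrix transpose_matrix_vector)

text \<open>A maximiser of the quadratic form on the unit sphere of an invariant subspace is an eigenvector:
  its residual \<open>A v - \<mu> v\<close> lies in the subspace, and if it were nonzero it would be a direction of
  first-order increase.\<close>

lemma symmetric_matrix_eigenvector:
  fixes A :: "real^'n^'n"
  assumes A: "transpose A = A" and S: "subspace S" "S \<noteq> {0}" and inv: "\<And>x. x \<in> S \<Longrightarrow> A *v x \<in> S"
  obtains v \<mu> where "v \<in> S" "norm v = 1" "A *v v = \<mu> *\<^sub>R v"
proof -
  let ?K = "S \<inter> sphere 0 1"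
  have "compact ?K" using closed_subspace[OF S(1)] by (intro closed_Int_compact) auto
  moreover have "?K \<noteq> {}"
  proof -
    obtain x where x: "x \<in> S" "x \<noteq> 0" using S subspace_0[OF S(1)] by blast
    then have "x /\<^sub>R norm x \<in> ?K" using S(1) by (auto simp: subspace_scale)
    then show ?thesis by blast
  qed
  moreover have "continuous_on ?K (\<lambda>x. x \<bullet> (A *v x))"
    by (intro continuous_intros matrix_vector.continuous_on)
  ultimately have "\<exists>v\<in>?K. \<forall>y\<in>?K. y \<bullet> (A *v y) \<le> v \<bullet> (A *v v)"
    by (rule continuous_attains_sup)
  then obtain v where v: "v \<in> ?K" and max: "\<And>y. y \<in> ?K \<Longrightarrow> y \<bullet> (A *v y) \<le> v \<bullet> (A *v v)"
    by blast
  define \<mu> where "\<mu> = v \<bullet> (A *v v)"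
  have quad: "x \<bullet> (A *v x) \<le> \<mu> * (x \<bullet> x)" if x: "x \<in> S" for x
  proof (cases "x = 0")
    case False
    then have "x /\<^sub>R norm x \<in> ?K" using S(1) x by (auto simp: subspace_scale)
    from max[OF this] have "(x \<bullet> (A *v x)) / (norm x)\<^sup>2 \<le> \<mu>"
      by (simp add: \<mu>_def matrix_vector.scaleR_right power2_eq_square divide_inverse mult_ac)
    then show ?thesis using False by (simp add: pos_divide_le_eq power2_norm_eq_inner)
  qed simp
  define g where "g = A *v v - \<mu> *\<^sub>R v"
  have vv: "v \<bullet> v = 1" using v by (simp add: dot_square_norm)
  have gS: "g \<in> S" using v inv S(1) by (auto simp: g_def intro!: subspace_diff subspace_scale)
  \<comment> \<open>Perturbing the maximiser in the direction \<open>g\<close> bounds a linear term by a quadratic one.\<close>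
  have perturb: "2 * t * (g \<bullet> g) \<le> t\<^sup>2 * (\<mu> * (g \<bullet> g) - g \<bullet> (A *v g))" for t
  proof -
    have "v + t *\<^sub>R g \<in> S" using v gS S(1) by (auto intro!: subspace_add subspace_scale)
    from quad[OF this] have "\<mu> + 2 * t * (g \<bullet> (A *v v)) + t\<^sup>2 * (g \<bullet> (A *v g)) \<le> \<mu> * (1 + 2 * t * (g \<bullet> v) + t\<^sup>2 * (g \<bullet> g))"
      using symmetric_inner[OF A, of v g] vv
      by (simp add: matrix_vector.add_right matrix_vector.scaleR_right inner_add_left inner_add_right \<mu>_def[symmetric]
          power2_eq_square inner_commute algebra_simps)
    moreover have "g \<bullet> (A *v v) = g \<bullet> g + \<mu> * (g \<bullet> v)"
      using inner_diff_right[of g "A *v v" "\<mu> *\<^sub>R v"] by (simp add: g_def[symmetric])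
    ultimately show ?thesis by (simp add: algebra_simps)
  qed
  have "g \<bullet> g = 0"
  proof (rule ccontr)
    assume "g \<bullet> g \<noteq> 0"
    then have pos: "g \<bullet> g > 0" by (simp add: less_le)
    define C where "C = \<bar>\<mu> * (g \<bullet> g) - g \<bullet> (A *v g)\<bar> + 1"
    \<comment> \<open>This step size beats the quadratic coefficient, which is at most \<open>C\<close>.\<close>
    define t where "t = (g \<bullet> g) / C"
    have C: "C > 0" by (simp add: C_def add_nonneg_pos)
    have t: "t > 0" using pos C by (simp add: t_def)
    have "2 * t * (g \<bullet> g) \<le> t\<^sup>2 * C"
      by (rule order_trans[OF perturb mult_left_mono]) (auto simp: C_def)
    also have "\<dots> = t * (g \<bullet> g)" using C by (simp add: t_def power2_eq_square)
    finally show False using t pos by simp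
  qed
  then have "A *v v = \<mu> *\<^sub>R v" by (simp add: g_def)
  then show ?thesis using v that by auto
qed

text \<open>Split off one eigenvector; by symmetry its orthogonal complement inside the subspace is again
  invariant and has smaller dimension.\<close>

lemma symmetric_matrix_eigenbasis_subspace:
  fixes A :: "real^'n^'n"
  assumes A: "transpose A = A"
  shows "subspace S \<Longrightarrow> (\<And>x. x \<in> S \<Longrightarrow> A *v x \<in> S) \<Longrightarrow>
    \<exists>B\<subseteq>S. pairwise orthogonal B \<and> (\<forall>v\<in>B. norm v = 1 \<and> (\<exists>\<mu>. A *v v = \<mu> *\<^sub>R v)) \<and> span B = S"
proof (induction "dim S" arbitrary: S rule: less_induct)
  case less
  show ?case
  proof (cases "S = {0}")
    case True
    then show ?thesis by (intro exI[of _ "{}"]) auto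
  next
    case False
    obtain v \<mu> where v: "v \<in> S" "norm v = 1" "A *v v = \<mu> *\<^sub>R v"
      by (rule symmetric_matrix_eigenvector[OF A less.prems(1) False less.prems(2)])
    have vv: "v \<bullet> v = 1" using v by (simp add: dot_square_norm)
    define S' where "S' = {x\<in>S. v \<bullet> x = 0}"
    have S': "subspace S'"
      using less.prems(1) by (auto simp: S'_def subspace_def inner_add_right)
    have inv': "A *v x \<in> S'" if "x \<in> S'" for x
      using that less.prems(2) v(3) by (auto simp: S'_def symmetric_inner[OF A])
    have "v \<notin> S'" "S' \<subseteq> S" using vv by (auto simp: S'_def)
    then have "S' \<subset> S" using v(1) by blast
    then have "dim S' < dim S"
      using S' less.prems(1) by (intro dim_psubset) (simp add: span_eq_iff[THEN iffD2])
    from less.hyps[OF this S' inv'] obtain B where B: "B \<subseteq> S'" "pairwise orthogonal B"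
      "\<forall>v\<in>B. norm v = 1 \<and> (\<exists>\<mu>. A *v v = \<mu> *\<^sub>R v)" "span B = S'" by blast
    show ?thesis
    proof (intro exI[of _ "insert v B"] conjI)
      show "insert v B \<subseteq> S" using B(1) v by (auto simp: S'_def)
      show "pairwise orthogonal (insert v B)"
        using B(1,2) by (auto simp: pairwise_insert S'_def orthogonal_def inner_commute)
      show "\<forall>v\<in>insert v B. norm v = 1 \<and> (\<exists>\<mu>. A *v v = \<mu> *\<^sub>R v)" using B(3) v by auto
      show "span (insert v B) = S"
      proof
        show "span (insert v B) \<subseteq> S"
          using B(1) v less.prems(1) by (intro span_minimal) (auto simp: S'_def)
        show "S \<subseteq> span (insert v B)"
        proof
          fix x assume x: "x \<in> S"
          have "x - (v \<bullet> x) *\<^sub>R v \<in> S'"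
            using x v vv less.prems(1) by (auto simp: S'_def inner_diff_right intro!: subspace_diff subspace_scale)
          then have "x - (v \<bullet> x) *\<^sub>R v \<in> span B" using B(4) by simp
          then show "x \<in> span (insert v B)" using span_breakdown_eq[of x v B] by blast
        qed
      qed
    qed
  qed
qed

definition orthonormal_frame :: "('n::finite \<Rightarrow> real^'n) \<Rightarrow> bool" where
  "orthonormal_frame e \<longleftrightarrow> (\<forall>k m. e k \<bullet> e m = (if k = m then 1 else 0))"

text \<open>The function \<open>f\<close> applied to the eigenvalues: the matrix \<open>\<Sum>\<^sub>k f\<^sub>k e\<^sub>k e\<^sub>k\<^sup>T\<close>. For an orthonormal frame
  this is an algebra homomorphism in \<open>f\<close>, so all matrix functions of \<open>L\<close> reduce to functions of its
  eigenvalues.\<close>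

definition spectral :: "('n::finite \<Rightarrow> real^'n) \<Rightarrow> ('n \<Rightarrow> real) \<Rightarrow> real^'n^'n" where
  "spectral e f = (\<chi> i j. \<Sum>k\<in>UNIV. f k * (e k $ i * e k $ j))"

lemma spectral_factorization:
  "spectral e f = transpose (\<chi> k. e k) ** (\<chi> i j. if i = j then f i else 0) ** (\<chi> k. e k)"
proof -
  have "(transpose (\<chi> k. e k) ** (\<chi> i j. if i = j then f i else 0)) $ i $ k = e k $ i * f k" for i k
    by (simp add: matrix_matrix_mult_def transpose_def if_distrib cong: if_cong)
  then show ?thesis
    by (simp add: vec_eq_iff spectral_def matrix_matrix_mult_def[of "transpose _ ** _"] mult_ac)
qed

lemma spectral_theorem:
  fixes A :: "real^'n^'n"
  assumes A: "transpose A = A"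
  obtains e l where "orthonormal_frame e" "A = spectral e l"
proof -
  obtain B where B: "pairwise orthogonal B" "\<forall>v\<in>B. norm v = 1 \<and> (\<exists>\<mu>. A *v v = \<mu> *\<^sub>R v)" "span B = UNIV"
    using symmetric_matrix_eigenbasis_subspace[OF A subspace_UNIV] by auto
  have "0 \<notin> B" using B(2) by auto
  then have ind: "independent B" using pairwise_orthogonal_independent B(1) by blast
  then have fin: "finite B" by (rule independent_imp_finite)
  have "card B = dim (UNIV :: (real^'n) set)"
    using basis_card_eq_dim[of B UNIV] ind B(3) by simp
  then have "card B = CARD('n)" by (simp add: dim_UNIV)
  then obtain e where e: "bij_betw e (UNIV :: 'n set) B"
    using fin finite_same_card_bij[of "UNIV :: 'n set" B] by auto
  have eB: "e k \<in> B" for k using e by (auto simp: bij_betw_def)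
  then have "\<forall>k. \<exists>\<mu>. A *v e k = \<mu> *\<^sub>R e k" using B(2) by blast
  then obtain l where l: "\<And>k. A *v e k = l k *\<^sub>R e k" by metis
  have on: "e k \<bullet> e m = (if k = m then 1 else 0)" for k m
  proof (cases "k = m")
    case True
    then show ?thesis using B(2) eB[of k] by (simp add: dot_square_norm)
  next
    case False
    then have "e k \<noteq> e m" using e by (auto simp: bij_betw_def inj_on_def)
    then show ?thesis using B(1) eB False by (auto simp: pairwise_def orthogonal_def)
  qed
  then have frame: "orthonormal_frame e" by (simp add: orthonormal_frame_def)
  define U where "U = (\<chi> k. e k)"
  have "(\<Sum>i\<in>UNIV. e k $ i * e m $ i) = (if k = m then 1 else 0)" for k m
    using on[of k m] by (simp add: inner_vec_def)
  then have U: "U ** transpose U = mat 1"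
    by (simp add: vec_eq_iff U_def matrix_matrix_mult_def transpose_def mat_def)
  then have U': "transpose U ** U = mat 1" by (simp add: matrix_left_right_inverse)
  have "A ** transpose U = transpose U ** (\<chi> i j. if i = j then l i else 0)"
  proof -
    have "(A ** transpose U) $ i $ k = l k * e k $ i" for i k
      using arg_cong[OF l[of k], of "\<lambda>x. x $ i"]
      by (simp add: matrix_matrix_mult_def matrix_vector_mult_def transpose_def U_def)
    then show ?thesis
      by (simp add: vec_eq_iff) (simp add: matrix_matrix_mult_def transpose_def U_def if_distrib cong: if_cong)
  qed
  then have "A = transpose U ** (\<chi> i j. if i = j then l i else 0) ** U"
    by (metis U' matrix_mul_assoc matrix_mul_rid)
  then show ?thesis using that[OF frame, of l] by (simp add: spectral_factorization U_def)
qed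

context
  fixes e :: "'n::finite \<Rightarrow> real^'n"
  assumes frame: "orthonormal_frame e"
begin

lemma frame_inner: "e k \<bullet> e m = (if k = m then 1 else 0)"
  using frame by (simp add: orthonormal_frame_def)

lemma frame_orthogonal: "(\<chi> k. e k) ** transpose (\<chi> k. e k) = mat 1" "transpose (\<chi> k. e k) ** (\<chi> k. e k) = mat 1"
proof -
  have "(\<Sum>i\<in>UNIV. e k $ i * e m $ i) = (if k = m then 1 else 0)" for k m
    using frame_inner[of k m] by (simp add: inner_vec_def)
  then show "(\<chi> k. e k) ** transpose (\<chi> k. e k) = mat 1"
    by (simp add: vec_eq_iff matrix_matrix_mult_def transpose_def mat_def)
  then show "transpose (\<chi> k. e k) ** (\<chi> k. e k) = mat 1" by (simp add: matrix_left_right_inverse)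
qed

lemma spectral_mult: "spectral e f ** spectral e g = spectral e (\<lambda>k. f k * g k)"
proof -
  let ?U = "\<chi> k. e k"
  let ?D = "\<lambda>f :: 'n \<Rightarrow> real. (\<chi> i j. if i = j then f i else 0) :: real^'n^'n"
  have D: "?D f ** ?D g = ?D (\<lambda>k. f k * g k)"
  proof -
    have "(if i = m then f i else 0) * (if m = j then g m else 0)
        = (if m = i then (if i = j then f i * g i else 0) else 0)" for i j m by simp
    then show ?thesis by (simp add: vec_eq_iff matrix_matrix_mult_def)
  qed
  have "spectral e f ** spectral e g = transpose ?U ** ?D f ** (?U ** transpose ?U) ** ?D g ** ?U"
    by (simp only: spectral_factorization matrix_mul_assoc)
  also have "\<dots> = transpose ?U ** (?D f ** ?D g) ** ?U"
    by (simp only: frame_orthogonal matrix_mul_rid matrix_mul_assoc)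
  finally show ?thesis unfolding D by (simp only: spectral_factorization)
qed

lemma spectral_one: "spectral e (\<lambda>_. 1) = mat 1"
proof -
  have "(\<chi> i j. if i = j then 1 else 0) = (mat 1 :: real^'n^'n)" by (simp add: vec_eq_iff mat_def)
  then show ?thesis by (simp only: spectral_factorization frame_orthogonal matrix_mul_rid)
qed

lemma spectral_add: "spectral e f + spectral e g = spectral e (\<lambda>k. f k + g k)"
  by (simp add: vec_eq_iff spectral_def sum.distrib distrib_right)

lemma spectral_diff: "spectral e f - spectral e g = spectral e (\<lambda>k. f k - g k)"
  by (simp add: vec_eq_iff spectral_def sum_subtractf left_diff_distrib)

lemma spectral_minus: "- spectral e f = spectral e (\<lambda>k. - f k)"
  by (simp add: vec_eq_iff spectral_def sum_negf)

lemma spectral_scaleR: "x *\<^sub>R spectral e f = spectral e (\<lambda>k. x * f k)"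
  by (simp add: vec_eq_iff spectral_def sum_distrib_left mult.assoc)

lemma spectral_transpose: "transpose (spectral e f) = spectral e f"
  by (simp add: vec_eq_iff spectral_def transpose_def mult_ac)

lemma spectral_trace: "trace (spectral e f) = (\<Sum>k\<in>UNIV. f k)"
proof -
  have "trace (spectral e f) = (\<Sum>k\<in>UNIV. f k * (e k \<bullet> e k))"
    unfolding trace_def spectral_def inner_vec_def
    by (simp add: sum_distrib_left) (subst sum.swap, simp)
  then show ?thesis by (simp add: frame_inner)
qed

lemma spectral_det: "det (spectral e f) = (\<Prod>k\<in>UNIV. f k)"
proof -
  let ?U = "\<chi> k. e k"
  let ?D = "(\<chi> i j. if i = j then f i else 0) :: real^'n^'n"
  have "det (spectral e f) = det (transpose ?U) * det ?U * det ?D"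
    by (simp add: spectral_factorization det_mul)
  also have "det (transpose ?U) * det ?U = det (transpose ?U ** ?U)" by (simp add: det_mul)
  also have "\<dots> = 1" by (simp add: frame_orthogonal)
  also have "det ?D = (\<Prod>k\<in>UNIV. f k)" by (subst det_diagonal) auto
  finally show ?thesis by simp
qed

lemma spectral_inverse:
  assumes "\<And>k. f k \<noteq> 0"
  shows "matrix_inv (spectral e f) = spectral e (\<lambda>k. 1 / f k)"
proof -
  let ?A = "spectral e f" and ?B = "spectral e (\<lambda>k. 1 / f k)"
  have AB: "?A ** ?B = mat 1" and BA: "?B ** ?A = mat 1"
    by (simp_all add: spectral_mult assms spectral_one)
  show ?thesis
    unfolding matrix_inv_def
  proof (rule some_equality)
    fix C assume "?A ** C = mat 1 \<and> C ** ?A = mat 1"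
    then have "C ** ?A ** ?B = ?B" by simp
    then show "C = ?B" by (simp add: matrix_mul_assoc[symmetric] AB)
  qed (simp add: AB BA)
qed

lemma spectral_eigenvector: "spectral e f *v e k = f k *\<^sub>R e k"
proof -
  have "(spectral e f *v e k) $ i = (\<Sum>m\<in>UNIV. f m * e m $ i * (e m \<bullet> e k))" for i
    unfolding spectral_def matrix_vector_mult_def inner_vec_def
    by (simp add: sum_distrib_left sum_distrib_right mult_ac) (rule sum.swap)
  moreover have "f m * e m $ i * (e m \<bullet> e k) = (if m = k then f k * e k $ i else 0)" for m i
    by (simp add: frame_inner)
  ultimately show ?thesis by (simp add: vec_eq_iff)
qed

lemma spectral_coefficient: "e k \<bullet> (spectral e f *v e k) = f k"
  by (simp add: spectral_eigenvector frame_inner)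

lemma spectral_quadratic: "x \<bullet> (spectral e f *v x) = (\<Sum>k\<in>UNIV. f k * (e k \<bullet> x)\<^sup>2)"
proof -
  have "x \<bullet> (spectral e f *v x) = (\<Sum>i\<in>UNIV. \<Sum>j\<in>UNIV. \<Sum>k\<in>UNIV. f k * ((e k $ i * x $ i) * (e k $ j * x $ j)))"
    unfolding spectral_def matrix_vector_mult_def inner_vec_def
    by (simp add: sum_distrib_left sum_distrib_right mult_ac)
  also have "\<dots> = (\<Sum>i\<in>UNIV. \<Sum>k\<in>UNIV. \<Sum>j\<in>UNIV. f k * ((e k $ i * x $ i) * (e k $ j * x $ j)))"
    by (intro sum.cong refl sum.swap)
  also have "\<dots> = (\<Sum>k\<in>UNIV. \<Sum>i\<in>UNIV. \<Sum>j\<in>UNIV. f k * ((e k $ i * x $ i) * (e k $ j * x $ j)))"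
    by (rule sum.swap)
  also have "\<dots> = (\<Sum>k\<in>UNIV. f k * (e k \<bullet> x)\<^sup>2)"
    by (simp add: inner_vec_def power2_eq_square sum_distrib_left[symmetric] sum_distrib_right[symmetric])
  finally show ?thesis .
qed

lemma spectral_pos_semidef: "pos_semidef (spectral e f) \<longleftrightarrow> (\<forall>k. 0 \<le> f k)"
proof
  assume "pos_semidef (spectral e f)"
  then show "\<forall>k. 0 \<le> f k" unfolding pos_semidef_def using spectral_coefficient by metis
qed (simp add: pos_semidef_def spectral_transpose spectral_quadratic sum_nonneg)

lemma spectral_mat_pow: "mat_pow (spectral e f) n = spectral e (\<lambda>k. f k ^ n)"
  by (induction n) (simp_all add: spectral_one spectral_mult)

lemma spectral_sum: "(\<Sum>n\<in>I. spectral e (f n)) = spectral e (\<lambda>k. \<Sum>n\<in>I. f n k)"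
proof (cases "finite I")
  case True
  then show ?thesis
    by (induction I) (simp_all add: spectral_add, simp add: spectral_def vec_eq_iff)
qed (simp add: spectral_def vec_eq_iff)

lemma spectral_mat_poly: "mat_poly p (spectral e f) = spectral e (\<lambda>k. poly p (f k))"
  by (simp add: mat_poly_def spectral_mat_pow spectral_scaleR spectral_sum poly_altdef)

lemma spectral_expand: "spectral e f = (\<Sum>k\<in>UNIV. f k *\<^sub>R (\<chi> i j. e k $ i * e k $ j))"
  by (simp add: vec_eq_iff spectral_def)

lemma spectral_mat_exp: "mat_exp (spectral e f) = spectral e (\<lambda>k. exp (f k))"
proof -
  have "(\<lambda>n. \<Sum>k\<in>UNIV. (1 / fact n * f k ^ n) *\<^sub>R (\<chi> i j. e k $ i * e k $ j)) sums spectral e (\<lambda>k. exp (f k))"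
    unfolding spectral_expand
    using exp_converges[of "f _"] by (intro sums_sum sums_scaleR_left) (simp add: divide_inverse)
  moreover have "(1 / fact n) *\<^sub>R mat_pow (spectral e f) n = (\<Sum>k\<in>UNIV. (1 / fact n * f k ^ n) *\<^sub>R (\<chi> i j. e k $ i * e k $ j))" for n
    unfolding spectral_mat_pow spectral_scaleR by (rule spectral_expand)
  ultimately show ?thesis unfolding mat_exp_def by (simp add: sums_iff)
qed

lemma spectral_has_vector_derivative:
  assumes "\<And>k. ((\<lambda>t. f t k) has_real_derivative f' k) (at t within S)"
  shows "((\<lambda>t. spectral e (f t)) has_vector_derivative spectral e f') (at t within S)"
  unfolding spectral_expand
  using assms by (intro has_vector_derivative_sum)
    (auto intro!: derivative_eq_intros simp: has_real_derivative_iff_has_vector_derivative)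

end

section \<open>Polynomials of the Laplacian of a vertex-transitive graph\<close>

lemma interpolating_polynomial:
  fixes g :: "real \<Rightarrow> real"
  assumes "finite S"
  shows "\<exists>p. \<forall>x\<in>S. poly p x = g x"
  using assms
proof (induction S)
  case (insert a S)
  then obtain p where p: "\<forall>x\<in>S. poly p x = g x" by blast
  define w where "w = (\<Prod>s\<in>S. [:- s, 1:])"
  have w: "poly w x = (\<Prod>s\<in>S. x - s)" for x by (simp add: w_def poly_prod)
  have "poly w a \<noteq> 0" using insert.hyps by (auto simp: w)
  moreover have "poly w x = 0" if "x \<in> S" for x using insert.hyps that by (auto simp: w)
  ultimately show ?case
    using p by (intro exI[of _ "p + smult ((g a - poly p a) / poly w a) w"]) auto
qed simp

text \<open>Lagrange interpolation on the spectrum: this is how a spectrally defined matrix is recognised as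
  a polynomial of \<open>L\<close>.\<close>

lemma spectral_is_mat_poly:
  assumes e: "orthonormal_frame e" and f: "\<And>k m. l k = l m \<Longrightarrow> f k = f m"
  obtains p where "spectral e f = mat_poly p (spectral e l)"
proof -
  have "finite (range l)" by simp
  from interpolating_polynomial[OF this, of "\<lambda>x. f (SOME k. l k = x)"]
  obtain p where p: "\<forall>x\<in>range l. poly p x = f (SOME k. l k = x)" by (elim exE)
  have "poly p (l k) = f k" for k
  proof -
    have "l (SOME m. l m = l k) = l k" by (rule someI[of _ k]) simp
    then show ?thesis using bspec[OF p rangeI[of l k]] f[of "SOME m. l m = l k" k] by simp
  qed
  then show ?thesis by (intro that[of p]) (simp add: spectral_mat_poly[OF e])
qed

lemma transpose_laplacian:
  assumes "symp adj"
  shows "transpose (normalized_laplacian adj) = normalized_laplacian adj"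
  using assms by (auto simp: vec_eq_iff transpose_def normalized_laplacian_def symp_def mult.commute)

lemma trace_laplacian: "trace (normalized_laplacian adj :: real^'n^'n) = real CARD('n)"
  by (simp add: trace_def normalized_laplacian_def)

lemma automorphism_degree:
  assumes "graph_automorphism adj f"
  shows "vertex_degree adj (f v) = vertex_degree adj v"
proof -
  have f: "bij f" "\<And>u v. adj u v \<longleftrightarrow> adj (f u) (f v)" using assms by (auto simp: graph_automorphism_def)
  have "{u. adj (f v) u} = f ` {u. adj v u}"
  proof
    show "{u. adj (f v) u} \<subseteq> f ` {u. adj v u}"
    proof
      fix x assume x: "x \<in> {u. adj (f v) u}"
      have "f (inv f x) = x" using bij_is_surj[OF f(1)] by (rule surj_f_inv_f)
      with x f(2)[of v "inv f x"] show "x \<in> f ` {u. adj v u}" by (intro image_eqI[of _ _ "inv f x"]) auto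
    qed
  qed (use f(2) in auto)
  then show ?thesis
    by (simp add: vertex_degree_def card_image[OF inj_on_subset[OF bij_is_inj[OF f(1)] subset_UNIV]])
qed

lemma automorphism_laplacian:
  assumes "graph_automorphism adj f"
  shows "normalized_laplacian adj $ f i $ f j = normalized_laplacian adj $ i $ j"
proof -
  have "f i = f j \<longleftrightarrow> i = j" "adj (f i) (f j) \<longleftrightarrow> adj i j"
    using assms by (auto simp: graph_automorphism_def bij_def inj_eq)
  then show ?thesis by (simp add: normalized_laplacian_def automorphism_degree[OF assms])
qed

text \<open>Invariance under simultaneous permutation of rows and columns is preserved by matrix products.\<close>

lemma automorphism_mat_poly:
  fixes A :: "real^'n^'n"
  assumes f: "bij f" and A: "\<And>i j. A $ f i $ f j = A $ i $ j"
  shows "mat_poly p A $ f i $ f j = mat_poly p A $ i $ j"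
proof -
  have pow: "mat_pow A n $ f i $ f j = mat_pow A n $ i $ j" for n i j
  proof (induction n arbitrary: i j)
    case 0
    show ?case using f by (simp add: mat_def bij_def inj_eq)
  next
    case (Suc n)
    have "(A ** mat_pow A n) $ f i $ f j = (\<Sum>k\<in>UNIV. A $ f i $ f k * mat_pow A n $ f k $ f j)"
      using sum.reindex_bij_betw[OF f, of "\<lambda>k. A $ f i $ k * mat_pow A n $ k $ f j"]
      by (simp add: matrix_matrix_mult_def)
    then show ?case using A Suc by (simp add: matrix_matrix_mult_def)
  qed
  show ?thesis by (simp add: mat_poly_def pow)
qed

text \<open>An automorphism that moves \<open>i\<close> to \<open>j\<close> also moves the \<open>i\<close>-th diagonal entry to the \<open>j\<close>-th.\<close>

lemma vertex_transitive_constant_diagonal: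
  fixes adj :: "'n::finite \<Rightarrow> 'n \<Rightarrow> bool"
  assumes "vertex_transitive adj" and X: "X = mat_poly p (normalized_laplacian adj)"
  shows "X $ i $ i = trace X / real CARD('n)"
proof -
  have "X $ j $ j = X $ i $ i" for j
  proof -
    obtain f where f: "graph_automorphism adj f" "f i = j"
      using assms(1) unfolding vertex_transitive_def by blast
    then show ?thesis
      using automorphism_mat_poly[of f "normalized_laplacian adj" p i i] automorphism_laplacian[OF f(1)]
      by (simp add: X graph_automorphism_def)
  qed
  then have "trace X = (\<Sum>j::'n\<in>UNIV. X $ i $ i)" unfolding trace_def by (intro sum.cong refl)
  then show ?thesis by simp
qed

text \<open>On a \<open>d\<close>-regular graph \<open>L = I - Adj / d\<close>, and \<open>2 x\<^sub>i x\<^sub>j \<le> x\<^sub>i\<^sup>2 + x\<^sub>j\<^sup>2\<close> summed over the edges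
  bounds the form of \<open>Adj\<close> by \<open>d \<bar>x\<bar>\<^sup>2\<close>. If \<open>d = 0\<close>, then \<open>1 / d = 0\<close>
  and \<open>L = I\<close>.\<close>

lemma laplacian_quadratic_nonneg:
  fixes adj :: "'n::finite \<Rightarrow> 'n \<Rightarrow> bool"
  assumes sym: "symp adj" and irr: "irreflp adj" and vt: "vertex_transitive adj"
  shows "0 \<le> x \<bullet> (normalized_laplacian adj *v x)"
proof -
  obtain d where d: "\<And>v. vertex_degree adj v = d"
  proof
    fix v
    obtain f where "graph_automorphism adj f" "f (SOME v. True) = v"
      using vt unfolding vertex_transitive_def by blast
    then show "vertex_degree adj v = vertex_degree adj (SOME v. True)"
      using automorphism_degree[of adj f "SOME v. True"] by simp
  qed
  define s where "s = 1 / real d"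
  define A where "A i j = (if adj i j then 1 else 0 :: real)" for i j
  have entry: "normalized_laplacian adj $ i $ j = (if i = j then 1 else 0) - s * A i j" for i j
    using irr by (auto simp: normalized_laplacian_def d s_def A_def irreflp_def)
  have row: "(\<Sum>j\<in>UNIV. A i j) = real d" for i
    using d[of i] by (simp add: A_def vertex_degree_def sum.If_cases Collect_conv_if)
  have A_sym: "A i j = A j i" for i j using sym by (auto simp: A_def symp_def)
  have s: "0 \<le> s" "s * real d \<le> 1" by (auto simp: s_def)
  have "(\<Sum>i\<in>UNIV. \<Sum>j\<in>UNIV. A i j * (x $ i * x $ j))
      \<le> (\<Sum>i\<in>UNIV. \<Sum>j\<in>UNIV. A i j * (((x $ i)\<^sup>2 + (x $ j)\<^sup>2) / 2))"
  proof (intro sum_mono mult_left_mono)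
    fix i j
    show "x $ i * x $ j \<le> ((x $ i)\<^sup>2 + (x $ j)\<^sup>2) / 2"
      using zero_le_power2[of "x $ i - x $ j"] by (simp add: power2_diff)
  qed (simp add: A_def)
  also have "\<dots> = (\<Sum>i\<in>UNIV. \<Sum>j\<in>UNIV. A i j * (x $ i)\<^sup>2) / 2 + (\<Sum>i\<in>UNIV. \<Sum>j\<in>UNIV. A i j * (x $ j)\<^sup>2) / 2"
    by (simp add: sum.distrib[symmetric] sum_divide_distrib algebra_simps add_divide_distrib)
  also have "(\<Sum>i\<in>UNIV. \<Sum>j\<in>UNIV. A i j * (x $ j)\<^sup>2) = (\<Sum>i\<in>UNIV. \<Sum>j\<in>UNIV. A i j * (x $ i)\<^sup>2)"
    by (subst sum.swap) (simp add: A_sym)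
  also have "(\<Sum>i\<in>UNIV. \<Sum>j\<in>UNIV. A i j * (x $ i)\<^sup>2) = (\<Sum>i\<in>UNIV. (\<Sum>j\<in>UNIV. A i j) * (x $ i)\<^sup>2)"
    by (simp only: sum_distrib_right)
  also have "\<dots> = real d * (\<Sum>i\<in>UNIV. (x $ i)\<^sup>2)" by (simp add: row sum_distrib_left)
  finally have le: "(\<Sum>i\<in>UNIV. \<Sum>j\<in>UNIV. A i j * (x $ i * x $ j)) \<le> real d * (\<Sum>i\<in>UNIV. (x $ i)\<^sup>2)" by simp
  have "x \<bullet> (normalized_laplacian adj *v x)
      = (\<Sum>i\<in>UNIV. \<Sum>j\<in>UNIV. (if i = j then (x $ i)\<^sup>2 else 0) - s * (A i j * (x $ i * x $ j)))"
    by (auto simp: inner_vec_def matrix_vector_mult_def entry sum_distrib_left power2_eq_square algebra_simps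
        intro!: sum.cong)
  also have "\<dots> = (\<Sum>i\<in>UNIV. (x $ i)\<^sup>2) - s * (\<Sum>i\<in>UNIV. \<Sum>j\<in>UNIV. A i j * (x $ i * x $ j))"
    by (simp add: sum_subtractf sum_distrib_left)
  also have "\<dots> \<ge> (\<Sum>i\<in>UNIV. (x $ i)\<^sup>2) - s * (real d * (\<Sum>i\<in>UNIV. (x $ i)\<^sup>2))"
    using le s by (intro diff_left_mono mult_left_mono)
  also have "(\<Sum>i\<in>UNIV. (x $ i)\<^sup>2) - s * (real d * (\<Sum>i\<in>UNIV. (x $ i)\<^sup>2)) = (1 - s * real d) * (\<Sum>i\<in>UNIV. (x $ i)\<^sup>2)"
    by (simp add: algebra_simps)
  also have "\<dots> \<ge> 0" using s by (intro mult_nonneg_nonneg sum_nonneg) auto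
  finally show ?thesis .
qed

section \<open>The equation for the eigenvalues of R\<close>

definition bounded_lipschitz :: "('a::metric_space \<Rightarrow> real) \<Rightarrow> bool" where
  "bounded_lipschitz f \<longleftrightarrow> (\<exists>B. \<forall>x. \<bar>f x\<bar> \<le> B) \<and> (\<exists>K. \<forall>x y. \<bar>f x - f y\<bar> \<le> K * dist x y)"

lemma bounded_lipschitzI:
  assumes "\<And>x. \<bar>f x\<bar> \<le> B" "\<And>x y. \<bar>f x - f y\<bar> \<le> K * dist x y"
  shows "bounded_lipschitz f"
  using assms unfolding bounded_lipschitz_def by blast

lemma bounded_lipschitz_const: "bounded_lipschitz (\<lambda>x. c)"
  by (rule bounded_lipschitzI[of _ "\<bar>c\<bar>" 0]) auto

lemma bounded_lipschitz_mult:
  assumes "bounded_lipschitz f" "bounded_lipschitz g"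
  shows "bounded_lipschitz (\<lambda>x. f x * g x)"
proof -
  obtain B K where f: "\<forall>x. \<bar>f x\<bar> \<le> B" "\<forall>x y. \<bar>f x - f y\<bar> \<le> K * dist x y"
    using assms(1) unfolding bounded_lipschitz_def by blast
  obtain B' K' where g: "\<forall>x. \<bar>g x\<bar> \<le> B'" "\<forall>x y. \<bar>g x - g y\<bar> \<le> K' * dist x y"
    using assms(2) unfolding bounded_lipschitz_def by blast
  have B: "B \<ge> 0" "B' \<ge> 0"
    using f(1)[THEN spec, of undefined] g(1)[THEN spec, of undefined] by auto
  show ?thesis
  proof (rule bounded_lipschitzI[of _ "B * B'" "B' * K + B * K'"])
    fix x y
    show "\<bar>f x * g x\<bar> \<le> B * B'" using f g B by (auto simp: abs_mult intro!: mult_mono)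
    have "f x * g x - f y * g y = (f x - f y) * g x + f y * (g x - g y)" by (simp add: algebra_simps)
    then have "\<bar>f x * g x - f y * g y\<bar> \<le> \<bar>f x - f y\<bar> * \<bar>g x\<bar> + \<bar>f y\<bar> * \<bar>g x - g y\<bar>"
      by (metis abs_mult abs_triangle_ineq)
    also have "\<dots> \<le> (K * dist x y) * B' + B * (K' * dist x y)"
      using f g B order_trans[OF abs_ge_zero, of "f x - f y" "K * dist x y"]
      by (intro add_mono mult_mono) auto
    finally show "\<bar>f x * g x - f y * g y\<bar> \<le> (B' * K + B * K') * dist x y" by (simp add: algebra_simps)
  qed
qed

lemma bounded_lipschitz_prod:
  "(\<And>i. i \<in> I \<Longrightarrow> bounded_lipschitz (f i)) \<Longrightarrow> bounded_lipschitz (\<lambda>x. \<Prod>i\<in>I. f i x)"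
proof (induction I rule: infinite_finite_induct)
  case (insert i I)
  then show ?case using bounded_lipschitz_mult[of "f i" "\<lambda>x. \<Prod>i\<in>I. f i x"] by simp
qed (simp_all add: bounded_lipschitz_const)

text \<open>Since \<open>u - v \<le> u\<^sup>n - v\<^sup>n\<close> for \<open>1 \<le> v \<le> u\<close>.\<close>

lemma root_nonexpansive:
  assumes "n > 0" "1 \<le> x" "1 \<le> y"
  shows "\<bar>root n x - root n y\<bar> \<le> \<bar>x - y\<bar>"
proof -
  have *: "u - v \<le> u ^ n - v ^ n" if "1 \<le> v" "v \<le> u" "n > 0" for u v :: real and n :: nat
    using that(3)
  proof (induction n rule: nat_induct_non_zero)
    case (Suc n)
    have "u - v \<le> u ^ n - v ^ n" by (rule Suc.IH)
    also have "\<dots> \<le> u * (u ^ n - v ^ n)"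
      using that power_mono[of v u n] mult_right_mono[of 1 u "u ^ n - v ^ n"] by simp
    also have "\<dots> \<le> u ^ Suc n - v ^ Suc n"
      using that mult_right_mono[of v u "v ^ n"] by (simp add: algebra_simps)
    finally show ?case .
  qed simp
  show ?thesis
  proof (cases "y \<le> x")
    case True
    then show ?thesis using *[of "root n y" "root n x" n] assms by simp
  next
    case False
    then show ?thesis using *[of "root n x" "root n y" n] assms by simp
  qed
qed

lemma root_prod: "n > 0 \<Longrightarrow> root n (\<Prod>i\<in>I. f i) = (\<Prod>i\<in>I. root n (f i))"
  by (induction I rule: infinite_finite_induct) (auto simp: real_root_mult)

lemma real_mvt:
  fixes f :: "real \<Rightarrow> real"
  assumes "0 < t" "\<And>s. s \<in> {0..t} \<Longrightarrow> (f has_real_derivative f' s) (at s within {0..t})"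
  shows "\<exists>s\<in>{0<..<t}. f t - f 0 = t * f' s"
proof -
  have "\<exists>s\<in>{0<..<t}. f t - f 0 = f' s * (t - 0)"
    by (rule mvt_simple[OF assms(1)]) (use assms(2) in \<open>auto simp: has_field_derivative_def\<close>)
  then show ?thesis by (simp add: mult.commute)
qed

text \<open>Here \<open>l\<close> are the eigenvalues of the Laplacian and \<open>b = a + q\<close>; the unknown is the vector of
  eigenvalues of \<open>R\<close>.\<close>

locale rate_equation =
  fixes l :: "'n::finite \<Rightarrow> real" and b c :: real
  assumes l: "\<And>k. l k \<ge> 0" and b: "b \<ge> 0" and c: "c > 0"
begin

definition one_plus :: "real^'n \<Rightarrow> 'n \<Rightarrow> real" where
  "one_plus \<rho> k = 1 + c * l k * \<rho> $ k"

text \<open>The function \<open>Q\<close> in terms of the eigenvalues.\<close>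

definition geo_mean :: "real^'n \<Rightarrow> real" where
  "geo_mean \<rho> = root CARD('n) (\<Prod>k\<in>UNIV. one_plus \<rho> k)"

definition decay :: "real \<Rightarrow> 'n \<Rightarrow> real" where
  "decay t k = exp (- (t * b * l k))"

text \<open>The scalar factor \<open>Tr[Q'(R) exp (- t b L)] / c\<close> of the equation for \<open>R\<close>.\<close>

definition speed :: "real \<Rightarrow> real^'n \<Rightarrow> real" where
  "speed t \<rho> = (\<Sum>k\<in>UNIV. decay t k * (l k / real CARD('n) * (geo_mean \<rho> * (1 / one_plus \<rho> k))))"

definition rate :: "real \<Rightarrow> real^'n \<Rightarrow> real^'n" where
  "rate t \<rho> = (\<chi> k. speed t \<rho> * decay t k)"

text \<open>Projection to a box. The clipped equation has a globally Lipschitz right-hand side, and an a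
  priori bound shows that its solution stays in a large enough box, where clipping does nothing.\<close>

definition clip :: "real \<Rightarrow> real^'n \<Rightarrow> real^'n" where
  "clip K \<rho> = (\<chi> k. max 0 (min K (\<rho> $ k)))"

lemma one_plus_ge: "0 \<le> \<rho> $ k \<Longrightarrow> 1 \<le> one_plus \<rho> k"
  using l[of k] c by (simp add: one_plus_def)

lemma decay_bounds: "0 < decay t k" "t \<ge> 0 \<Longrightarrow> decay t k \<le> 1"
  using l[of k] b by (auto simp: decay_def)

lemma geo_mean_ge: "(\<And>k. 0 \<le> \<rho> $ k) \<Longrightarrow> 1 \<le> geo_mean \<rho>"
  unfolding geo_mean_def using one_plus_ge by (simp add: prod_ge_1)

lemma speed_nonneg: "(\<And>k. 0 \<le> \<rho> $ k) \<Longrightarrow> 0 \<le> speed t \<rho>"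
  unfolding speed_def
  using decay_bounds(1) l order_trans[OF zero_le_one geo_mean_ge] order_trans[OF zero_le_one one_plus_ge]
  by (intro sum_nonneg mult_nonneg_nonneg divide_nonneg_nonneg) (auto intro: less_imp_le)

lemma geo_mean_le:
  assumes "\<And>k. 0 \<le> \<rho> $ k"
  shows "geo_mean \<rho> \<le> (\<Sum>k\<in>UNIV. one_plus \<rho> k)"
proof -
  let ?S = "\<Sum>k\<in>UNIV. one_plus \<rho> k"
  have pos: "0 \<le> one_plus \<rho> k" for k using one_plus_ge[of \<rho> k] assms[of k] by linarith
  have "(\<Prod>k\<in>UNIV. one_plus \<rho> k) \<le> (\<Prod>k::'n\<in>UNIV. ?S)"
    using pos by (intro prod_mono conjI member_le_sum) auto
  then have "(\<Prod>k\<in>UNIV. one_plus \<rho> k) \<le> ?S ^ CARD('n)" by simp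
  then have "geo_mean \<rho> \<le> root CARD('n) (?S ^ CARD('n))"
    unfolding geo_mean_def by (intro real_root_le_mono) auto
  also have "\<dots> = ?S" using pos by (intro real_root_power_cancel sum_nonneg) auto
  finally show ?thesis .
qed

text \<open>The growth is at most linear because the geometric mean is at most the sum and the other factors
  are bounded.\<close>

lemma speed_le:
  assumes \<rho>: "\<And>k. 0 \<le> \<rho> $ k" and t: "t \<ge> 0"
  shows "speed t \<rho> \<le> (\<Sum>k\<in>UNIV. l k) * (\<Sum>k\<in>UNIV. one_plus \<rho> k)"
proof -
  have "decay t k * (l k / real CARD('n) * (geo_mean \<rho> * (1 / one_plus \<rho> k))) \<le> l k * (\<Sum>k\<in>UNIV. one_plus \<rho> k)" for k
  proof -
    have g: "0 \<le> geo_mean \<rho>" "1 \<le> one_plus \<rho> k" using geo_mean_ge[OF \<rho>] one_plus_ge \<rho> by auto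
    have "geo_mean \<rho> * (1 / one_plus \<rho> k) \<le> geo_mean \<rho> * 1"
      using g by (intro mult_left_mono) auto
    then have 1: "geo_mean \<rho> * (1 / one_plus \<rho> k) \<le> (\<Sum>k\<in>UNIV. one_plus \<rho> k)"
      using geo_mean_le[OF \<rho>] by linarith
    have 2: "l k / real CARD('n) \<le> l k" using l[of k] by (simp add: divide_le_eq mult_right_le_one_le mult_le_cancel_left1 Suc_leI)
    have "l k / real CARD('n) * (geo_mean \<rho> * (1 / one_plus \<rho> k)) \<le> l k * (\<Sum>k\<in>UNIV. one_plus \<rho> k)"
      using 1 2 l[of k] g by (intro mult_mono) auto
    moreover have "decay t k * (l k / real CARD('n) * (geo_mean \<rho> * (1 / one_plus \<rho> k)))
        \<le> 1 * (l k / real CARD('n) * (geo_mean \<rho> * (1 / one_plus \<rho> k)))"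
      using decay_bounds(2)[OF t, of k] l[of k] g by (intro mult_right_mono) auto
    ultimately show ?thesis by linarith
  qed
  then show ?thesis unfolding speed_def sum_distrib_right by (intro sum_mono) auto
qed

lemma clip_bounds: "K \<ge> 0 \<Longrightarrow> 0 \<le> clip K \<rho> $ k" "K \<ge> 0 \<Longrightarrow> clip K \<rho> $ k \<le> K"
  by (auto simp: clip_def)

lemma clip_id: "(\<And>k. 0 \<le> \<rho> $ k \<and> \<rho> $ k \<le> K) \<Longrightarrow> clip K \<rho> = \<rho>"
  by (simp add: clip_def vec_eq_iff)

lemma clip_lipschitz: "\<bar>clip K x $ k - clip K y $ k\<bar> \<le> dist x y"
proof -
  have "\<bar>clip K x $ k - clip K y $ k\<bar> \<le> \<bar>(x - y) $ k\<bar>" by (simp add: clip_def)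
  also have "\<dots> \<le> dist x y" unfolding dist_norm by (rule component_le_norm_cart)
  finally show ?thesis .
qed

lemma one_plus_clip_lipschitz:
  "\<bar>one_plus (clip K x) k - one_plus (clip K y) k\<bar> \<le> c * l k * dist x y"
proof -
  have "one_plus (clip K x) k - one_plus (clip K y) k = c * l k * (clip K x $ k - clip K y $ k)"
    by (simp add: one_plus_def algebra_simps)
  then show ?thesis
    using clip_lipschitz[of K x k y] c l[of k] by (simp add: abs_mult mult_left_mono)
qed

text \<open>Distributing the root over the product turns the geometric mean into a product of bounded
  Lipschitz functions; on the box all factors are at least \<open>1\<close>.\<close>

lemma bounded_lipschitz_coefficient:
  assumes K: "K \<ge> 0"
  shows "bounded_lipschitz (\<lambda>\<rho>. geo_mean (clip K \<rho>) * (1 / one_plus (clip K \<rho>) k))"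
proof (rule bounded_lipschitz_mult)
  have ge: "1 \<le> one_plus (clip K \<rho>) j" for \<rho> j by (intro one_plus_ge clip_bounds K)
  show "bounded_lipschitz (\<lambda>\<rho>. geo_mean (clip K \<rho>))"
    unfolding geo_mean_def root_prod[OF zero_less_card_finite]
  proof (rule bounded_lipschitz_prod)
    fix j :: 'n
    show "bounded_lipschitz (\<lambda>\<rho>. root CARD('n) (one_plus (clip K \<rho>) j))"
    proof (rule bounded_lipschitzI[of _ "1 + c * l j * K" "c * l j"])
      fix x y
      have "root CARD('n) (one_plus (clip K x) j) \<le> root CARD('n) (one_plus (clip K x) j ^ CARD('n))"
        using ge[of x j] by (intro real_root_le_mono self_le_power) auto
      also have "\<dots> = one_plus (clip K x) j" using ge[of x j] by (intro real_root_power_cancel) auto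
      also have "\<dots> \<le> 1 + c * l j * K"
        using clip_bounds(2)[OF K, of x j] c l[of j] by (auto simp: one_plus_def intro!: mult_left_mono)
      finally show "\<bar>root CARD('n) (one_plus (clip K x) j)\<bar> \<le> 1 + c * l j * K"
        using ge[of x j] by simp
      show "\<bar>root CARD('n) (one_plus (clip K x) j) - root CARD('n) (one_plus (clip K y) j)\<bar> \<le> c * l j * dist x y"
        using root_nonexpansive[OF zero_less_card_finite ge ge] one_plus_clip_lipschitz order_trans by blast
    qed
  qed
  show "bounded_lipschitz (\<lambda>\<rho>. 1 / one_plus (clip K \<rho>) k)"
  proof (rule bounded_lipschitzI[of _ 1 "c * l k"])
    fix x y
    let ?u = "one_plus (clip K x) k" and ?v = "one_plus (clip K y) k"
    show "\<bar>1 / ?u\<bar> \<le> 1" using ge[of x k] by simp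
    have "1 * 1 \<le> ?u * ?v" using ge[of x k] ge[of y k] by (intro mult_mono) auto
    moreover have "1 / ?u - 1 / ?v = (?v - ?u) / (?u * ?v)"
      using ge[of x k] ge[of y k] by (simp add: field_simps)
    ultimately have "\<bar>1 / ?u - 1 / ?v\<bar> \<le> \<bar>?u - ?v\<bar>"
      by (simp add: abs_divide abs_minus_commute divide_le_eq mult_le_cancel_left1)
    also have "\<dots> \<le> c * l k * dist x y" by (rule one_plus_clip_lipschitz)
    finally show "\<bar>1 / ?u - 1 / ?v\<bar> \<le> c * l k * dist x y" .
  qed
qed

lemma speed_clip_regular:
  assumes K: "K \<ge> 0"
  obtains C where "C \<ge> 0" "\<And>t x y. t \<ge> 0 \<Longrightarrow> norm (rate t (clip K x) - rate t (clip K y)) \<le> C * norm (x - y)"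
    "continuous_on ({0..T} \<times> UNIV) (\<lambda>(t, \<rho>). rate t (clip K \<rho>))"
proof -
  define h where "h k \<rho> = l k / real CARD('n) * (geo_mean (clip K \<rho>) * (1 / one_plus (clip K \<rho>) k))" for k \<rho>
  have "bounded_lipschitz (h k)" for k
    unfolding h_def[abs_def] by (intro bounded_lipschitz_mult[OF bounded_lipschitz_const] bounded_lipschitz_coefficient K)
  then have "\<forall>k. \<exists>D. \<forall>x y. \<bar>h k x - h k y\<bar> \<le> D * dist x y" by (auto simp: bounded_lipschitz_def)
  then obtain D where D: "\<And>k x y. \<bar>h k x - h k y\<bar> \<le> D k * dist x y" by metis
  have D0: "\<bar>h k x - h k y\<bar> \<le> \<bar>D k\<bar> * dist x y" for k x y
    by (rule order_trans[OF D mult_right_mono]) auto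
  have speed: "speed t (clip K x) = (\<Sum>k\<in>UNIV. decay t k * h k x)" for t x
    by (simp add: speed_def h_def)
  define C where "C = real CARD('n) * (\<Sum>k\<in>UNIV. \<bar>D k\<bar>)"
  have "norm (rate t (clip K x) - rate t (clip K y)) \<le> C * norm (x - y)" if t: "t \<ge> 0" for t x y
  proof -
    have "\<bar>speed t (clip K x) - speed t (clip K y)\<bar> = \<bar>\<Sum>k\<in>UNIV. decay t k * (h k x - h k y)\<bar>"
      by (simp add: speed sum_subtractf right_diff_distrib)
    also have "\<dots> \<le> (\<Sum>k\<in>UNIV. \<bar>decay t k * (h k x - h k y)\<bar>)" by (rule sum_abs)
    also have "\<dots> \<le> (\<Sum>k\<in>UNIV. 1 * (\<bar>D k\<bar> * dist x y))"
      unfolding abs_mult using decay_bounds[of t] t D0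
      by (intro sum_mono mult_mono) (auto simp: less_imp_le)
    also have "\<dots> = (\<Sum>k\<in>UNIV. \<bar>D k\<bar>) * dist x y" by (simp add: sum_distrib_right)
    finally have s: "\<bar>speed t (clip K x) - speed t (clip K y)\<bar> \<le> (\<Sum>k\<in>UNIV. \<bar>D k\<bar>) * dist x y" .
    have "norm (rate t (clip K x) - rate t (clip K y)) \<le> (\<Sum>k\<in>UNIV. \<bar>(rate t (clip K x) - rate t (clip K y)) $ k\<bar>)"
      by (rule norm_le_l1_cart)
    also have "\<dots> \<le> (\<Sum>k::'n\<in>UNIV. (\<Sum>k\<in>UNIV. \<bar>D k\<bar>) * dist x y)"
    proof (rule sum_mono)
      fix k
      have "\<bar>(rate t (clip K x) - rate t (clip K y)) $ k\<bar> = \<bar>speed t (clip K x) - speed t (clip K y)\<bar> * \<bar>decay t k\<bar>"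
        by (simp add: rate_def abs_mult[symmetric] left_diff_distrib)
      also have "\<dots> \<le> \<bar>speed t (clip K x) - speed t (clip K y)\<bar> * 1"
        using decay_bounds[of t k] t by (intro mult_left_mono) auto
      also have "\<dots> \<le> (\<Sum>k\<in>UNIV. \<bar>D k\<bar>) * dist x y" using s by simp
      finally show "\<bar>(rate t (clip K x) - rate t (clip K y)) $ k\<bar> \<le> (\<Sum>k\<in>UNIV. \<bar>D k\<bar>) * dist x y" .
    qed
    also have "\<dots> = C * norm (x - y)" by (simp add: C_def dist_norm mult.assoc)
    finally show ?thesis .
  qed
  moreover have "C \<ge> 0" by (simp add: C_def sum_nonneg)
  moreover have "continuous_on ({0..T} \<times> UNIV) (\<lambda>(t, \<rho>). rate t (clip K \<rho>))"
  proof -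
    have h: "continuous_on UNIV (h k)" for k
    proof (rule continuous_on_iff[THEN iffD2], intro ballI allI impI)
      fix x :: "real^'n" and \<epsilon> :: real assume \<epsilon>: "\<epsilon> > 0"
      have "dist (h k y) (h k x) < \<epsilon>" if "dist y x < \<epsilon> / (\<bar>D k\<bar> + 1)" for y
      proof -
        have "dist (h k y) (h k x) \<le> \<bar>D k\<bar> * dist y x" using D0 by (simp add: dist_real_def)
        also have "\<dots> \<le> (\<bar>D k\<bar> + 1) * dist y x" by (intro mult_right_mono) auto
        also have "\<dots> < \<epsilon>" using that by (simp add: field_simps add_pos_nonneg)
        finally show ?thesis .
      qed
      then show "\<exists>d>0. \<forall>y\<in>UNIV. dist y x < d \<longrightarrow> dist (h k y) (h k x) < \<epsilon>"
        using \<epsilon> by (intro exI[of _ "\<epsilon> / (\<bar>D k\<bar> + 1)"]) (auto simp: add_nonneg_pos)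
    qed
    have h2: "continuous_on ({0..T} \<times> UNIV) (\<lambda>z. h k (snd z))" for k
      by (rule continuous_on_compose2[OF h]) (auto intro!: continuous_intros)
    show ?thesis
      unfolding rate_def speed decay_def case_prod_unfold
      by (intro continuous_on_vec_lambda continuous_intros h2)
  qed
  ultimately show ?thesis using that by blast
qed

definition solves_rate :: "real \<Rightarrow> (real \<Rightarrow> real^'n) \<Rightarrow> bool" where
  "solves_rate T \<rho> \<longleftrightarrow> \<rho> 0 = 0 \<and> (\<forall>t\<in>{0..T}. (\<forall>k. 0 \<le> \<rho> t $ k) \<and>
    (\<rho> has_vector_derivative rate t (\<rho> t)) (at t within {0..T}))"

lemma solves_rate_unique:
  assumes \<rho>: "solves_rate T \<rho>" and s: "solves_rate T s" and t: "t \<in> {0..T}"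
  shows "s t = \<rho> t"
proof -
  have "continuous_on {0..T} \<rho>" "continuous_on {0..T} s"
    by (rule continuous_on_vector_derivative, use assms in \<open>auto simp: solves_rate_def\<close>)+
  then obtain K1 K2 where K: "K1 \<ge> 0" "\<And>t. t \<in> {0..T} \<Longrightarrow> norm (\<rho> t) \<le> K1" "K2 \<ge> 0" "\<And>t. t \<in> {0..T} \<Longrightarrow> norm (s t) \<le> K2"
    using continuous_on_interval_bound[of T \<rho>] continuous_on_interval_bound[of T s] by metis
  define K where "K = max K1 K2"
  have K0: "K \<ge> 0" using K by (simp add: K_def)
  have clip: "clip K (\<rho> u) = \<rho> u" "clip K (s u) = s u" if "u \<in> {0..T}" for u
  proof -
    have "\<bar>\<rho> u $ k\<bar> \<le> K" "\<bar>s u $ k\<bar> \<le> K" for k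
      using component_le_norm_cart[of "\<rho> u" k] component_le_norm_cart[of "s u" k] K(2,4)[OF that]
      by (auto simp: K_def le_max_iff_disj intro: order_trans)
    then show "clip K (\<rho> u) = \<rho> u" "clip K (s u) = s u"
      using assms that by (auto intro!: clip_id simp: solves_rate_def abs_le_iff)
  qed
  obtain C where C: "\<And>t x y. t \<ge> 0 \<Longrightarrow> norm (rate t (clip K x) - rate t (clip K y)) \<le> C * norm (x - y)"
    using speed_clip_regular[OF K0] by metis
  have "s t - \<rho> t = 0"
  proof (rule gronwall_zero[where f' = "\<lambda>t. rate t (s t) - rate t (\<rho> t)" and C = C, OF _ _ _ t])
    fix u assume u: "u \<in> {0..T}"
    show "((\<lambda>t. s t - \<rho> t) has_vector_derivative rate u (s u) - rate u (\<rho> u)) (at u within {0..T})"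
      using assms u by (intro has_vector_derivative_diff) (auto simp: solves_rate_def)
    show "norm (rate u (s u) - rate u (\<rho> u)) \<le> C * norm (s u - \<rho> u)"
      using C[of u "s u" "\<rho> u"] u by (simp add: clip)
  qed (use assms in \<open>simp add: solves_rate_def\<close>)
  then show ?thesis by simp
qed

text \<open>Solve the equation clipped at \<open>K = exp (C T)\<close>. Its solution is nonnegative since the speed is, and
  \<open>m = 1 + \<Sum>\<^sub>k \<rho>\<^sub>k\<close> satisfies \<open>m' \<le> C m\<close>, so it stays below \<open>K\<close> and solves the original equation.\<close>

lemma solves_rate_exists:
  assumes T: "T \<ge> 0"
  obtains \<rho> where "solves_rate T \<rho>"
proof -
  \<comment> \<open>The constant of the linear growth bound for \<open>\<Sum>\<^sub>k \<rho>\<^sub>k\<close>, which holds whatever the size of the box.\<close>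
  define C where "C = real CARD('n) * (\<Sum>k\<in>UNIV. l k) * (real CARD('n) + (\<Sum>k\<in>UNIV. c * l k))"
  define K where "K = exp (C * T)"
  have K0: "K \<ge> 0" by (simp add: K_def)
  obtain D where D: "\<And>t x y. t \<ge> 0 \<Longrightarrow> norm (rate t (clip K x) - rate t (clip K y)) \<le> D * norm (x - y)"
    and cont: "continuous_on ({0..T} \<times> UNIV) (\<lambda>(t, \<rho>). rate t (clip K \<rho>))"
    using speed_clip_regular[OF K0, of T] by metis
  have D': "norm (rate t (clip K x) - rate t (clip K y)) \<le> D * norm (x - y)" if "t \<in> {0..T}" for t x y
    using D that by auto
  obtain \<rho> where \<rho>0: "\<rho> 0 = 0"
    and \<rho>: "\<And>t. t \<in> {0..T} \<Longrightarrow> (\<rho> has_vector_derivative rate t (clip K (\<rho> t))) (at t within {0..T})"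
    using global_ode_solution[OF T cont D'] by metis
  have \<rho>k: "((\<lambda>t. \<rho> t $ k) has_real_derivative speed t (clip K (\<rho> t)) * decay t k) (at t within {0..T})"
    if "t \<in> {0..T}" for t k
    using bounded_linear.has_vector_derivative[OF bounded_linear_vec_nth \<rho>[OF that], of k]
    by (simp add: has_real_derivative_iff_has_vector_derivative rate_def)
  have sp0: "0 \<le> speed t (clip K x)" for t x using clip_bounds(1)[OF K0] by (intro speed_nonneg) auto
  have nonneg: "0 \<le> \<rho> t $ k" if t: "t \<in> {0..T}" for t k
  proof (cases "t = 0")
    case False
    have "\<exists>s\<in>{0<..<t}. \<rho> t $ k - \<rho> 0 $ k = t * (speed s (clip K (\<rho> s)) * decay s k)"
    proof (rule real_mvt)
      fix s assume "s \<in> {0..t}"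
      then show "((\<lambda>t. \<rho> t $ k) has_real_derivative speed s (clip K (\<rho> s)) * decay s k) (at s within {0..t})"
        using has_field_derivative_subset[OF \<rho>k, of s "{0..t}" k] t by (simp add: subset_iff)
    qed (use False t in auto)
    then show ?thesis using \<rho>0 t sp0 decay_bounds(1) by (auto simp: less_imp_le)
  qed (use \<rho>0 in simp)
  define m where "m t = 1 + (\<Sum>k\<in>UNIV. \<rho> t $ k)" for t
  have speed_m: "speed t (clip K (\<rho> t)) * (\<Sum>k\<in>UNIV. decay t k) \<le> C * m t" if t: "t \<in> {0..T}" for t
  proof -
    have cl: "0 \<le> clip K (\<rho> t) $ k" "clip K (\<rho> t) $ k \<le> \<rho> t $ k" for k
      using clip_bounds(1)[OF K0] nonneg[OF t, of k] by (auto simp: clip_def)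
    have "clip K (\<rho> t) $ k \<le> m t" for k
    proof -
      have "\<rho> t $ k \<le> (\<Sum>k\<in>UNIV. \<rho> t $ k)" using nonneg[OF t] by (intro member_le_sum) auto
      then show ?thesis using cl(2)[of k] by (simp add: m_def)
    qed
    moreover have m1: "1 \<le> m t" using nonneg[OF t] by (simp add: m_def sum_nonneg)
    ultimately have "one_plus (clip K (\<rho> t)) k \<le> (1 + c * l k) * m t" for k
      using c l[of k] mult_left_mono[of "clip K (\<rho> t) $ k" "m t" "c * l k"]
      by (simp add: one_plus_def distrib_right add_mono)
    then have "(\<Sum>k\<in>UNIV. one_plus (clip K (\<rho> t)) k) \<le> (\<Sum>k\<in>UNIV. (1 + c * l k) * m t)" by (rule sum_mono)
    also have "\<dots> = (real CARD('n) + (\<Sum>k\<in>UNIV. c * l k)) * m t"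
      by (simp add: sum_distrib_right[symmetric] sum.distrib)
    finally have "(\<Sum>k\<in>UNIV. l k) * (\<Sum>k\<in>UNIV. one_plus (clip K (\<rho> t)) k)
        \<le> (\<Sum>k\<in>UNIV. l k) * ((real CARD('n) + (\<Sum>k\<in>UNIV. c * l k)) * m t)"
      using l by (intro mult_left_mono sum_nonneg) auto
    then have "speed t (clip K (\<rho> t)) \<le> (\<Sum>k\<in>UNIV. l k) * ((real CARD('n) + (\<Sum>k\<in>UNIV. c * l k)) * m t)"
      using speed_le[of "clip K (\<rho> t)" t] cl(1) t by auto
    moreover have "(\<Sum>k\<in>UNIV. decay t k) \<le> (\<Sum>k::'n\<in>UNIV. 1)" using decay_bounds(2) t by (intro sum_mono) auto
    moreover have "0 \<le> (\<Sum>k\<in>UNIV. decay t k)" using decay_bounds(1) by (intro sum_nonneg) (auto intro: less_imp_le)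
    ultimately have "speed t (clip K (\<rho> t)) * (\<Sum>k\<in>UNIV. decay t k)
        \<le> ((\<Sum>k\<in>UNIV. l k) * ((real CARD('n) + (\<Sum>k\<in>UNIV. c * l k)) * m t)) * real CARD('n)"
      using sp0[of t "\<rho> t"] by (intro mult_mono) auto
    then show ?thesis by (simp add: C_def mult_ac)
  qed
  have m_le: "m t \<le> exp (C * t)" if t: "t \<in> {0..T}" for t
  proof (cases "t = 0")
    case False
    define m' where "m' s = exp (- C * s) * (speed s (clip K (\<rho> s)) * (\<Sum>k\<in>UNIV. decay s k) - C * m s)" for s
    have "\<exists>s\<in>{0<..<t}. exp (- C * t) * m t - exp (- C * 0) * m 0 = t * m' s"
    proof (rule real_mvt)
      fix s assume s: "s \<in> {0..t}"
      have "((\<lambda>t. \<rho> t $ k) has_real_derivative speed s (clip K (\<rho> s)) * decay s k) (at s within {0..t})" for k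
        using has_field_derivative_subset[OF \<rho>k, of s "{0..t}" k] t s by (simp add: subset_iff)
      then have "(m has_real_derivative speed s (clip K (\<rho> s)) * (\<Sum>k\<in>UNIV. decay s k)) (at s within {0..t})"
        unfolding m_def[abs_def] by (auto intro!: derivative_eq_intros simp: sum_distrib_left)
      then show "((\<lambda>s. exp (- C * s) * m s) has_real_derivative m' s) (at s within {0..t})"
        unfolding m'_def by (auto intro!: derivative_eq_intros simp: algebra_simps)
    qed (use False t in auto)
    then obtain s where s: "s \<in> {0<..<t}" "exp (- C * t) * m t - m 0 = t * m' s" by auto
    have "m' s \<le> 0" using speed_m[of s] s t by (simp add: m'_def mult_le_0_iff)
    then have "exp (- C * t) * m t \<le> 1" using s t \<rho>0 mult_nonneg_nonpos[of t "m' s"] by (simp add: m_def)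
    then show ?thesis by (simp add: exp_minus field_simps)
  qed (simp add: m_def \<rho>0)
  have clip: "clip K (\<rho> t) = \<rho> t" if t: "t \<in> {0..T}" for t
  proof (rule clip_id)
    fix k
    have "\<rho> t $ k \<le> (\<Sum>k\<in>UNIV. \<rho> t $ k)" using nonneg[OF t] by (intro member_le_sum) auto
    also have "\<dots> \<le> exp (C * t)" using m_le[OF t] by (simp add: m_def)
    also have "\<dots> \<le> K"
    proof -
      have "C \<ge> 0" unfolding C_def using l c by (intro mult_nonneg_nonneg add_nonneg_nonneg sum_nonneg) auto
      then show ?thesis using t by (simp add: K_def mult_left_mono)
    qed
    finally show "0 \<le> \<rho> t $ k \<and> \<rho> t $ k \<le> K" using nonneg[OF t] by auto
  qed
  show ?thesis
    using \<rho>0 \<rho> nonneg clip by (intro that[of \<rho>]) (auto simp: solves_rate_def)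
qed

text \<open>This keeps \<open>R t\<close> inside the polynomials of \<open>L\<close>.\<close>

lemma solves_rate_equal_eigenvalues:
  assumes \<rho>: "solves_rate T \<rho>" and km: "l k = l m" and t: "t \<in> {0..T}"
  shows "\<rho> t $ k = \<rho> t $ m"
proof -
  have "\<rho> t $ k - \<rho> t $ m = 0"
  proof (rule gronwall_zero[where f' = "\<lambda>_. 0" and C = 0, OF _ _ _ t])
    fix s assume "s \<in> {0..T}"
    then have d: "(\<rho> has_vector_derivative rate s (\<rho> s)) (at s within {0..T})" using \<rho> by (simp add: solves_rate_def)
    from has_vector_derivative_diff[OF bounded_linear.has_vector_derivative[OF bounded_linear_vec_nth this, of k]
        bounded_linear.has_vector_derivative[OF bounded_linear_vec_nth this, of m]]
    show "((\<lambda>t. \<rho> t $ k - \<rho> t $ m) has_vector_derivative 0) (at s within {0..T})"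
      by (simp add: rate_def decay_def km)
  qed (use \<rho> in \<open>simp_all add: solves_rate_def\<close>)
  then show ?thesis by simp
qed

end

text \<open>In reversed time, \<open>feedback_eigenvalue\<close> lists the eigenvalues of \<open>A = P - b L\<close> along a given
  solution, and \<open>mean_eigenvalue\<close> is the normalising factor of the matrices \<open>F\<^sup>i\<close>.\<close>

locale rate_solution = rate_equation l b c
  for l :: "'n::finite \<Rightarrow> real" and b c +
  fixes T :: real and \<rho> :: "real \<Rightarrow> real^'n"
  assumes pos: "\<exists>k. l k > 0" and \<rho>: "solves_rate T \<rho>"
begin

definition weight :: "real \<Rightarrow> 'n \<Rightarrow> real" where
  "weight s k = c * l k * decay s k / one_plus (\<rho> s) k"

definition mean_weight :: "real \<Rightarrow> real" where
  "mean_weight s = (\<Sum>k\<in>UNIV. weight s k) / real CARD('n)"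

definition feedback_eigenvalue :: "real \<Rightarrow> 'n \<Rightarrow> real" where
  "feedback_eigenvalue s k = speed s (\<rho> s) * weight s k"

definition mean_eigenvalue :: "real \<Rightarrow> real" where
  "mean_eigenvalue s = (\<Sum>k\<in>UNIV. feedback_eigenvalue s k) / real CARD('n)"

lemma rho_nonneg: "s \<in> {0..T} \<Longrightarrow> 0 \<le> \<rho> s $ k"
  using \<rho> by (simp add: solves_rate_def)

lemma one_plus_rho: "s \<in> {0..T} \<Longrightarrow> 1 \<le> one_plus (\<rho> s) k"
  by (rule one_plus_ge[OF rho_nonneg])

lemma weight_nonneg: "s \<in> {0..T} \<Longrightarrow> 0 \<le> weight s k"
  unfolding weight_def
  using l[of k] c decay_bounds(1)[of s k] one_plus_rho[of s k] by simp

lemma mean_weight_pos: assumes s: "s \<in> {0..T}" shows "0 < mean_weight s"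
proof -
  obtain k where "l k > 0" using pos by blast
  then have "0 < weight s k"
    unfolding weight_def using c decay_bounds(1)[of s k] one_plus_rho[OF s, of k] by simp
  then have "0 < (\<Sum>k\<in>UNIV. weight s k)"
    using weight_nonneg[OF s] by (intro sum_pos2[of UNIV k]) auto
  then show ?thesis by (simp add: mean_weight_def)
qed

lemma speed_eq: "speed s (\<rho> s) = geo_mean (\<rho> s) * mean_weight s / c"
proof -
  have "decay s k * (l k / real CARD('n) * (geo_mean (\<rho> s) * (1 / one_plus (\<rho> s) k)))
      = geo_mean (\<rho> s) * weight s k / real CARD('n) / c" for k
    using c by (simp add: weight_def mult_ac)
  then have "speed s (\<rho> s) = (\<Sum>k\<in>UNIV. geo_mean (\<rho> s) * weight s k / real CARD('n) / c)"
    by (simp add: speed_def)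
  then show ?thesis by (simp add: mean_weight_def sum_distrib_left sum_divide_distrib)
qed

lemma mean_eigenvalue_eq: "mean_eigenvalue s = speed s (\<rho> s) * mean_weight s"
  unfolding mean_eigenvalue_def feedback_eigenvalue_def mean_weight_def
  by (simp add: sum_distrib_left sum_divide_distrib mult_ac divide_inverse)

lemma speed_pos: assumes s: "s \<in> {0..T}" shows "0 < speed s (\<rho> s)"
proof -
  have "1 \<le> geo_mean (\<rho> s)" by (rule geo_mean_ge[OF rho_nonneg[OF s]])
  then show ?thesis using mean_weight_pos[OF s] c by (simp add: speed_eq)
qed

lemma mean_eigenvalue_pos: "s \<in> {0..T} \<Longrightarrow> 0 < mean_eigenvalue s"
  by (simp add: mean_eigenvalue_eq speed_pos mean_weight_pos)

lemma rho_derivative: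
  assumes s: "s \<in> {0..T}"
  shows "((\<lambda>s. \<rho> s $ k) has_real_derivative speed s (\<rho> s) * decay s k) (at s within {0..T})"
proof -
  have "(\<rho> has_vector_derivative rate s (\<rho> s)) (at s within {0..T})"
    using \<rho> s by (simp add: solves_rate_def)
  from bounded_linear.has_vector_derivative[OF bounded_linear_vec_nth this, of k]
  show ?thesis by (simp add: has_real_derivative_iff_has_vector_derivative rate_def)
qed

lemma one_plus_derivative:
  assumes s: "s \<in> {0..T}"
  shows "((\<lambda>s. one_plus (\<rho> s) k) has_real_derivative feedback_eigenvalue s k * one_plus (\<rho> s) k) (at s within {0..T})"
  unfolding one_plus_def
  using one_plus_rho[OF s, of k] rho_derivative[OF s, of k]
  by (auto intro!: derivative_eq_intros simp: feedback_eigenvalue_def weight_def one_plus_def)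

lemma weight_derivative:
  assumes s: "s \<in> {0..T}"
  shows "((\<lambda>s. weight s k) has_real_derivative - weight s k * (b * l k + feedback_eigenvalue s k)) (at s within {0..T})"
proof -
  have "((\<lambda>s. decay s k) has_real_derivative - (b * l k) * decay s k) (at s within {0..T})"
    unfolding decay_def by (auto intro!: derivative_eq_intros)
  moreover have "one_plus (\<rho> s) k \<noteq> 0" using one_plus_rho[OF s, of k] by linarith
  ultimately show ?thesis
    unfolding weight_def
    by (auto intro!: derivative_eq_intros one_plus_derivative[OF s] simp: field_simps)
qed

text \<open>Differentiate the logarithm: \<open>log Q\<close> is the mean of the \<open>log (1 + c l\<^sub>k \<rho>\<^sub>k)\<close>, whose derivatives are
  the eigenvalues of \<open>A\<close>.\<close>

lemma geo_mean_derivative: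
  assumes s: "s \<in> {0..T}"
  shows "((\<lambda>s. geo_mean (\<rho> s)) has_real_derivative geo_mean (\<rho> s) * mean_eigenvalue s) (at s within {0..T})"
proof -
  define g where "g s = (\<Sum>k\<in>UNIV. ln (one_plus (\<rho> s) k)) / real CARD('n)" for s
  \<comment> \<open>The geometric mean as the exponential of the mean logarithm.\<close>
  define h where "h s = exp (g s)" for s
  have eq: "h s = geo_mean (\<rho> s)" if s: "s \<in> {0..T}" for s
  proof -
    have p: "0 < one_plus (\<rho> s) k" for k using one_plus_rho[OF s, of k] by linarith
    then have "geo_mean (\<rho> s) = (\<Prod>k\<in>UNIV. one_plus (\<rho> s) k) powr (1 / real CARD('n))"
      unfolding geo_mean_def by (intro root_powr_inverse prod_nonneg) (auto intro: less_imp_le)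
    also have "\<dots> = h s"
      using p by (simp add: powr_def h_def g_def ln_prod prod_pos less_imp_neq[THEN not_sym])
    finally show ?thesis by simp
  qed
  have "((\<lambda>s. ln (one_plus (\<rho> s) k)) has_real_derivative feedback_eigenvalue s k) (at s within {0..T})" for k
    using one_plus_rho[OF s, of k]
    by (auto intro!: derivative_eq_intros one_plus_derivative[OF s])
  then have "(g has_real_derivative mean_eigenvalue s) (at s within {0..T})"
    unfolding g_def[abs_def] mean_eigenvalue_def by (intro DERIV_cdivide DERIV_sum)
  then have "(h has_real_derivative h s * mean_eigenvalue s) (at s within {0..T})"
    unfolding h_def[abs_def] by (auto intro!: derivative_eq_intros)
  then have "(h has_real_derivative geo_mean (\<rho> s) * mean_eigenvalue s) (at s within {0..T})"
    unfolding eq[OF s] .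
  then show ?thesis
    by (rule has_field_derivative_transform_within[OF _ zero_less_one s]) (simp add: eq)
qed

text \<open>The function \<open>\<kappa>\<close>: the logarithmic derivative of the speed, namely the sum of those of the
  geometric mean and of the mean weight.\<close>

definition drift :: "real \<Rightarrow> real" where
  "drift s = mean_eigenvalue s + (\<Sum>k\<in>UNIV. - weight s k * (b * l k + feedback_eigenvalue s k)) / real CARD('n) / mean_weight s"

lemma mean_weight_derivative:
  assumes s: "s \<in> {0..T}"
  shows "(mean_weight has_real_derivative mean_weight s * (drift s - mean_eigenvalue s)) (at s within {0..T})"
proof -
  have "(mean_weight has_real_derivative (\<Sum>k\<in>UNIV. - weight s k * (b * l k + feedback_eigenvalue s k)) / real CARD('n)) (at s within {0..T})"
    unfolding mean_weight_def[abs_def] by (auto intro!: derivative_eq_intros weight_derivative[OF s])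
  then show ?thesis using mean_weight_pos[OF s] by (simp add: drift_def)
qed

lemma speed_derivative:
  assumes s: "s \<in> {0..T}"
  shows "((\<lambda>s. speed s (\<rho> s)) has_real_derivative speed s (\<rho> s) * drift s) (at s within {0..T})"
proof -
  have "((\<lambda>s. geo_mean (\<rho> s) * mean_weight s / c) has_real_derivative speed s (\<rho> s) * drift s) (at s within {0..T})"
    using c by (auto intro!: derivative_eq_intros geo_mean_derivative[OF s] mean_weight_derivative[OF s]
      simp: speed_eq field_simps)
  then show ?thesis
    by (rule has_field_derivative_transform_within[OF _ zero_less_one s]) (simp add: speed_eq)
qed

lemma feedback_eigenvalue_derivative:
  assumes s: "s \<in> {0..T}"
  shows "((\<lambda>s. feedback_eigenvalue s k) has_real_derivative
    feedback_eigenvalue s k * (drift s - b * l k - feedback_eigenvalue s k)) (at s within {0..T})"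
  unfolding feedback_eigenvalue_def[abs_def]
  by (auto intro!: derivative_eq_intros speed_derivative[OF s] weight_derivative[OF s] simp: feedback_eigenvalue_def algebra_simps)

text \<open>As \<open>\<lambda> = r \<gamma>\<close>, its logarithmic derivative is \<open>\<kappa> + (\<kappa> - \<lambda>)\<close>: the relation \<open>c r = Q \<gamma>\<close> makes
  \<open>\<kappa> - \<lambda>\<close> the logarithmic derivative of \<open>\<gamma>\<close>.\<close>

lemma mean_eigenvalue_derivative:
  assumes s: "s \<in> {0..T}"
  shows "(mean_eigenvalue has_real_derivative mean_eigenvalue s * (2 * drift s - mean_eigenvalue s)) (at s within {0..T})"
  unfolding mean_eigenvalue_eq[abs_def]
  by (auto intro!: derivative_eq_intros speed_derivative[OF s] mean_weight_derivative[OF s] simp: mean_eigenvalue_eq algebra_simps)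

lemma feedback_eigenvalue_equal:
  assumes s: "s \<in> {0..T}" and km: "l k = l m"
  shows "feedback_eigenvalue s k = feedback_eigenvalue s m"
  by (simp add: feedback_eigenvalue_def weight_def one_plus_def decay_def km solves_rate_equal_eigenvalues[OF \<rho> km s])

end

section \<open>The coupled Riccati system\<close>

lemma has_vector_derivative_vec_lambda:
  fixes f :: "'n::finite \<Rightarrow> real \<Rightarrow> 'b::euclidean_space"
  assumes "\<And>i. (f i has_vector_derivative f' i) (at t within S)"
  shows "((\<lambda>t. \<chi> i. f i t) has_vector_derivative (\<chi> i. f' i)) (at t within S)"
proof -
  have axis: "bounded_linear (axis i :: 'b \<Rightarrow> 'b^'n)" for i
    by (rule linear_conv_bounded_linear[THEN iffD1]) (auto intro!: linearI simp: vec_eq_iff axis_def)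
  have decomp: "(\<chi> i. g i) = (\<Sum>i\<in>UNIV. axis i (g i))" for g :: "'n \<Rightarrow> 'b"
    by (simp add: vec_eq_iff axis_def if_distrib cong: if_cong)
  show ?thesis
    unfolding decomp
    by (intro has_vector_derivative_sum bounded_linear.has_vector_derivative[OF axis] assms)
qed

lemma has_vector_derivative_reverse:
  fixes f :: "real \<Rightarrow> 'b::real_normed_vector"
  assumes f: "\<And>s. s \<in> {0..T} \<Longrightarrow> (f has_vector_derivative f' s) (at s within {0..T})" and t: "t \<in> {0..T}"
  shows "((\<lambda>t. f (T - t)) has_vector_derivative - f' (T - t)) (at t within {0..T})"
proof -
  have im: "(\<lambda>t. T - t) ` {0..T} = {0..T}" by (auto simp: image_iff intro!: bexI[of _ "T - _"])
  have "((\<lambda>t. T - t) has_vector_derivative - 1) (at t within {0..T})"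
    by (auto intro!: derivative_eq_intros)
  moreover have "(f has_vector_derivative f' (T - t)) (at (T - t) within (\<lambda>t. T - t) ` {0..T})"
    using f[of "T - t"] t unfolding im by auto
  ultimately have "(f \<circ> (\<lambda>t. T - t) has_vector_derivative - 1 *\<^sub>R f' (T - t)) (at t within {0..T})"
    by (rule vector_diff_chain_within)
  then show ?thesis by (simp add: o_def)
qed

text \<open>The system prescribes the derivative of the tuple \<open>(F\<^sup>1, \<dots>, F\<^sup>N)\<close> as a constant plus a linear map
  plus a bilinear map on the diagonal. Two solutions are bounded on \<open>[0, T]\<close>, so the
  right-hand side is Lipschitz along them; in reversed time both start at the same value.\<close>

lemma solves_riccati_unique:
  fixes F G :: "'n::finite \<Rightarrow> real \<Rightarrow> real^'n^'n"
  assumes F: "solves_riccati L a q \<epsilon> c T F" and G: "solves_riccati L a q \<epsilon> c T G" and t: "t \<in> {0..T}"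
  shows "G i t = F i t"
proof -
  define M where "M = (a + q) *\<^sub>R L"
  \<comment> \<open>The bilinear and the linear part of the vector field of the system.\<close>
  define \<beta> :: "real^'n^'n^'n \<Rightarrow> real^'n^'n^'n \<Rightarrow> real^'n^'n^'n" where
    "\<beta> Z Y = (\<chi> i. (\<Sum>j\<in>UNIV. Z $ j ** unit_outer j ** Y $ i) + (\<Sum>j\<in>UNIV. Y $ i ** unit_outer j ** Z $ j)
      - Z $ i ** unit_outer i ** Y $ i)" for Z Y
  define \<Lambda> :: "real^'n^'n^'n \<Rightarrow> real^'n^'n^'n" where
    "\<Lambda> Z = (\<chi> i. (\<Sum>j\<in>UNIV. M ** unit_outer j ** Z $ i) + (\<Sum>j\<in>UNIV. Z $ i ** unit_outer j ** M))" for Z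
  define \<Phi> where "\<Phi> Z = \<Lambda> Z + \<beta> Z Z - (\<epsilon> - q\<^sup>2) *\<^sub>R (\<chi> i. L ** unit_outer i ** L)" for Z
  note mm = matrix_mult.add_left matrix_mult.add_right matrix_mult.scaleR_left matrix_mult.scaleR_right
  have \<beta>: "bounded_bilinear \<beta>"
    unfolding bilinear_conv_bounded_bilinear[symmetric] bilinear_def
    by (intro conjI allI linearI; rule vec_eq_iff[THEN iffD2], rule allI)
      (simp_all add: \<beta>_def mm sum.distrib scaleR_sum_right algebra_simps)
  have \<Lambda>: "bounded_linear \<Lambda>"
    unfolding linear_conv_bounded_linear[symmetric]
    by (intro linearI; rule vec_eq_iff[THEN iffD2], rule allI)
      (simp_all add: \<Lambda>_def mm sum.distrib scaleR_sum_right algebra_simps)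
  have deriv: "((\<lambda>t. \<chi> i. H i t) has_vector_derivative \<Phi> (\<chi> i. H i t)) (at t within {0..T})"
    if H: "solves_riccati L a q \<epsilon> c T H" and t: "t \<in> {0..T}" for H :: "'n \<Rightarrow> real \<Rightarrow> real^'n^'n" and t
  proof -
    have "(H i has_vector_derivative \<Phi> (\<chi> i. H i t) $ i) (at t within {0..T})" for i
    proof -
      from H[unfolded solves_riccati_def, THEN conjunct2, THEN conjunct2, THEN spec[of _ i], THEN bspec[OF _ t]]
      obtain D where D: "(H i has_vector_derivative D) (at t within {0..T})"
        and eq: "D + (\<Sum>j\<in>UNIV. (- M - H j t) ** unit_outer j ** H i t)
        + (\<Sum>j\<in>UNIV. H i t ** unit_outer j ** (- M - H j t))
        + (\<epsilon> - q\<^sup>2) *\<^sub>R (L ** unit_outer i ** L) + H i t ** unit_outer i ** H i t = 0"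
        unfolding M_def by (elim exE conjE)
      have "D = - ((\<Sum>j\<in>UNIV. (- M - H j t) ** unit_outer j ** H i t)
        + (\<Sum>j\<in>UNIV. H i t ** unit_outer j ** (- M - H j t))
        + (\<epsilon> - q\<^sup>2) *\<^sub>R (L ** unit_outer i ** L) + H i t ** unit_outer i ** H i t)"
        using eq by (simp only: eq_neg_iff_add_eq_0 add.assoc)
      also have "\<dots> = \<Phi> (\<chi> i. H i t) $ i"
        by (simp add: \<Phi>_def \<Lambda>_def \<beta>_def matrix_mult.diff_left matrix_mult.diff_right matrix_mult.minus_left
            matrix_mult.minus_right sum_subtractf sum_negf)
      finally show ?thesis using D by simp
    qed
    from has_vector_derivative_vec_lambda[of H "\<lambda>i. \<Phi> (\<chi> i. H i t) $ i", OF this] show ?thesis by simp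
  qed
  define Z where "Z t = (\<chi> i. F i t)" for t
  define Y where "Y t = (\<chi> i. G i t)" for t
  note dZ = deriv[OF F, folded Z_def[abs_def], folded Z_def]
  note dY = deriv[OF G, folded Y_def[abs_def], folded Y_def]
  have "continuous_on {0..T} Z" "continuous_on {0..T} Y"
    by (rule continuous_on_vector_derivative, erule dZ, rule continuous_on_vector_derivative, erule dY)
  then obtain K1 K2 where K: "K1 \<ge> 0" "\<And>t. t \<in> {0..T} \<Longrightarrow> norm (Z t) \<le> K1" "K2 \<ge> 0" "\<And>t. t \<in> {0..T} \<Longrightarrow> norm (Y t) \<le> K2"
    using continuous_on_interval_bound[of T Z] continuous_on_interval_bound[of T Y] by metis
  obtain B1 where B1: "\<And>Z Y. norm (\<beta> Z Y) \<le> norm Z * norm Y * B1" "B1 \<ge> 0"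
    using bounded_bilinear.nonneg_bounded[OF \<beta>] by blast
  obtain B2 where B2: "\<And>Z. norm (\<Lambda> Z) \<le> norm Z * B2"
    using bounded_linear.bounded[OF \<Lambda>] by blast
  have lip: "norm (\<Phi> (Y s) - \<Phi> (Z s)) \<le> (B2 + K2 * B1 + K1 * B1) * norm (Y s - Z s)" if s: "s \<in> {0..T}" for s
  proof -
    have "\<Phi> (Y s) - \<Phi> (Z s) = \<Lambda> (Y s - Z s) + (\<beta> (Y s) (Y s - Z s) + \<beta> (Y s - Z s) (Z s))"
      by (simp add: \<Phi>_def linear_diff[OF bounded_linear.linear[OF \<Lambda>]] bounded_bilinear.diff_left[OF \<beta>]
          bounded_bilinear.diff_right[OF \<beta>])
    also have "norm \<dots> \<le> norm (\<Lambda> (Y s - Z s)) + (norm (\<beta> (Y s) (Y s - Z s)) + norm (\<beta> (Y s - Z s) (Z s)))"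
      by (intro order_trans[OF norm_triangle_ineq] add_left_mono norm_triangle_ineq)
    also have "\<dots> \<le> norm (Y s - Z s) * B2 + (norm (Y s) * norm (Y s - Z s) * B1 + norm (Y s - Z s) * norm (Z s) * B1)"
      by (intro add_mono B1 B2)
    also have "\<dots> \<le> norm (Y s - Z s) * B2 + (K2 * norm (Y s - Z s) * B1 + norm (Y s - Z s) * K1 * B1)"
      using K(2,4)[OF s] B1(2) by (intro add_mono mult_right_mono mult_left_mono order_refl) auto
    finally show ?thesis by (simp add: algebra_simps)
  qed
  have "Y (T - (T - t)) - Z (T - (T - t)) = 0"
  proof (rule gronwall_zero[where f = "\<lambda>t. Y (T - t) - Z (T - t)" and f' = "\<lambda>t. - \<Phi> (Y (T - t)) - - \<Phi> (Z (T - t))"])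
    fix s assume s: "s \<in> {0..T}"
    show "((\<lambda>t. Y (T - t) - Z (T - t)) has_vector_derivative - \<Phi> (Y (T - s)) - - \<Phi> (Z (T - s))) (at s within {0..T})"
      by (intro has_vector_derivative_diff has_vector_derivative_reverse[where f = Y and f' = "\<lambda>s. \<Phi> (Y s)"]
          has_vector_derivative_reverse[where f = Z and f' = "\<lambda>s. \<Phi> (Z s)"] dZ dY s)
    show "norm (- \<Phi> (Y (T - s)) - - \<Phi> (Z (T - s))) \<le> (B2 + K2 * B1 + K1 * B1) * norm (Y (T - s) - Z (T - s))"
      using lip[of "T - s"] s by (simp add: norm_minus_commute)
  next
    show "Y (T - 0) - Z (T - 0) = 0"
      using F G by (simp add: Y_def Z_def solves_riccati_def vec_eq_iff)
  qed (use t in auto)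
  then have "Y t = Z t" by simp
  then show ?thesis by (simp add: Y_def Z_def vec_eq_iff)
qed

text \<open>As \<open>e\<^sub>j\<^sup>T A e\<^sub>j = \<mu>\<close> for every \<open>j\<close>, the normalisation gives \<open>F\<^sup>j e\<^sub>j = A e\<^sub>j\<close>. The sums over the players
  then only involve \<open>\<Sum>\<^sub>j e\<^sub>j e\<^sub>j\<^sup>T = I\<close>.\<close>

lemma rank_one_riccati:
  fixes A :: "real^'n^'n"
  assumes diag: "\<And>j. A $ j $ j = \<mu>" and \<mu>: "\<mu> \<noteq> 0"
  defines "F \<equiv> \<lambda>i. (1 / \<mu>) *\<^sub>R (A ** unit_outer i ** A)"
  shows "(\<Sum>j\<in>UNIV. (- M - F j) ** unit_outer j ** F i) = - ((M + A) ** F i)"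
    and "(\<Sum>j\<in>UNIV. F i ** unit_outer j ** (- M - F j)) = - (F i ** (M + A))"
    and "F i ** unit_outer i ** F i = A ** unit_outer i ** A"
proof -
  have EAE: "unit_outer j ** A ** unit_outer j = \<mu> *\<^sub>R unit_outer j" for j
    by (simp add: vec_eq_iff matrix_mult_unit_outer diag) (auto simp: unit_outer_def axis_def)
  have FE: "F j ** unit_outer j = A ** unit_outer j" for j
  proof -
    have "F j ** unit_outer j = (1 / \<mu>) *\<^sub>R (A ** (unit_outer j ** A ** unit_outer j))"
      by (simp add: F_def matrix_mult.scaleR_left matrix_mul_assoc)
    then show ?thesis using \<mu> by (simp add: EAE matrix_mult.scaleR_right)
  qed
  have EF: "unit_outer j ** F j = unit_outer j ** A" for j
  proof -
    have "unit_outer j ** F j = (1 / \<mu>) *\<^sub>R ((unit_outer j ** A ** unit_outer j) ** A)"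
      by (simp add: F_def matrix_mult.scaleR_right matrix_mul_assoc)
    then show ?thesis using \<mu> by (simp add: EAE matrix_mult.scaleR_left)
  qed
  have sumE: "(\<Sum>j\<in>UNIV. X ** unit_outer j) = X" "(\<Sum>j\<in>UNIV. unit_outer j ** X) = X" for X :: "real^'n^'n"
    by (simp_all add: sum_mult_unit_outer vec_eq_iff transpose_def)
  have "(\<Sum>j\<in>UNIV. (- M - F j) ** unit_outer j ** F i) = (\<Sum>j\<in>UNIV. (- M - A) ** unit_outer j) ** F i"
    unfolding matrix_mult.sum_left by (intro sum.cong refl) (simp add: matrix_mult.diff_left FE)
  then show "(\<Sum>j\<in>UNIV. (- M - F j) ** unit_outer j ** F i) = - ((M + A) ** F i)"
    unfolding sumE by (simp add: matrix_mult.diff_left matrix_mult.minus_left matrix_mult.add_left)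
  have "(\<Sum>j\<in>UNIV. F i ** unit_outer j ** (- M - F j)) = F i ** (\<Sum>j\<in>UNIV. unit_outer j ** (- M - A))"
    unfolding matrix_mult.sum_right by (intro sum.cong refl) (simp add: matrix_mul_assoc[symmetric] matrix_mult.diff_right EF)
  then show "(\<Sum>j\<in>UNIV. F i ** unit_outer j ** (- M - F j)) = - (F i ** (M + A))"
    unfolding sumE by (simp add: matrix_mult.diff_right matrix_mult.minus_right matrix_mult.add_right)
  have "F i ** unit_outer i ** F i = A ** (unit_outer i ** F i)" by (simp add: FE matrix_mul_assoc)
  then show "F i ** unit_outer i ** F i = A ** unit_outer i ** A" by (simp add: EF matrix_mul_assoc)
qed

context rate_equation
begin

context
  fixes e :: "'n \<Rightarrow> real^'n" and L :: "real^'n^'n"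
  assumes frame: "orthonormal_frame e" and L: "L = spectral e l"
begin

lemma decay_matrix: "mat_exp (- (t * b) *\<^sub>R L) = spectral e (decay t)"
  by (simp add: L spectral_scaleR[OF frame] spectral_mat_exp[OF frame] decay_def[abs_def] mult.assoc)

lemma one_plus_matrix: "mat 1 + c *\<^sub>R (spectral e (\<lambda>k. x $ k) ** L) = spectral e (one_plus x)"
  by (simp add: L spectral_mult[OF frame] spectral_scaleR[OF frame] spectral_add[OF frame]
      spectral_one[OF frame, symmetric] one_plus_def[abs_def] mult_ac)

lemma ode_rhs_spectral:
  assumes x: "\<And>k. 0 \<le> x $ k"
  shows "(1 / c * trace (Q_deriv L c (spectral e (\<lambda>k. x $ k)) ** mat_exp (- (t * b) *\<^sub>R L))) *\<^sub>R mat_exp (- (t * b) *\<^sub>R L)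
    = spectral e (\<lambda>k. rate t x $ k)"
proof -
  have "one_plus x k \<noteq> 0" for k using one_plus_ge[OF x, of k] by linarith
  then have "Q_deriv L c (spectral e (\<lambda>k. x $ k))
      = spectral e (\<lambda>k. 1 / real CARD('n) * geo_mean x * (1 / one_plus x k * (c * l k)))"
    unfolding Q_deriv_def Q_fun_def one_plus_matrix
    by (simp add: spectral_inverse[OF frame] spectral_det[OF frame] geo_mean_def L
        spectral_scaleR[OF frame] spectral_mult[OF frame])
  then have "1 / c * trace (Q_deriv L c (spectral e (\<lambda>k. x $ k)) ** mat_exp (- (t * b) *\<^sub>R L))
      = 1 / c * (\<Sum>k\<in>UNIV. 1 / real CARD('n) * geo_mean x * (1 / one_plus x k * (c * l k)) * decay t k)"
    unfolding decay_matrix by (simp only: spectral_mult[OF frame] spectral_trace[OF frame])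
  also have "\<dots> = speed t x"
    unfolding speed_def sum_distrib_left using c by (intro sum.cong refl) simp
  finally show ?thesis
    by (simp only: decay_matrix spectral_scaleR[OF frame] rate_def vec_lambda_beta)
qed

lemma solves_R_ode_spectral:
  assumes T: "T > 0" and ab: "b = a + q" and \<rho>: "solves_rate T \<rho>"
  shows "solves_R_ode L a q c T (\<lambda>t. spectral e (\<lambda>k. \<rho> t $ k))"
  unfolding solves_R_ode_def
proof (intro conjI ballI)
  show "spectral e (\<lambda>k. \<rho> 0 $ k) = 0"
    using \<rho> by (simp add: solves_rate_def spectral_def vec_eq_iff)
  fix t assume t: "t \<in> {0..T}"
  have nn: "0 \<le> \<rho> t $ k" for k using \<rho> t by (simp add: solves_rate_def)
  obtain p where "spectral e (\<lambda>k. \<rho> t $ k) = mat_poly p (spectral e l)"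
    by (rule spectral_is_mat_poly[OF frame solves_rate_equal_eigenvalues[OF \<rho> _ t]])
  moreover have "pos_semidef (spectral e (\<lambda>k. \<rho> t $ k))"
    using nn by (simp add: spectral_pos_semidef[OF frame])
  ultimately show "spectral e (\<lambda>k. \<rho> t $ k) \<in> psd_polys L"
    unfolding psd_polys_def L by blast
  have "(\<rho> has_vector_derivative rate t (\<rho> t)) (at t within {0..T})"
    using \<rho> t by (simp add: solves_rate_def)
  from bounded_linear.has_vector_derivative[OF bounded_linear_vec_nth this]
  have "((\<lambda>t. \<rho> t $ k) has_real_derivative rate t (\<rho> t) $ k) (at t within {0..T})" for k
    by (simp add: has_real_derivative_iff_has_vector_derivative)
  from spectral_has_vector_derivative[OF frame, of "\<lambda>t k. \<rho> t $ k" "\<lambda>k. rate t (\<rho> t) $ k", OF this]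
  show "((\<lambda>t. spectral e (\<lambda>k. \<rho> t $ k)) has_vector_derivative
      (1 / c * trace (Q_deriv L c (spectral e (\<lambda>k. \<rho> t $ k)) ** mat_exp (- (t * (a + q)) *\<^sub>R L)))
        *\<^sub>R mat_exp (- (t * (a + q)) *\<^sub>R L)) (at t within {0..T})"
    unfolding ab[symmetric] ode_rhs_spectral[OF nn] .
qed

text \<open>Every solution takes values in the polynomials of \<open>L\<close>, which are diagonal in the frame; its
  diagonal coefficients therefore determine it and solve the rate equation.\<close>

lemma solves_R_ode_coefficients:
  assumes S: "solves_R_ode L a q c T S" and ab: "b = a + q"
  defines "s \<equiv> \<lambda>t. \<chi> k. e k \<bullet> (S t *v e k)"
  shows "solves_rate T s" and "\<And>t. t \<in> {0..T} \<Longrightarrow> S t = spectral e (\<lambda>k. s t $ k)"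
proof -
  have S_eq: "S t = spectral e (\<lambda>k. s t $ k)" and nn: "0 \<le> s t $ k" if t: "t \<in> {0..T}" for t k
  proof -
    have "S t \<in> psd_polys L" using S t by (simp add: solves_R_ode_def)
    then obtain p where p: "S t = mat_poly p L" "pos_semidef (S t)"
      unfolding psd_polys_def by blast
    then have "S t = spectral e (\<lambda>k. poly p (l k))" by (simp add: L spectral_mat_poly[OF frame])
    moreover from this have "s t $ k = poly p (l k)" for k by (simp add: s_def spectral_coefficient[OF frame])
    ultimately show "S t = spectral e (\<lambda>k. s t $ k)" by simp
    show "0 \<le> s t $ k" using p(2) by (simp add: s_def pos_semidef_def)
  qed
  show "S t = spectral e (\<lambda>k. s t $ k)" if "t \<in> {0..T}" for t by (rule S_eq[OF that])
  have lin: "bounded_linear (\<lambda>A :: real^'n^'n. \<chi> k. e k \<bullet> (A *v e k))"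
    by (rule linear_conv_bounded_linear[THEN iffD1])
      (auto intro!: linearI simp: vec_eq_iff matrix_vector.add_left matrix_vector.scaleR_left inner_add_right)
  show "solves_rate T s"
    unfolding solves_rate_def
  proof (intro conjI ballI allI)
    have "S 0 = 0" using S by (simp add: solves_R_ode_def)
    then show "s 0 = 0" by (subst vec_eq_iff) (simp add: s_def)
    fix t assume t: "t \<in> {0..T}"
    show "0 \<le> s t $ k" for k by (rule nn[OF t])
    have "(S has_vector_derivative (1 / c * trace (Q_deriv L c (S t) ** mat_exp (- (t * b) *\<^sub>R L)))
        *\<^sub>R mat_exp (- (t * b) *\<^sub>R L)) (at t within {0..T})"
      using S t by (simp add: solves_R_ode_def ab)
    then have "(S has_vector_derivative spectral e (\<lambda>k. rate t (s t) $ k)) (at t within {0..T})"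
      unfolding S_eq[OF t] ode_rhs_spectral[OF nn[OF t]] .
    from bounded_linear.has_vector_derivative[OF lin this]
    show "(s has_vector_derivative rate t (s t)) (at t within {0..T})"
      unfolding s_def[symmetric] by (simp add: spectral_coefficient[OF frame] s_def[abs_def])
  qed
qed

end

end

text \<open>The spectral data of a Laplacian all of whose polynomials have constant diagonal, together with
  the solution \<open>\<rho>\<close> of the rate equation.\<close>

locale transitive_game = rate_solution l b c T \<rho>
  for l :: "'n::finite \<Rightarrow> real" and b c T \<rho> +
  fixes e :: "'n \<Rightarrow> real^'n" and L :: "real^'n^'n" and a q :: real
  assumes frame: "orthonormal_frame e" and L: "L = spectral e l" and T: "T > 0" and ab: "b = a + q"
    and tr: "trace L = real CARD('n)"
    and diag: "\<And>p i. mat_poly p L $ i $ i = trace (mat_poly p L) / real CARD('n)"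
begin

definition ode_solution :: "real \<Rightarrow> real^'n^'n" where
  "ode_solution t = spectral e (\<lambda>k. \<rho> t $ k)"

text \<open>The matrix \<open>A = P - b L\<close>.\<close>

definition gain :: "real \<Rightarrow> real^'n^'n" where
  "gain t = spectral e (feedback_eigenvalue (T - t))"

lemma P_of_eq:
  assumes t: "t \<in> {0..T}"
  shows "P_of L a q c T ode_solution t = (a + q) *\<^sub>R L + gain t"
proof -
  have s: "T - t \<in> {0..T}" using t by auto
  have "((\<lambda>s. \<rho> s $ k) has_real_derivative rate (T - t) (\<rho> (T - t)) $ k) (at (T - t) within {0..T})" for k
    using rho_derivative[OF s, of k] by (simp add: rate_def)
  from spectral_has_vector_derivative[OF frame this]
  have vd: "vector_derivative ode_solution (at (T - t) within {0..T}) = spectral e (\<lambda>k. rate (T - t) (\<rho> (T - t)) $ k)"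
    unfolding ode_solution_def[abs_def] using T s by (intro vector_derivative_within_closed_interval) auto
  have "ode_solution (T - t) ** (c *\<^sub>R L) = c *\<^sub>R (ode_solution (T - t) ** L)" by (rule matrix_mult.scaleR_right)
  then have "mat 1 + ode_solution (T - t) ** (c *\<^sub>R L) = spectral e (one_plus (\<rho> (T - t)))"
    by (simp add: ode_solution_def one_plus_matrix[OF frame L])
  moreover have "one_plus (\<rho> (T - t)) k \<noteq> 0" for k using one_plus_rho[OF s, of k] by linarith
  ultimately show ?thesis
    unfolding P_of_def vd gain_def
    by (simp add: L spectral_inverse[OF frame] spectral_scaleR[OF frame] spectral_mult[OF frame])
      (rule arg_cong[where f = "spectral e"], simp add: fun_eq_iff feedback_eigenvalue_def weight_def rate_def mult_ac)
qed

lemma gain_trace: "trace (gain t) / real CARD('n) = mean_eigenvalue (T - t)"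
  by (simp add: gain_def spectral_trace[OF frame] mean_eigenvalue_def)

lemma gain_diagonal: assumes t: "t \<in> {0..T}" shows "gain t $ j $ j = mean_eigenvalue (T - t)"
proof -
  have s: "T - t \<in> {0..T}" using t by auto
  obtain p where "spectral e (feedback_eigenvalue (T - t)) = mat_poly p (spectral e l)"
    by (rule spectral_is_mat_poly[OF frame feedback_eigenvalue_equal[OF s]])
  then have p: "gain t = mat_poly p L" by (simp add: gain_def L)
  have "gain t $ j $ j = trace (gain t) / real CARD('n)" unfolding p by (rule diag)
  then show ?thesis by (simp only: gain_trace)
qed

lemma F_of_eq:
  assumes t: "t \<in> {0..T}"
  shows "F_of L a q (P_of L a q c T ode_solution) i t = (1 / mean_eigenvalue (T - t)) *\<^sub>R (gain t ** unit_outer i ** gain t)"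
proof -
  have "trace (P_of L a q c T ode_solution t) - (a + q) * trace L = trace (gain t)"
    by (simp add: P_of_eq[OF t] trace_add) (simp add: trace_def sum_distrib_left)
  then show ?thesis by (simp add: F_of_def P_of_eq[OF t] gain_trace)
qed

lemma gain_derivative:
  assumes t: "t \<in> {0..T}"
  shows "(gain has_vector_derivative ((a + q) *\<^sub>R L + gain t) ** gain t - drift (T - t) *\<^sub>R gain t) (at t within {0..T})"
proof -
  have "((\<lambda>s. spectral e (feedback_eigenvalue s)) has_vector_derivative
      spectral e (\<lambda>k. feedback_eigenvalue s k * (drift s - b * l k - feedback_eigenvalue s k))) (at s within {0..T})"
    if "s \<in> {0..T}" for s
    by (rule spectral_has_vector_derivative[OF frame feedback_eigenvalue_derivative[OF that]])
  from has_vector_derivative_reverse[OF this t]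
  have "(gain has_vector_derivative - spectral e (\<lambda>k. feedback_eigenvalue (T - t) k *
      (drift (T - t) - b * l k - feedback_eigenvalue (T - t) k))) (at t within {0..T})"
    by (simp add: gain_def[abs_def])
  also have "- spectral e (\<lambda>k. feedback_eigenvalue (T - t) k * (drift (T - t) - b * l k - feedback_eigenvalue (T - t) k))
      = ((a + q) *\<^sub>R L + gain t) ** gain t - drift (T - t) *\<^sub>R gain t"
    unfolding gain_def L ab[symmetric] spectral_scaleR[OF frame] spectral_add[OF frame] spectral_mult[OF frame] spectral_diff[OF frame]
      spectral_minus[OF frame]
    by (rule arg_cong[where f = "spectral e"]) (simp add: fun_eq_iff algebra_simps)
  finally show ?thesis .
qed

text \<open>With \<open>A' = C A - \<kappa> A\<close>, \<open>C = b L + A\<close>, and \<open>(1 / \<lambda>)' = (2 \<kappa> - \<lambda>) / \<lambda>\<close>, the terms with \<open>\<kappa>\<close> cancel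
  in the derivative of \<open>F = A E A / \<lambda>\<close> and leave \<open>F' = C F + F C - A E A\<close>, which is the Riccati
  equation by \<open>rank_one_riccati\<close>.\<close>

lemma F_of_solves_riccati:
  assumes q: "q\<^sup>2 = \<epsilon>"
  shows "solves_riccati L a q \<epsilon> c T (F_of L a q (P_of L a q c T ode_solution))"
  unfolding solves_riccati_def
proof (intro conjI allI ballI)
  let ?F = "F_of L a q (P_of L a q c T ode_solution)"
  let ?M = "(a + q) *\<^sub>R L"
  have At: "transpose (gain t) = gain t" for t by (simp add: gain_def spectral_transpose[OF frame])
  fix i
  show "transpose (?F i t) = ?F i t" if t: "t \<in> {0..T}" for t
  proof -
    have "transpose (unit_outer i) = unit_outer i" by (simp add: vec_eq_iff transpose_def unit_outer_def)
    then show ?thesis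
      by (simp add: F_of_eq[OF t] transpose_scalar matrix_transpose_mul At matrix_mul_assoc)
  qed
  show "?F i T = c *\<^sub>R (L ** unit_outer i ** L)"
  proof -
    have T0: "T \<in> {0..T}" and z: "0 \<in> {0..T}" using T by auto
    have \<rho>0: "\<rho> 0 = 0" using \<rho> by (simp add: solves_rate_def)
    have "(\<Sum>k\<in>UNIV. l k) = real CARD('n)" using tr by (simp add: L spectral_trace[OF frame])
    moreover have "one_plus (\<rho> 0) k = 1" for k by (simp add: \<rho>0 one_plus_def)
    ultimately have "speed 0 (\<rho> 0) = 1"
      by (simp add: speed_def decay_def geo_mean_def sum_divide_distrib[symmetric])
    then have fe: "feedback_eigenvalue 0 k = c * l k" for k
      by (simp add: feedback_eigenvalue_def weight_def \<rho>0 one_plus_def decay_def)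
    then have "mean_eigenvalue 0 = c"
      using \<open>(\<Sum>k\<in>UNIV. l k) = real CARD('n)\<close> by (simp add: mean_eigenvalue_def sum_distrib_left[symmetric])
    moreover have "gain T = c *\<^sub>R L"
      by (simp add: gain_def fe L spectral_scaleR[OF frame] fun_eq_iff[symmetric]) (simp add: fe[abs_def])
    ultimately show ?thesis
      using c by (simp add: F_of_eq[OF T0] matrix_mult.scaleR_left matrix_mult.scaleR_right)
  qed
  fix t assume t: "t \<in> {0..T}"
  have s: "T - t \<in> {0..T}" using t by auto
  define \<mu> where "\<mu> = mean_eigenvalue (T - t)"
  define \<kappa> where "\<kappa> = drift (T - t)"
  have \<mu>: "\<mu> \<noteq> 0" using mean_eigenvalue_pos[OF s] by (simp add: \<mu>_def)
  define E where "E = (unit_outer i :: real^'n^'n)"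
  define X where "X = (1 / \<mu>) *\<^sub>R (gain t ** E ** gain t)"
  define D where "D = (?M + gain t) ** X + X ** (?M + gain t) - gain t ** E ** gain t"
  have comm: "(?M + gain t) ** gain t = gain t ** (?M + gain t)"
    by (simp add: gain_def L spectral_scaleR[OF frame] spectral_add[OF frame] spectral_mult[OF frame] mult.commute)
  have "((\<lambda>t. (1 / mean_eigenvalue (T - t)) *\<^sub>R (gain t ** E ** gain t)) has_vector_derivative D) (at t within {0..T})"
  proof -
    have "((\<lambda>t. mean_eigenvalue (T - t)) has_vector_derivative - (\<mu> * (2 * \<kappa> - \<mu>))) (at t within {0..T})"
      unfolding \<mu>_def \<kappa>_def
      by (rule has_vector_derivative_reverse[OF _ t])
        (simp add: mean_eigenvalue_derivative has_real_derivative_iff_has_vector_derivative[symmetric])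
    then have inv: "((\<lambda>t. 1 / mean_eigenvalue (T - t)) has_real_derivative (2 * \<kappa> - \<mu>) / \<mu>) (at t within {0..T})"
      unfolding has_real_derivative_iff_has_vector_derivative[symmetric]
      using \<mu> by (auto intro!: derivative_eq_intros simp: \<mu>_def[symmetric] power2_eq_square field_simps)
    have dA: "(gain has_vector_derivative (?M + gain t) ** gain t - \<kappa> *\<^sub>R gain t) (at t within {0..T})"
      unfolding \<kappa>_def by (rule gain_derivative[OF t])
    have "((\<lambda>t. gain t ** E) has_vector_derivative ((?M + gain t) ** gain t - \<kappa> *\<^sub>R gain t) ** E) (at t within {0..T})"
      by (rule bounded_linear.has_vector_derivative[OF matrix_mult.bounded_linear_left dA])
    note dAEA = matrix_mult.has_vector_derivative[OF this dA]
    define C where "C = ?M + gain t"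
    define Y where "Y = gain t ** E ** gain t"
    have XY: "X = (1 / \<mu>) *\<^sub>R Y" by (simp only: X_def Y_def)
    have 1: "gain t ** E ** (C ** gain t) = Y ** C" by (simp only: comm[folded C_def] Y_def matrix_mul_assoc)
    have 2: "C ** gain t ** E ** gain t = C ** Y" by (simp only: Y_def matrix_mul_assoc)
    have 3: "gain t ** E ** (\<kappa> *\<^sub>R gain t) = \<kappa> *\<^sub>R Y" by (simp only: matrix_mult.scaleR_right Y_def)
    have 4: "(\<kappa> *\<^sub>R gain t) ** E ** gain t = \<kappa> *\<^sub>R Y" by (simp only: matrix_mult.scaleR_left Y_def)
    have 5: "gain t ** E ** (C ** gain t - \<kappa> *\<^sub>R gain t) + (C ** gain t - \<kappa> *\<^sub>R gain t) ** E ** gain t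
        = C ** Y + Y ** C - (2 * \<kappa>) *\<^sub>R Y"
      unfolding matrix_mult.diff_right matrix_mult.diff_left 1 2 3 4 mult_2 scaleR_add_left by simp
    have AEA: "((\<lambda>t. gain t ** E ** gain t) has_vector_derivative C ** Y + Y ** C - (2 * \<kappa>) *\<^sub>R Y) (at t within {0..T})"
      using dAEA unfolding C_def[symmetric] 5 .
    have "((\<lambda>t. (1 / mean_eigenvalue (T - t)) *\<^sub>R (gain t ** E ** gain t)) has_vector_derivative
        (1 / \<mu>) *\<^sub>R (C ** Y + Y ** C - (2 * \<kappa>) *\<^sub>R Y) + ((2 * \<kappa> - \<mu>) / \<mu>) *\<^sub>R Y) (at t within {0..T})"
      using has_vector_derivative_scaleR[OF inv AEA] unfolding \<mu>_def Y_def .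
    also have "(1 / \<mu>) *\<^sub>R (C ** Y + Y ** C - (2 * \<kappa>) *\<^sub>R Y) + ((2 * \<kappa> - \<mu>) / \<mu>) *\<^sub>R Y = D"
    proof -
      have "(2 * \<kappa> - \<mu>) / \<mu> = 2 * \<kappa> / \<mu> - 1" using \<mu> by (simp add: field_simps)
      then show ?thesis
        by (simp add: D_def C_def[symmetric] Y_def[symmetric] XY matrix_mult.scaleR_left matrix_mult.scaleR_right
            scaleR_add_right scaleR_diff_right scaleR_diff_left)
    qed
    finally show ?thesis .
  qed
  then have dF: "(?F i has_vector_derivative D) (at t within {0..T})"
    by (rule has_vector_derivative_transform[OF t, rotated]) (simp add: F_of_eq E_def)
  note sums = rank_one_riccati[of "gain t" \<mu>, OF gain_diagonal[OF t, folded \<mu>_def] \<mu>]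
  have Fj: "?F j t = (1 / \<mu>) *\<^sub>R (gain t ** unit_outer j ** gain t)" for j
    by (simp add: F_of_eq[OF t] \<mu>_def)
  show "\<exists>D. (?F i has_vector_derivative D) (at t within {0..T}) \<and>
      D + (\<Sum>j\<in>UNIV. (- ?M - ?F j t) ** unit_outer j ** ?F i t)
        + (\<Sum>j\<in>UNIV. ?F i t ** unit_outer j ** (- ?M - ?F j t))
        + (\<epsilon> - q\<^sup>2) *\<^sub>R (L ** unit_outer i ** L) + ?F i t ** unit_outer i ** ?F i t = 0"
  proof (intro exI[of _ D] conjI dF)
    show "D + (\<Sum>j\<in>UNIV. (- ?M - ?F j t) ** unit_outer j ** ?F i t)
        + (\<Sum>j\<in>UNIV. ?F i t ** unit_outer j ** (- ?M - ?F j t))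
        + (\<epsilon> - q\<^sup>2) *\<^sub>R (L ** unit_outer i ** L) + ?F i t ** unit_outer i ** ?F i t = 0"
      unfolding Fj sums q by (simp add: D_def X_def E_def)
  qed
qed

end

section \<open>Brownian increments and the past\<close>

context prob_space
begin

lemma brownian_motion_increment:
  assumes "brownian_motion M B" "0 \<le> s" "s \<le> t"
  shows "integrable M (\<lambda>\<omega>. B t \<omega> - B s \<omega>)" "integrable M (\<lambda>\<omega>. (B t \<omega> - B s \<omega>)\<^sup>2)"
    "expectation (\<lambda>\<omega>. B t \<omega> - B s \<omega>) = 0" "expectation (\<lambda>\<omega>. (B t \<omega> - B s \<omega>)\<^sup>2) = t - s"
proof -
  have "integrable M (\<lambda>\<omega>. B t \<omega> - B s \<omega>) \<and> integrable M (\<lambda>\<omega>. (B t \<omega> - B s \<omega>)\<^sup>2) \<and>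
    expectation (\<lambda>\<omega>. B t \<omega> - B s \<omega>) = 0 \<and> expectation (\<lambda>\<omega>. (B t \<omega> - B s \<omega>)\<^sup>2) = t - s"
  proof (cases "s = t")
    case False
    define v where "v = sqrt (t - s)"
    have v: "v > 0" "v\<^sup>2 = t - s" using assms False by (auto simp: v_def)
    have D: "distributed M lborel (\<lambda>\<omega>. B t \<omega> - B s \<omega>) (normal_density 0 v)"
      using assms False by (auto simp: brownian_motion_def v_def)
    have "integrable M (\<lambda>\<omega>. B t \<omega> - B s \<omega>)"
      using distributed_integrable[OF D, of "\<lambda>x. x"] integrable_normal_moment_nz_1[OF v(1), of 0] by simp
    moreover have "integrable M (\<lambda>\<omega>. (B t \<omega> - B s \<omega>)\<^sup>2)"
      using distributed_integrable[OF D, of "\<lambda>x. x\<^sup>2"] integrable_normal_moment[OF v(1), of 0 2] by simp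
    moreover have "expectation (\<lambda>\<omega>. B t \<omega> - B s \<omega>) = 0"
      using distributed_integral[OF D, of "\<lambda>x. x"] integral_normal_moment_nz_1[OF v(1), of 0] by simp
    moreover have "expectation (\<lambda>\<omega>. (B t \<omega> - B s \<omega>)\<^sup>2) = t - s"
      using distributed_integral[OF D, of "\<lambda>x. x\<^sup>2"] integral_normal_moment_even[OF v(1), of 0 1] v
      by (simp add: fact_2)
    ultimately show ?thesis by simp
  qed simp
  then show "integrable M (\<lambda>\<omega>. B t \<omega> - B s \<omega>)" "integrable M (\<lambda>\<omega>. (B t \<omega> - B s \<omega>)\<^sup>2)"
    "expectation (\<lambda>\<omega>. B t \<omega> - B s \<omega>) = 0" "expectation (\<lambda>\<omega>. (B t \<omega> - B s \<omega>)\<^sup>2) = t - s"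
    by auto
qed

text \<open>Order the times in \<open>J\<close> together with \<open>0\<close> and \<open>s\<close>. Up to the null set \<open>B 0 \<noteq> 0\<close>, the cylinder event is
  an event of the increments between consecutive times, and these are independent of the increment
  from \<open>s\<close> to \<open>t\<close>.\<close>

lemma brownian_motion_cylinder_indep:
  assumes B: "brownian_motion M B" and s: "0 \<le> s" "s \<le> t"
    and J: "finite J" "J \<subseteq> {0..s}" and A: "\<And>r. A r \<in> sets borel" and C: "C \<in> sets borel"
  shows "prob ({\<omega>\<in>space M. \<forall>r\<in>J. B r \<omega> \<in> A r} \<inter> {\<omega>\<in>space M. B t \<omega> - B s \<omega> \<in> C})
    = prob {\<omega>\<in>space M. \<forall>r\<in>J. B r \<omega> \<in> A r} * prob {\<omega>\<in>space M. B t \<omega> - B s \<omega> \<in> C}"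
proof -
  have Bm: "B r \<in> borel_measurable M" if "r \<ge> 0" for r
    using B that by (auto simp: brownian_motion_def)
  have B0: "AE \<omega> in M. B 0 \<omega> = 0" using B by (auto simp: brownian_motion_def)
  define xs where "xs = sorted_list_of_set (insert 0 (insert s J))"
  define m where "m = length xs - 1"
  have set_xs: "set xs = insert 0 (insert s J)" and sorted: "sorted xs"
    unfolding xs_def using J(1) by (simp_all only: set_sorted_list_of_set finite_insert sorted_sorted_list_of_set)
  have m: "length xs = Suc m" using set_xs by (cases xs) (auto simp: m_def)
  \<comment> \<open>The last increment, number \<open>m\<close>, leads from \<open>s\<close> to \<open>t\<close>.\<close>
  define \<tau> where "\<tau> k = (if k \<le> m then xs ! k else t)" for k
  have bounds: "0 \<le> x \<and> x \<le> s" if "x \<in> set xs" for x using that set_xs J s by auto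
  have "xs ! 0 = 0"
  proof (rule antisym)
    obtain i where "i < length xs" "xs ! i = 0" using set_xs by (metis in_set_conv_nth insertI1)
    then show "xs ! 0 \<le> 0" using sorted_nth_mono[OF sorted, of 0 i] by auto
  qed (use bounds m in auto)
  then have \<tau>0: "\<tau> 0 = 0" by (simp add: \<tau>_def)
  have "xs ! m = s"
  proof (rule antisym)
    obtain i where "i < length xs" "xs ! i = s" using set_xs by (metis in_set_conv_nth insertCI)
    then show "s \<le> xs ! m" using sorted_nth_mono[OF sorted, of i m] m by auto
  qed (use bounds m in auto)
  then have \<tau>m: "\<tau> m = s" by (simp add: \<tau>_def)
  have \<tau>_mono: "\<tau> k \<le> \<tau> (Suc k)" if "k < Suc m" for k
    using that sorted_nth_mono[OF sorted, of k "Suc k"] m s \<tau>m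
    by (cases "k = m") (auto simp: \<tau>_def)
  have \<tau>_nonneg: "\<tau> k \<ge> 0" for k using bounds m s by (auto simp: \<tau>_def)
  define \<Delta> where "\<Delta> k \<omega> = B (\<tau> (Suc k)) \<omega> - B (\<tau> k) \<omega>" for k \<omega>
  have "\<forall>n (\<tau>::nat \<Rightarrow> real). 0 \<le> \<tau> 0 \<and> (\<forall>k<n. \<tau> k \<le> \<tau> (Suc k)) \<longrightarrow>
      indep_vars (\<lambda>_. borel) (\<lambda>k \<omega>. B (\<tau> (Suc k)) \<omega> - B (\<tau> k) \<omega>) {..<n}"
    using B unfolding brownian_motion_def by (elim conjE)
  from this[THEN spec, of "Suc m", THEN spec, of \<tau>] have "indep_vars (\<lambda>_. borel) \<Delta> {..<Suc m}"
    using \<tau>0 \<tau>_mono by (simp add: \<Delta>_def[abs_def])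
  then have iv: "indep_var (PiM {..<m} (\<lambda>_. borel)) (\<lambda>\<omega>. restrict (\<lambda>i. \<Delta> i \<omega>) {..<m})
      (PiM {m} (\<lambda>_. borel)) (\<lambda>\<omega>. restrict (\<lambda>i. \<Delta> i \<omega>) {m})"
    by (rule indep_var_restrict) auto
  define S where "S = {x\<in>space (PiM {..<m} (\<lambda>_. borel :: real measure)). \<forall>k\<in>{k. k \<le> m \<and> \<tau> k \<in> J}. (\<Sum>j<k. x j) \<in> A (\<tau> k)}"
  define S' where "S' = {x\<in>space (PiM {m} (\<lambda>_. borel :: real measure)). x m \<in> C}"
  have S_sets: "S \<in> sets (PiM {..<m} (\<lambda>_. borel))"
    unfolding S_def
  proof (rule sets.sets_Collect_finite_All)
    show "finite {k. k \<le> m \<and> \<tau> k \<in> J}" by simp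
    fix k assume k: "k \<in> {k. k \<le> m \<and> \<tau> k \<in> J}"
    have [measurable]: "A (\<tau> k) \<in> sets borel" by (rule A)
    have [measurable]: "(\<lambda>x. \<Sum>j<k. x j) \<in> borel_measurable (PiM {..<m} (\<lambda>_. borel :: real measure))"
      using k by (intro borel_measurable_sum measurable_component_singleton) auto
    show "{x \<in> space (PiM {..<m} (\<lambda>_. borel)). (\<Sum>j<k. x j) \<in> A (\<tau> k)} \<in> sets (PiM {..<m} (\<lambda>_. borel :: real measure))"
      by measurable
  qed
  note S_sets
  moreover have "S' \<in> sets (PiM {m} (\<lambda>_. borel))"
    unfolding S'_def using C by measurable
  ultimately have prod: "prob ((\<lambda>\<omega>. (restrict (\<lambda>i. \<Delta> i \<omega>) {..<m}, restrict (\<lambda>i. \<Delta> i \<omega>) {m})) -` (S \<times> S') \<inter> space M)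
      = prob ((\<lambda>\<omega>. restrict (\<lambda>i. \<Delta> i \<omega>) {..<m}) -` S \<inter> space M) * prob ((\<lambda>\<omega>. restrict (\<lambda>i. \<Delta> i \<omega>) {m}) -` S' \<inter> space M)"
    by (rule indep_varD[OF iv])
  define E where "E = {\<omega>\<in>space M. \<forall>r\<in>J. B r \<omega> \<in> A r}"
  define D where "D = {\<omega>\<in>space M. B t \<omega> - B s \<omega> \<in> C}"
  define E' where "E' = (\<lambda>\<omega>. restrict (\<lambda>i. \<Delta> i \<omega>) {..<m}) -` S \<inter> space M"
  have D': "(\<lambda>\<omega>. restrict (\<lambda>i. \<Delta> i \<omega>) {m}) -` S' \<inter> space M = D"
    using \<tau>m by (auto simp: S'_def D_def \<Delta>_def \<tau>_def space_PiM)
  have E'D: "(\<lambda>\<omega>. (restrict (\<lambda>i. \<Delta> i \<omega>) {..<m}, restrict (\<lambda>i. \<Delta> i \<omega>) {m})) -` (S \<times> S') \<inter> space M = E' \<inter> D"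
    using D' by (auto simp: E'_def)
  have tele: "(\<Sum>j<k. \<Delta> j \<omega>) = B (\<tau> k) \<omega> - B 0 \<omega>" for k \<omega>
    unfolding \<Delta>_def using \<tau>0 by (induction k) auto
  have E'_eq: "\<omega> \<in> E' \<longleftrightarrow> \<omega> \<in> E" if "\<omega> \<in> space M" "B 0 \<omega> = 0" for \<omega>
  proof -
    have "\<omega> \<in> E' \<longleftrightarrow> (\<forall>k\<in>{k. k \<le> m \<and> \<tau> k \<in> J}. B (\<tau> k) \<omega> \<in> A (\<tau> k))"
      using that by (auto simp: E'_def S_def space_PiM tele)
    also have "\<dots> \<longleftrightarrow> (\<forall>r\<in>J. B r \<omega> \<in> A r)"
    proof -
      have "\<exists>k\<le>m. \<tau> k = r" if r: "r \<in> J" for r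
      proof -
        obtain i where "i < length xs" "xs ! i = r" using set_xs r by (metis in_set_conv_nth insertCI)
        then show ?thesis using m by (auto simp: \<tau>_def intro!: exI[of _ i])
      qed
      then show ?thesis by fastforce
    qed
    finally show ?thesis using that by (auto simp: E_def)
  qed
  have [measurable]: "E \<in> sets M"
    unfolding E_def
  proof (rule sets.sets_Collect_finite_All)
    fix r assume r: "r \<in> J"
    have [measurable]: "A r \<in> sets borel" "B r \<in> borel_measurable M" using A Bm J r by auto
    show "{\<omega> \<in> space M. B r \<omega> \<in> A r} \<in> sets M" by measurable
  qed (use J in auto)
  have [measurable]: "D \<in> sets M"
  proof -
    have [measurable]: "C \<in> sets borel" "B t \<in> borel_measurable M" "B s \<in> borel_measurable M" using C Bm s by auto
    show ?thesis unfolding D_def by measurable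
  qed
  have [measurable]: "E' \<in> sets M"
    using S_sets iv unfolding E'_def indep_var_eq by (auto intro!: measurable_sets)
  have 1: "prob E' = prob E" and 2: "prob (E' \<inter> D) = prob (E \<inter> D)"
    using B0 E'_eq by (auto intro!: finite_measure_eq_AE)
  have "prob (E' \<inter> D) = prob E' * prob D"
    using prod unfolding D' E'D E'_def[symmetric] .
  then show ?thesis unfolding 1 2 unfolding E_def D_def .
qed

end

locale brownian_family = prob_space M for M :: "'w measure" +
  fixes W :: "'n::finite \<Rightarrow> real \<Rightarrow> 'w \<Rightarrow> real"
  assumes indep_bm: "independent_brownian_motions M W"
begin

abbreviation "\<F> \<equiv> natural_filtration M W"

lemma bm: "brownian_motion M (W i)"
  using indep_bm by (auto simp: independent_brownian_motions_def)

lemma W_measurable: "t \<ge> 0 \<Longrightarrow> W i t \<in> borel_measurable M"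
  using bm[of i] by (auto simp: brownian_motion_def)

lemma W_continuous: "\<omega> \<in> space M \<Longrightarrow> continuous_on {0..} (\<lambda>t. W i t \<omega>)"
  using bm[of i] by (auto simp: brownian_motion_def)

lemma W_zero: "AE \<omega> in M. W i 0 \<omega> = 0"
  using bm[of i] by (auto simp: brownian_motion_def)

lemma filtration_gen:
  "(\<Union>j. \<Union>s\<in>{0..t}. {W j s -` A \<inter> space M | A. A \<in> sets borel}) \<subseteq> Pow (space M)"
  by auto

lemma space_filtration [simp]: "space (\<F> t) = space M"
  unfolding natural_filtration_def by (rule space_measure_of[OF filtration_gen])

lemma sets_filtration:
  "sets (\<F> t) = sigma_sets (space M) (\<Union>j. \<Union>s\<in>{0..t}. {W j s -` A \<inter> space M | A. A \<in> sets borel})"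
  unfolding natural_filtration_def by (rule sets_measure_of[OF filtration_gen])

lemma filtration_subset: "sets (\<F> t) \<subseteq> sets M"
  unfolding sets_filtration
proof (rule sets.sigma_sets_subset, safe)
  fix j s and A :: "real set" assume "s \<in> {0..t}" "A \<in> sets borel"
  then show "W j s -` A \<inter> space M \<in> sets M" using W_measurable[of s j] by (auto intro: measurable_sets)
qed

lemma W_adapted: "0 \<le> s \<Longrightarrow> s \<le> t \<Longrightarrow> W i s \<in> borel_measurable (\<F> t)"
  by (rule measurableI) (auto simp: sets_filtration intro!: sigma_sets.Basic UN_I[of i] UN_I[of s])

lemma measurable_filtration_M: "f \<in> measurable (\<F> t) N \<Longrightarrow> f \<in> measurable M N"
  using filtration_subset[of t] by (auto simp: measurable_def)

text \<open>Cylinder events up to time \<open>s\<close> form a \<open>\<pi>\<close>-system that generates the past. Such an event is an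
  intersection of one event per player; independence of the paths factorises its probability, and
  for the player \<open>l\<close> whose increment is tested \<open>brownian_motion_cylinder_indep\<close> applies.\<close>

lemma increment_indep_filtration:
  assumes s: "0 \<le> s" "s \<le> t" and u: "u \<in> borel_measurable (\<F> s)"
  shows "indep_var borel u borel (\<lambda>\<omega>. W l t \<omega> - W l s \<omega>)"
proof -
  define cyl where "cyl J A = {\<omega>\<in>space M. \<forall>j. \<forall>r\<in>J. W j r \<omega> \<in> A j r}" for J and A :: "'n \<Rightarrow> real \<Rightarrow> real set"
  define G where "G = {cyl J A | J A. finite J \<and> J \<subseteq> {0..s} \<and> (\<forall>j r. A j r \<in> sets borel)}"
  define H where "H = {(\<lambda>\<omega>. W l t \<omega> - W l s \<omega>) -` C \<inter> space M | C. C \<in> sets (borel :: real measure)}"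
  have d_meas: "(\<lambda>\<omega>. W l t \<omega> - W l s \<omega>) \<in> borel_measurable M"
    using s by (intro borel_measurable_diff W_measurable) auto
  have cyl_sets: "cyl J A \<in> sets M" if "finite J" "J \<subseteq> {0..s}" "\<And>j r. A j r \<in> sets borel" for J A
  proof -
    have "{\<omega>\<in>space M. \<forall>j\<in>UNIV. \<forall>r\<in>J. W j r \<omega> \<in> A j r} \<in> sets M"
    proof (intro sets.sets_Collect_finite_All)
    fix j r assume r: "r \<in> J"
    have [measurable]: "A j r \<in> sets borel" "W j r \<in> borel_measurable M" using that W_measurable r by auto
    show "{\<omega> \<in> space M. W j r \<omega> \<in> A j r} \<in> sets M" by measurable
    qed (use that in auto)
    then show ?thesis by (simp add: cyl_def)
  qed
  have indep: "indep_set G H"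
  proof (rule indep_setI)
    show "G \<subseteq> events" using cyl_sets by (auto simp: G_def)
    show "H \<subseteq> events" using d_meas by (auto simp: H_def intro: measurable_sets)
    fix a b assume "a \<in> G" "b \<in> H"
    from \<open>a \<in> G\<close> obtain J A where J: "finite J" "J \<subseteq> {0..s}" and A': "\<forall>j r. A j r \<in> sets borel"
      and a: "a = cyl J A"
      unfolding G_def by blast
    from \<open>b \<in> H\<close> obtain C where C: "C \<in> sets borel" and b: "b = (\<lambda>\<omega>. W l t \<omega> - W l s \<omega>) -` C \<inter> space M"
      unfolding H_def by blast
    have A: "A j r \<in> sets borel" for j r using A' by blast
    have b': "b = {\<omega>\<in>space M. W l t \<omega> - W l s \<omega> \<in> C}" using b by auto
    define path where "path i \<omega> = (\<lambda>t\<in>{0..}. W i t \<omega>)" for i \<omega>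
    have paths: "indep_vars (\<lambda>_. PiM {0..} (\<lambda>_. borel)) path UNIV"
      using indep_bm by (auto simp: independent_brownian_motions_def path_def[abs_def])
    define S where "S j = {x\<in>space (PiM {0..} (\<lambda>_. borel :: real measure)). \<forall>r\<in>J. x r \<in> A j r}" for j
    define D where "D = {x\<in>space (PiM {0..} (\<lambda>_. borel :: real measure)). x t - x s \<in> C}"
    have S: "S j \<in> sets (PiM {0..} (\<lambda>_. borel))" for j
      unfolding S_def
    proof (rule sets.sets_Collect_finite_All)
      fix r assume r: "r \<in> J"
      have [measurable]: "A j r \<in> sets borel" by (rule A)
      have [measurable]: "(\<lambda>x. x r) \<in> borel_measurable (PiM {0..} (\<lambda>_. borel :: real measure))"
        using r J by (intro measurable_component_singleton) auto
      show "{x \<in> space (PiM {0..} (\<lambda>_. borel)). x r \<in> A j r} \<in> sets (PiM {0..} (\<lambda>_. borel :: real measure))"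
        by measurable
    qed (use J in auto)
    have D: "D \<in> sets (PiM {0..} (\<lambda>_. borel))"
    proof -
      have [measurable]: "C \<in> sets borel" by (rule C)
      have [measurable]: "(\<lambda>x. x t) \<in> borel_measurable (PiM {0..} (\<lambda>_. borel :: real measure))"
        "(\<lambda>x. x s) \<in> borel_measurable (PiM {0..} (\<lambda>_. borel :: real measure))"
        using s by (auto intro!: measurable_component_singleton)
      show ?thesis unfolding D_def by measurable
    qed
    have pre_S: "path j -` S j \<inter> space M = {\<omega>\<in>space M. \<forall>r\<in>J. W j r \<omega> \<in> A j r}" for j
      using J by (auto simp: path_def S_def space_PiM)
    have pre_D: "path l -` D \<inter> space M = b"
      using s by (auto simp: path_def D_def space_PiM b)
    have a_eq: "a = (\<Inter>j. path j -` S j \<inter> space M)"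
      by (auto simp: a cyl_def pre_S)
    have "prob (a \<inter> b) = prob (\<Inter>j. path j -` (if j = l then S j \<inter> D else S j) \<inter> space M)"
      unfolding a_eq pre_D[symmetric] by (intro arg_cong[where f = prob]) (auto split: if_splits)
    also have "\<dots> = (\<Prod>j\<in>UNIV. prob (path j -` (if j = l then S j \<inter> D else S j) \<inter> space M))"
      by (rule indep_varsD_finite[OF paths]) (use S D in auto)
    also have "\<dots> = prob (path l -` (S l \<inter> D) \<inter> space M) * (\<Prod>j\<in>UNIV - {l}. prob (path j -` S j \<inter> space M))"
      by (subst prod.remove[of _ l]) auto
    also have "path l -` (S l \<inter> D) \<inter> space M = {\<omega>\<in>space M. \<forall>r\<in>J. W l r \<omega> \<in> A l r} \<inter> {\<omega>\<in>space M. W l t \<omega> - W l s \<omega> \<in> C}"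
      using pre_S[of l] pre_D b by auto
    also have "prob \<dots> = prob (path l -` S l \<inter> space M) * prob b"
      using brownian_motion_cylinder_indep[of "W l" s t J "A l" C, OF bm s J A C] unfolding pre_S b' .
    also have "\<dots> * (\<Prod>j\<in>UNIV - {l}. prob (path j -` S j \<inter> space M))
       = (\<Prod>j\<in>UNIV. prob (path j -` S j \<inter> space M)) * prob b"
      by (subst (2) prod.remove[of _ l]) auto
    also have "(\<Prod>j\<in>UNIV. prob (path j -` S j \<inter> space M)) = prob a"
      unfolding a_eq by (rule indep_varsD_finite[OF paths, symmetric]) (use S in auto)
    finally show "prob (a \<inter> b) = prob a * prob b" .
  qed
  have "Int_stable G"
  proof (rule Int_stableI)
    fix a b assume "a \<in> G" "b \<in> G"
    from \<open>a \<in> G\<close> obtain J A where J: "finite J" "J \<subseteq> {0..s}" "\<forall>j r. A j r \<in> sets borel" "a = cyl J A"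
      unfolding G_def by blast
    from \<open>b \<in> G\<close> obtain J' A' where J': "finite J'" "J' \<subseteq> {0..s}" "\<forall>j r. A' j r \<in> sets borel" "b = cyl J' A'"
      unfolding G_def by blast
    define A'' where "A'' j r = (if r \<in> J then A j r else UNIV) \<inter> (if r \<in> J' then A' j r else UNIV)" for j r
    have "a \<inter> b = cyl (J \<union> J') A''"
      unfolding J(4) J'(4) by (auto simp: cyl_def A''_def)
    moreover have "A'' j r \<in> sets borel" for j r using J(3) J'(3) by (auto simp: A''_def)
    ultimately show "a \<inter> b \<in> G"
      unfolding G_def using J J' by (intro CollectI exI[of _ "J \<union> J'"] exI[of _ A'']) auto
  qed
  moreover have "Int_stable H"
  proof (rule Int_stableI)
    fix a b assume "a \<in> H" "b \<in> H"
    from \<open>a \<in> H\<close> obtain C where "C \<in> sets borel" "a = (\<lambda>\<omega>. W l t \<omega> - W l s \<omega>) -` C \<inter> space M"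
      unfolding H_def by blast
    moreover from \<open>b \<in> H\<close> obtain C' where "C' \<in> sets borel" "b = (\<lambda>\<omega>. W l t \<omega> - W l s \<omega>) -` C' \<inter> space M"
      unfolding H_def by blast
    ultimately have "a \<inter> b = (\<lambda>\<omega>. W l t \<omega> - W l s \<omega>) -` (C \<inter> C') \<inter> space M" "C \<inter> C' \<in> sets borel" by auto
    then show "a \<inter> b \<in> H" unfolding H_def by blast
  qed
  ultimately have gen: "indep_set (sigma_sets (space M) G) (sigma_sets (space M) H)"
    using indep by (intro indep_set_sigma_sets)
  have "sets (\<F> s) \<subseteq> sigma_sets (space M) G"
    unfolding sets_filtration
  proof (rule sigma_sets_mono, safe)
    fix j r and A :: "real set" assume r: "r \<in> {0..s}" and A: "A \<in> sets borel"
    have "W j r -` A \<inter> space M = cyl {r} (\<lambda>i _. if i = j then A else UNIV)"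
      by (auto simp: cyl_def split: if_splits)
    then have "W j r -` A \<inter> space M \<in> G"
      using r A unfolding G_def by (intro CollectI exI conjI) (assumption, auto)
    then show "W j r -` A \<inter> space M \<in> sigma_sets (space M) G" by (rule sigma_sets.Basic)
  qed
  then have "sigma_sets (space M) {u -` A \<inter> space M | A. A \<in> sets borel} \<subseteq> sigma_sets (space M) G"
    using measurable_sets[OF u] by (intro sigma_sets_mono) auto
  then have "indep_set (sigma_sets (space M) {u -` A \<inter> space M | A. A \<in> sets borel}) (sigma_sets (space M) H)"
    using gen unfolding indep_sets2_eq by blast
  then show ?thesis
    using d_meas measurable_filtration_M[OF u] unfolding indep_var_eq H_def by auto
qed

text \<open>Besides path continuity and finite second moments, this is all that the equilibrium proof uses of
  Brownian motion.\<close>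

lemma expectation_times_increment:
  assumes s: "0 \<le> s" "s \<le> t" and u: "u \<in> borel_measurable (\<F> s)" "integrable M u"
  shows "integrable M (\<lambda>\<omega>. u \<omega> * (W l t \<omega> - W l s \<omega>))"
    and "expectation (\<lambda>\<omega>. u \<omega> * (W l t \<omega> - W l s \<omega>)) = 0"
  using indep_var_integrable[OF increment_indep_filtration[OF s u(1)] u(2) brownian_motion_increment(1)[OF bm s]]
    indep_var_lebesgue_integral[OF increment_indep_filtration[OF s u(1)] u(2) brownian_motion_increment(1)[OF bm s]]
  by (auto simp: brownian_motion_increment(3)[OF bm s])

end

section \<open>Progressively measurable processes\<close>

abbreviation time :: "real \<Rightarrow> real measure" where
  "time T \<equiv> restrict_space lborel {0..T}"

lemma finite_measure_time: "finite_measure (time T)"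
  by (rule finite_measureI) (simp add: space_restrict_space emeasure_restrict_space emeasure_lborel_Icc_eq)

lemma integral_time: "integral\<^sup>L (time T) f = (LINT s:{0..T}|lborel. f s)"
  for f :: "real \<Rightarrow> 'b::{banach, second_countable_topology}"
  by (simp add: integral_restrict_space set_lebesgue_integral_def)

lemma integrable_time: "integrable (time T) f \<longleftrightarrow> set_integrable lborel {0..T} f"
  for f :: "real \<Rightarrow> 'b::{banach, second_countable_topology}"
  by (simp add: integrable_restrict_space set_integrable_def)

lemma measurable_time_eq: "measurable (restrict_space borel {0..T} \<Otimes>\<^sub>M N) L = measurable (time T \<Otimes>\<^sub>M N) L"
  by (intro measurable_cong_sets sets_pair_measure_cong sets_restrict_space_cong) auto

context brownian_family
begin

abbreviation progressive :: "real \<Rightarrow> (real \<Rightarrow> 'w \<Rightarrow> 'b::topological_space) \<Rightarrow> bool" where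
  "progressive T Y \<equiv> progressively_measurable T \<F> Y"

lemma progressiveI:
  assumes "\<And>t. t \<in> {0..T} \<Longrightarrow> (\<lambda>z. Y (fst z) (snd z)) \<in> borel_measurable (restrict_space borel {0..t} \<Otimes>\<^sub>M \<F> t)"
  shows "progressive T Y"
  using assms by (simp add: progressively_measurable_def case_prod_unfold)

lemma progressiveD:
  assumes "progressive T Y" "t \<in> {0..T}"
  shows "(\<lambda>z. Y (fst z) (snd z)) \<in> borel_measurable (restrict_space borel {0..t} \<Otimes>\<^sub>M \<F> t)"
  using assms by (simp add: progressively_measurable_def case_prod_unfold)

lemma progressive_adapted:
  assumes "progressive T Y" "t \<in> {0..T}"
  shows "Y t \<in> borel_measurable (\<F> t)"
proof -
  have "(\<lambda>\<omega>. (t, \<omega>)) \<in> measurable (\<F> t) (restrict_space borel {0..t} \<Otimes>\<^sub>M \<F> t)"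
    using assms(2) by (intro measurable_Pair1') (auto simp: space_restrict_space)
  from measurable_compose[OF this progressiveD[OF assms]] show ?thesis by simp
qed

lemma progressive_jointly_measurable:
  assumes "progressive T Y" "T \<ge> 0"
  shows "(\<lambda>z. Y (fst z) (snd z)) \<in> borel_measurable (time T \<Otimes>\<^sub>M M)"
proof -
  have "(\<lambda>x. x) \<in> measurable M (\<F> T)"
    using filtration_subset[of T] by (auto simp: measurable_def sets.sets_into_space intro: sets.Int_space_eq1[THEN ssubst])
  then have "(\<lambda>z. (fst z, snd z)) \<in> measurable (time T \<Otimes>\<^sub>M M) (time T \<Otimes>\<^sub>M \<F> T)"
    by (intro measurable_Pair measurable_fst measurable_compose[OF measurable_snd])
  from measurable_compose[OF this progressiveD[OF assms(1), of T, unfolded measurable_time_eq]]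
  show ?thesis using assms(2) by simp
qed

lemma progressive_const: "progressive T (\<lambda>t \<omega>. c)"
  by (rule progressiveI) simp

lemma progressive_add:
  fixes Y Z :: "real \<Rightarrow> 'w \<Rightarrow> 'b::{second_countable_topology, real_normed_vector}"
  assumes "progressive T Y" "progressive T Z"
  shows "progressive T (\<lambda>t \<omega>. Y t \<omega> + Z t \<omega>)"
  by (rule progressiveI) (intro borel_measurable_add progressiveD[OF assms(1)] progressiveD[OF assms(2)])

lemma progressive_scaleR:
  fixes Y :: "real \<Rightarrow> 'w \<Rightarrow> 'b::{second_countable_topology, real_normed_vector}"
  assumes "progressive T Y"
  shows "progressive T (\<lambda>t \<omega>. c *\<^sub>R Y t \<omega>)"
  by (rule progressiveI) (intro borel_measurable_scaleR borel_measurable_const progressiveD[OF assms])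

lemma progressive_vec_lambda:
  fixes Y :: "'n \<Rightarrow> real \<Rightarrow> 'w \<Rightarrow> real"
  assumes "\<And>i. progressive T (Y i)"
  shows "progressive T (\<lambda>t \<omega>. \<chi> i. Y i t \<omega>)"
proof (rule progressiveI)
  fix t assume t: "t \<in> {0..T}"
  have "(\<lambda>z. \<Sum>i\<in>UNIV. Y i (fst z) (snd z) *\<^sub>R axis i (1::real))
      \<in> borel_measurable (restrict_space borel {0..t} \<Otimes>\<^sub>M \<F> t)"
    by (intro borel_measurable_sum borel_measurable_scaleR borel_measurable_const progressiveD[OF assms t])
  also have "(\<lambda>z. \<Sum>i\<in>UNIV. Y i (fst z) (snd z) *\<^sub>R axis i (1::real)) = (\<lambda>z. \<chi> i. Y i (fst z) (snd z))"
    by (auto simp: fun_eq_iff vec_eq_iff axis_def if_distrib sum.delta' cong: if_cong)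
  finally show "(\<lambda>z. \<chi> i. Y i (fst z) (snd z)) \<in> borel_measurable (restrict_space borel {0..t} \<Otimes>\<^sub>M \<F> t)" .
qed

lemma progressive_component:
  fixes Y :: "real \<Rightarrow> 'w \<Rightarrow> real^'n"
  assumes "progressive T Y"
  shows "progressive T (\<lambda>t \<omega>. Y t \<omega> $ i)"
  by (rule progressiveI)
    (rule measurable_compose[OF progressiveD[OF assms]], auto intro!: borel_measurable_continuous_onI continuous_intros)

lemma progressive_matrix_vector:
  fixes Y :: "real \<Rightarrow> 'w \<Rightarrow> real^'n"
  assumes B: "continuous_on {0..T} B" and Y: "progressive T Y"
  shows "progressive T (\<lambda>t \<omega>. B t *v Y t \<omega>)"
proof (rule progressiveI)
  fix t assume t: "t \<in> {0..T}"
  have "B \<in> borel_measurable (restrict_space borel {0..t})"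
    using t by (intro borel_measurable_continuous_on_restrict continuous_on_subset[OF B]) auto
  then have "(\<lambda>z. B (fst z)) \<in> borel_measurable (restrict_space borel {0..t} \<Otimes>\<^sub>M \<F> t)"
    by (rule measurable_compose[OF measurable_fst])
  from borel_measurable_continuous_Pair[OF this progressiveD[OF Y t], of "(*v)"]
  show "(\<lambda>z. B (fst z) *v Y (fst z) (snd z)) \<in> borel_measurable (restrict_space borel {0..t} \<Otimes>\<^sub>M \<F> t)"
    by (simp add: matrix_vector.continuous_on continuous_on_fst continuous_on_snd continuous_on_id)
qed

text \<open>A continuous adapted path is the limit of its values on grids from the left.\<close>

lemma progressive_W: "progressive T (W i)"
proof (rule progressiveI)
  fix t assume t: "t \<in> {0..T}"
  \<comment> \<open>Rounding down keeps the grid time in the past; \<open>min t\<close> makes all grid values adapted to time \<open>t\<close>.\<close>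
  define g where "g n s = nat \<lfloor>s * Suc n\<rfloor>" for n :: nat and s :: real
  define Wn where "Wn n z = W i (min t (real (g n (fst z)) / Suc n)) (snd z)" for n and z :: "real \<times> 'w"
  show "(\<lambda>z. W i (fst z) (snd z)) \<in> borel_measurable (restrict_space borel {0..t} \<Otimes>\<^sub>M \<F> t)"
  proof (rule borel_measurable_LIMSEQ_real)
    fix z assume "z \<in> space (restrict_space borel {0..t} \<Otimes>\<^sub>M \<F> t)"
    then have z: "fst z \<in> {0..t}" "snd z \<in> space M"
      by (auto simp: space_pair_measure space_restrict_space)
    have lim: "(\<lambda>n. min t (real (g n (fst z)) / Suc n)) \<longlonglongrightarrow> fst z"
    proof (rule tendsto_sandwich)
      show "\<forall>\<^sub>F n in sequentially. fst z - 1 / Suc n \<le> min t (real (g n (fst z)) / Suc n)"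
      proof (rule always_eventually, rule allI)
        fix n
        have "fst z * Suc n - 1 \<le> real (g n (fst z))" unfolding g_def by linarith
        then have "(fst z * Suc n - 1) / Suc n \<le> real (g n (fst z)) / Suc n" by (rule divide_right_mono) simp
        then show "fst z - 1 / Suc n \<le> min t (real (g n (fst z)) / Suc n)"
          using z by (simp add: diff_divide_distrib del: of_nat_Suc) (smt (verit) divide_nonneg_pos of_nat_0_less_iff zero_less_Suc)
      qed
      show "\<forall>\<^sub>F n in sequentially. min t (real (g n (fst z)) / Suc n) \<le> fst z"
      proof (rule always_eventually, rule allI)
        fix n
        have "real (g n (fst z)) \<le> fst z * Suc n"
          unfolding g_def using z by (simp add: of_nat_nat)
        then show "min t (real (g n (fst z)) / Suc n) \<le> fst z"
          by (simp add: pos_divide_le_eq min.coboundedI2 del: of_nat_Suc)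
      qed
      have "(\<lambda>n. fst z - 1 / Suc n) \<longlonglongrightarrow> fst z - 0"
        by (intro tendsto_diff tendsto_const LIMSEQ_Suc[OF lim_1_over_n])
      then show "(\<lambda>n. fst z - 1 / Suc n) \<longlonglongrightarrow> fst z" by simp
    qed simp
    have "continuous (at (fst z) within {0..}) (\<lambda>t. W i t (snd z))"
      using W_continuous[OF z(2), of i] z(1) by (auto simp: continuous_on_eq_continuous_within)
    from continuous_within_tendsto_compose[OF this _ lim]
    show "(\<lambda>n. Wn n z) \<longlonglongrightarrow> W i (fst z) (snd z)"
      using t unfolding Wn_def by auto
  next
    fix n
    have "(\<lambda>z. (\<lambda>k z. W i (min t (real k / Suc n)) (snd z)) (g n (fst z)) z)
        \<in> borel_measurable (restrict_space borel {0..t} \<Otimes>\<^sub>M \<F> t)"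
    proof (rule measurable_compose_countable[where f = "\<lambda>k z. W i (min t (real k / Suc n)) (snd z)" and g = "\<lambda>z. g n (fst z)"])
      fix k :: nat
      show "(\<lambda>z. W i (min t (real k / Suc n)) (snd z)) \<in> borel_measurable (restrict_space borel {0..t} \<Otimes>\<^sub>M \<F> t)"
        using t by (intro measurable_compose[OF measurable_snd] W_adapted) auto
      have "g n \<in> measurable borel (count_space UNIV)"
        unfolding g_def by measurable
      then have "g n \<in> measurable (restrict_space borel {0..t}) (count_space UNIV)"
        by (rule measurable_restrict_space1)
      then show "(\<lambda>z. g n (fst z)) \<in> measurable (restrict_space borel {0..t} \<Otimes>\<^sub>M \<F> t) (count_space UNIV)"
        by (rule measurable_compose[OF measurable_fst])
    qed
    then show "Wn n \<in> borel_measurable (restrict_space borel {0..t} \<Otimes>\<^sub>M \<F> t)"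
      by (simp add: Wn_def[abs_def])
  qed
qed

lemma progressive_integral:
  fixes Y :: "real \<Rightarrow> 'w \<Rightarrow> 'b::{banach, second_countable_topology}"
  assumes "progressive T Y"
  shows "progressive T (\<lambda>t \<omega>. LINT s:{0..t}|lborel. Y s \<omega>)"
proof (rule progressiveI)
  fix t assume t: "t \<in> {0..T}"
  let ?N = "restrict_space borel {0..t} \<Otimes>\<^sub>M \<F> t"
  interpret time: finite_measure "time t" by (rule finite_measure_time)
  have "(\<lambda>p. (snd p, snd (fst p))) \<in> measurable (?N \<Otimes>\<^sub>M time t) (time t \<Otimes>\<^sub>M \<F> t)"
    by (intro measurable_Pair measurable_snd measurable_compose[OF measurable_fst])
  from measurable_compose[OF this progressiveD[OF assms t, unfolded measurable_time_eq]]
  have Y: "(\<lambda>p. Y (snd p) (snd (fst p))) \<in> borel_measurable (?N \<Otimes>\<^sub>M time t)" by simp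
  have f: "(\<lambda>p. fst (fst p)) \<in> borel_measurable (?N \<Otimes>\<^sub>M time t)"
    by (intro measurable_compose[OF measurable_fst] measurable_compose[OF measurable_fst] measurable_restrict_space1) simp
  have s: "snd \<in> borel_measurable (?N \<Otimes>\<^sub>M time t)"
    by (rule measurable_compose[OF measurable_snd]) (auto intro: measurable_restrict_space1)
  have "{p \<in> space (?N \<Otimes>\<^sub>M time t). snd p \<le> fst (fst p)} \<in> sets (?N \<Otimes>\<^sub>M time t)"
    using s f by (rule borel_measurable_le)
  then have "(\<lambda>p. indicator {p \<in> space (?N \<Otimes>\<^sub>M time t). snd p \<le> fst (fst p)} p *\<^sub>R Y (snd p) (snd (fst p)))
      \<in> borel_measurable (?N \<Otimes>\<^sub>M time t)"
    by (intro borel_measurable_scaleR borel_measurable_indicator Y)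
  also have "?this \<longleftrightarrow> (\<lambda>(z, s). indicator {..fst z} s *\<^sub>R Y s (snd z)) \<in> borel_measurable (?N \<Otimes>\<^sub>M time t)"
    by (rule measurable_cong) (auto simp: indicator_def)
  finally have "(\<lambda>z. \<integral>s. indicator {..fst z} s *\<^sub>R Y s (snd z) \<partial>time t) \<in> borel_measurable ?N"
    by (rule time.borel_measurable_lebesgue_integral)
  also have "?this \<longleftrightarrow> (\<lambda>z. LINT s:{0..fst z}|lborel. Y s (snd z)) \<in> borel_measurable ?N"
  proof (rule measurable_cong)
    fix z assume "z \<in> space ?N"
    then have z: "fst z \<in> {0..t}" by (auto simp: space_pair_measure space_restrict_space)
    have "(\<integral>s. indicator {..fst z} s *\<^sub>R Y s (snd z) \<partial>time t)
       = (\<integral>s. indicator {0..t} s *\<^sub>R indicator {..fst z} s *\<^sub>R Y s (snd z) \<partial>lborel)"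
      by (simp add: integral_restrict_space)
    also have "\<dots> = (\<integral>s. indicator {0..fst z} s *\<^sub>R Y s (snd z) \<partial>lborel)"
      using z by (intro Bochner_Integration.integral_cong) (auto simp: indicator_def)
    finally show "(\<integral>s. indicator {..fst z} s *\<^sub>R Y s (snd z) \<partial>time t) = (LINT s:{0..fst z}|lborel. Y s (snd z))"
      by (simp add: set_lebesgue_integral_def)
  qed
  finally show "(\<lambda>z. LINT s:{0..fst z}|lborel. Y s (snd z)) \<in> borel_measurable ?N" .
qed

end

section \<open>The state equation\<close>

lemma continuous_on_indefinite_lebesgue_integral:
  fixes f :: "real \<Rightarrow> 'b::euclidean_space"
  assumes "set_integrable lborel {0..T} f"
  shows "continuous_on {0..T} (\<lambda>t. LINT s:{0..t}|lborel. f s)"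
proof -
  have "continuous_on {0..T} (\<lambda>t. integral {0..t} f)"
    by (rule indefinite_integral_continuous_1[OF set_borel_integral_eq_integral(1)[OF assms]])
  moreover have "integral {0..t} f = (LINT s:{0..t}|lborel. f s)" if "t \<in> {0..T}" for t
    by (rule set_borel_integral_eq_integral(2)[symmetric], rule set_integrable_subset[OF assms]) (use that in auto)
  ultimately show ?thesis by (rule continuous_on_eq)
qed

lemma continuous_on_component_iff:
  "continuous_on S x \<longleftrightarrow> (\<forall>i. continuous_on S (\<lambda>t. x t $ i))" for x :: "'a::topological_space \<Rightarrow> real^'n"
proof
  assume "\<forall>i. continuous_on S (\<lambda>t. x t $ i)"
  then have "continuous_on S (\<lambda>t. \<chi> i. x t $ i)" by (intro continuous_on_vec_lambda) auto
  then show "continuous_on S x" by simp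
qed (auto intro: continuous_on_component)

text \<open>For one path, the componentwise Lebesgue equation of the state with drift \<open>B x + v\<close> is a linear
  Volterra equation whose forcing collects the initial value, the open-loop control \<open>v\<close> and the
  noise.\<close>

lemma pathwise_state_equation:
  fixes x :: "real \<Rightarrow> real^'n" and v w g :: "'n \<Rightarrow> real \<Rightarrow> real"
  assumes B: "continuous_on {0..T} B"
    and v: "\<And>i. set_integrable lborel {0..T} (v i)"
    and w: "\<And>i. continuous_on {0..T} (w i)"
    and g: "\<And>i t. t \<in> {0..T} \<Longrightarrow> g i t = (B t *v x t) $ i + v i t"
    and h: "\<And>t. h t = (\<chi> i. x0 $ i + (LINT s:{0..t}|lborel. v i s) + \<sigma> * w i t)"
  shows "continuous_on {0..T} h" (is ?cont)
    and "(\<forall>i. \<forall>t\<in>{0..T}. set_integrable lborel {0..t} (g i) \<and>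
            x t $ i = x0 $ i + (LINT s:{0..t}|lborel. g i s) + \<sigma> * w i t) \<longleftrightarrow>
          continuous_on {0..T} x \<and> (\<forall>t\<in>{0..T}. x t = h t + integral {0..t} (\<lambda>s. B s *v x s))"
      (is "?L \<longleftrightarrow> ?R")
proof -
  show ?cont
    unfolding h by (intro continuous_on_vec_lambda continuous_intros w continuous_on_indefinite_lebesgue_integral v)
  have decomp: "set_integrable lborel {0..t} (g i)"
      "x0 $ i + (LINT s:{0..t}|lborel. g i s) + \<sigma> * w i t = (h t + integral {0..t} (\<lambda>s. B s *v x s)) $ i"
    if x: "continuous_on {0..T} x" and t: "t \<in> {0..T}" for t i
  proof -
    have sub: "{0..t} \<subseteq> {0..T}" using t by auto
    have Bx: "continuous_on {0..t} (\<lambda>s. B s *v x s)"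
      by (intro matrix_vector.continuous_on continuous_on_subset[OF B sub] continuous_on_subset[OF x sub])
    then have Bxi: "set_integrable lborel {0..t} (\<lambda>s. (B s *v x s) $ i)"
      by (intro borel_integrable_atLeastAtMost' continuous_on_component)
    have vi: "set_integrable lborel {0..t} (v i)"
      using sub by (intro set_integrable_subset[OF v]) auto
    have gi: "set_integrable lborel {0..t} (g i) \<longleftrightarrow> set_integrable lborel {0..t} (\<lambda>s. (B s *v x s) $ i + v i s)"
      using sub g by (intro set_integrable_cong) auto
    show "set_integrable lborel {0..t} (g i)"
      unfolding gi using Bxi vi by (rule set_integral_add)
    have "(LINT s:{0..t}|lborel. g i s) = (LINT s:{0..t}|lborel. (B s *v x s) $ i + v i s)"
      using sub g by (intro set_lebesgue_integral_cong) auto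
    also have "\<dots> = (LINT s:{0..t}|lborel. (B s *v x s) $ i) + (LINT s:{0..t}|lborel. v i s)"
      using Bxi vi by (rule set_integral_add)
    also have "(LINT s:{0..t}|lborel. (B s *v x s) $ i) = integral {0..t} (\<lambda>s. (B s *v x s) $ i)"
      by (rule set_borel_integral_eq_integral(2)[OF Bxi])
    also have "\<dots> = integral {0..t} (\<lambda>s. B s *v x s) $ i"
      by (rule integral_component_eq_cart[OF integrable_continuous_interval[OF Bx]])
    finally show "x0 $ i + (LINT s:{0..t}|lborel. g i s) + \<sigma> * w i t = (h t + integral {0..t} (\<lambda>s. B s *v x s)) $ i"
      by (simp add: h)
  qed
  show "?L \<longleftrightarrow> ?R"
  proof
    assume L: ?L
    have x: "continuous_on {0..T} x"
      unfolding continuous_on_component_iff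
    proof
      fix i
      have "set_integrable lborel {0..T} (g i) \<or> {0..T} = {}" using L by fastforce
      then have "continuous_on {0..T} (\<lambda>t. LINT s:{0..t}|lborel. g i s)"
        using continuous_on_indefinite_lebesgue_integral[of T "g i"] by auto
      then have "continuous_on {0..T} (\<lambda>t. x0 $ i + (LINT s:{0..t}|lborel. g i s) + \<sigma> * w i t)"
        by (intro continuous_intros w)
      then show "continuous_on {0..T} (\<lambda>t. x t $ i)"
        by (rule continuous_on_eq) (use L in auto)
    qed
    moreover have "x t = h t + integral {0..t} (\<lambda>s. B s *v x s)" if t: "t \<in> {0..T}" for t
      unfolding vec_eq_iff
    proof
      fix i
      have "x t $ i = x0 $ i + (LINT s:{0..t}|lborel. g i s) + \<sigma> * w i t" using L t by blast
      then show "x t $ i = (h t + integral {0..t} (\<lambda>s. B s *v x s)) $ i"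
        unfolding decomp(2)[OF x t] .
    qed
    ultimately show ?R by blast
  next
    assume R: ?R
    then have x: "continuous_on {0..T} x" by blast
    show ?L
    proof (intro allI ballI conjI)
      fix i t assume t: "t \<in> {0..T}"
      show "set_integrable lborel {0..t} (g i)" by (rule decomp(1)[OF x t])
      have "x t = h t + integral {0..t} (\<lambda>s. B s *v x s)" by (rule bspec[OF conjunct2[OF R] t])
      then show "x t $ i = x0 $ i + (LINT s:{0..t}|lborel. g i s) + \<sigma> * w i t"
        unfolding decomp(2)[OF x t] by (rule arg_cong)
    qed
  qed
qed

context brownian_family
begin

definition forcing :: "real^'n \<Rightarrow> real \<Rightarrow> ('n \<Rightarrow> real \<Rightarrow> 'w \<Rightarrow> real) \<Rightarrow> real \<Rightarrow> 'w \<Rightarrow> real^'n" where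
  "forcing x0 \<sigma> v t \<omega> = (\<chi> i. x0 $ i + (LINT s:{0..t}|lborel. v i s \<omega>) + \<sigma> * W i t \<omega>)"

lemma continuous_W: "\<omega> \<in> space M \<Longrightarrow> continuous_on {0..T} (\<lambda>t. W i t \<omega>)"
  by (rule continuous_on_subset[OF W_continuous]) auto

lemma forcing_continuous:
  assumes "\<And>i. set_integrable lborel {0..T} (\<lambda>s. v i s \<omega>)" "\<omega> \<in> space M"
  shows "continuous_on {0..T} (\<lambda>t. forcing x0 \<sigma> v t \<omega>)"
  unfolding forcing_def
  by (intro continuous_on_vec_lambda continuous_intros continuous_W
      continuous_on_indefinite_lebesgue_integral assms)

lemma progressive_forcing:
  assumes "\<And>i. progressive T (v i)"
  shows "progressive T (forcing x0 \<sigma> v)"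
  unfolding forcing_def[abs_def]
  by (intro progressive_vec_lambda progressive_add progressive_const progressive_integral assms
      progressive_scaleR[where 'b = real, simplified] progressive_W)

lemma state_process_iff:
  assumes B: "continuous_on {0..T} B"
    and v: "AE \<omega> in M. \<forall>i. set_integrable lborel {0..T} (\<lambda>s. v i s \<omega>)"
    and \<beta>: "\<And>i t \<omega>. t \<in> {0..T} \<Longrightarrow> \<beta> i t \<omega> - a * (L *v X t \<omega>) $ i = (B t *v X t \<omega>) $ i + v i t \<omega>"
  shows "state_process M W L a \<sigma> T x0 \<beta> X \<longleftrightarrow> progressive T X \<and>
    (AE \<omega> in M. continuous_on {0..T} (\<lambda>t. X t \<omega>) \<and>
      (\<forall>t\<in>{0..T}. X t \<omega> = forcing x0 \<sigma> v t \<omega> + integral {0..t} (\<lambda>s. B s *v X s \<omega>)))"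
proof -
  have "AE \<omega> in M. (\<forall>i. \<forall>t\<in>{0..T}.
      set_integrable lborel {0..t} (\<lambda>s. \<beta> i s \<omega> - a * (L *v X s \<omega>) $ i) \<and>
      X t \<omega> $ i = x0 $ i + (LINT s:{0..t}|lborel. \<beta> i s \<omega> - a * (L *v X s \<omega>) $ i) + \<sigma> * W i t \<omega>)
    \<longleftrightarrow> (continuous_on {0..T} (\<lambda>t. X t \<omega>) \<and>
      (\<forall>t\<in>{0..T}. X t \<omega> = forcing x0 \<sigma> v t \<omega> + integral {0..t} (\<lambda>s. B s *v X s \<omega>)))"
    using v AE_space
  proof eventually_elim
    case (elim \<omega>)
    show ?case
      by (rule pathwise_state_equation(2)[where x = "\<lambda>t. X t \<omega>" and v = "\<lambda>i s. v i s \<omega>"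
            and w = "\<lambda>i t. W i t \<omega>" and g = "\<lambda>i s. \<beta> i s \<omega> - a * (L *v X s \<omega>) $ i", OF B])
        (use elim in \<open>auto simp: \<beta> forcing_def intro: continuous_W\<close>)
  qed
  from eventually_subst[OF this] show ?thesis
    unfolding state_process_def by (rule conj_cong[OF refl])
qed

text \<open>Covers both the feedback profile (\<open>v = 0\<close>) and a deviation (\<open>v\<close> is the control of the deviating
  player, whose row of \<open>B\<close> loses its feedback part). The solution formula for the Volterra equation
  is used on all paths, including those where \<open>v\<close> is not integrable, so that the process is
  progressively measurable for the raw filtration.\<close>

lemma affine_profile_well_posed:
  assumes T: "T \<ge> 0" and B: "continuous_on {0..T} B"
    and v: "AE \<omega> in M. \<forall>i. set_integrable lborel {0..T} (\<lambda>s. v i s \<omega>)"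
    and v_prog: "\<And>i. progressive T (v i)"
    and \<Phi>: "\<And>X i t \<omega>. t \<in> {0..T} \<Longrightarrow> \<Phi> X i t \<omega> - a * (L *v X t \<omega>) $ i = (B t *v X t \<omega>) $ i + v i t \<omega>"
  shows "well_posed M W L a \<sigma> T x0 \<Phi>"
proof (rule linear_volterra_equation[OF T B])
  fix \<Psi> \<Theta> :: "real \<Rightarrow> real^'n^'n"
  assume c: "continuous_on {0..T} \<Psi>" "continuous_on {0..T} \<Theta>" and
    eq: "\<And>h x. continuous_on {0..T} h \<Longrightarrow>
      (continuous_on {0..T} x \<and> (\<forall>t\<in>{0..T}. x t = h t + integral {0..t} (\<lambda>s. B s *v x s)))
        \<longleftrightarrow> (\<forall>t\<in>{0..T}. x t = h t + \<Psi> t *v integral {0..t} (\<lambda>s. \<Theta> s *v h s))"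
  let ?h = "forcing x0 \<sigma> v"
  define X where "X t \<omega> = ?h t \<omega> + \<Psi> t *v (LINT s:{0..t}|lborel. \<Theta> s *v ?h s \<omega>)" for t \<omega>
  have X_prog: "progressive T X"
    unfolding X_def[abs_def]
    by (intro progressive_add progressive_forcing v_prog progressive_matrix_vector c progressive_integral)
  have hc: "continuous_on {0..T} (\<lambda>t. ?h t \<omega>)"
    if "\<forall>i. set_integrable lborel {0..T} (\<lambda>s. v i s \<omega>)" "\<omega> \<in> space M" for \<omega>
    by (rule forcing_continuous) (use that in auto)
  have X: "\<forall>t\<in>{0..T}. X t \<omega> = ?h t \<omega> + \<Psi> t *v integral {0..t} (\<lambda>s. \<Theta> s *v ?h s \<omega>)"
    if "\<forall>i. set_integrable lborel {0..T} (\<lambda>s. v i s \<omega>)" "\<omega> \<in> space M" for \<omega>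
  proof
    fix t assume t: "t \<in> {0..T}"
    have sub: "{0..t} \<subseteq> {0..T}" using t by auto
    have "continuous_on {0..t} (\<lambda>s. \<Theta> s *v ?h s \<omega>)"
      by (intro matrix_vector.continuous_on continuous_on_subset[OF c(2) sub]
          continuous_on_subset[OF hc[OF that] sub])
    then have "(LINT s:{0..t}|lborel. \<Theta> s *v ?h s \<omega>) = integral {0..t} (\<lambda>s. \<Theta> s *v ?h s \<omega>)"
      by (intro set_borel_integral_eq_integral(2) borel_integrable_atLeastAtMost')
    then show "X t \<omega> = ?h t \<omega> + \<Psi> t *v integral {0..t} (\<lambda>s. \<Theta> s *v ?h s \<omega>)" by (simp add: X_def)
  qed
  have sp: "state_process M W L a \<sigma> T x0 (\<Phi> Y) Y \<longleftrightarrow> progressive T Y \<and>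
    (AE \<omega> in M. continuous_on {0..T} (\<lambda>t. Y t \<omega>) \<and>
      (\<forall>t\<in>{0..T}. Y t \<omega> = ?h t \<omega> + integral {0..t} (\<lambda>s. B s *v Y s \<omega>)))" for Y
    by (rule state_process_iff[OF B v \<Phi>])
  show ?thesis
    unfolding well_posed_def
  proof (intro exI conjI allI impI)
    have "AE \<omega> in M. continuous_on {0..T} (\<lambda>t. X t \<omega>) \<and>
      (\<forall>t\<in>{0..T}. X t \<omega> = ?h t \<omega> + integral {0..t} (\<lambda>s. B s *v X s \<omega>))"
      using v AE_space
    proof eventually_elim
      case (elim \<omega>)
      then have v': "\<forall>i. set_integrable lborel {0..T} (\<lambda>s. v i s \<omega>)" "\<omega> \<in> space M" by auto
      show ?case by (rule eq[OF hc[OF v'], THEN iffD2, OF X[OF v']])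
    qed
    with X_prog show "state_process M W L a \<sigma> T x0 (\<Phi> X) X" unfolding sp by blast
    fix Y assume "state_process M W L a \<sigma> T x0 (\<Phi> Y) Y"
    then have Y: "AE \<omega> in M. continuous_on {0..T} (\<lambda>t. Y t \<omega>) \<and>
      (\<forall>t\<in>{0..T}. Y t \<omega> = ?h t \<omega> + integral {0..t} (\<lambda>s. B s *v Y s \<omega>))" unfolding sp by blast
    show "AE \<omega> in M. \<forall>t\<in>{0..T}. Y t \<omega> = X t \<omega>"
      using Y v AE_space
    proof eventually_elim
      case (elim \<omega>)
      then have v': "\<forall>i. set_integrable lborel {0..T} (\<lambda>s. v i s \<omega>)" "\<omega> \<in> space M" by auto
      show ?case
        using eq[OF hc[OF v'], THEN iffD1, OF elim(1)] X[OF v'] by simp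
    qed
  qed
qed

end

section \<open>Square-integrability of the state\<close>

definition square_integrable :: "'a measure \<Rightarrow> ('a \<Rightarrow> real) \<Rightarrow> bool" where
  "square_integrable N f \<longleftrightarrow> f \<in> borel_measurable N \<and> integrable N (\<lambda>x. (f x)\<^sup>2)"

lemma square_integrable_bound:
  assumes "square_integrable N g" "f \<in> borel_measurable N" "AE x in N. \<bar>f x\<bar> \<le> \<bar>g x\<bar>"
  shows "square_integrable N f"
  unfolding square_integrable_def
proof
  show "integrable N (\<lambda>x. (f x)\<^sup>2)"
  proof (rule Bochner_Integration.integrable_bound[where f = "\<lambda>x. (g x)\<^sup>2"])
    show "AE x in N. norm ((f x)\<^sup>2) \<le> norm ((g x)\<^sup>2)"
      using assms(3) by eventually_elim (simp add: abs_le_square_iff)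
  qed (use assms in \<open>auto simp: square_integrable_def\<close>)
qed (rule assms)

lemma square_integrable_mult:
  assumes "square_integrable N f" "square_integrable N g"
  shows "integrable N (\<lambda>x. f x * g x)"
proof (rule Bochner_Integration.integrable_bound[where f = "\<lambda>x. (f x)\<^sup>2 + (g x)\<^sup>2"])
  show "AE x in N. norm (f x * g x) \<le> norm ((f x)\<^sup>2 + (g x)\<^sup>2)"
  proof (rule AE_I2)
    fix x
    have "2 * (\<bar>f x\<bar> * \<bar>g x\<bar>) \<le> (f x)\<^sup>2 + (g x)\<^sup>2"
      using zero_le_power2[of "\<bar>f x\<bar> - \<bar>g x\<bar>"] by (simp add: power2_diff)
    moreover have "0 \<le> \<bar>f x\<bar> * \<bar>g x\<bar>" by simp
    ultimately have "\<bar>f x\<bar> * \<bar>g x\<bar> \<le> (f x)\<^sup>2 + (g x)\<^sup>2" by linarith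
    then show "norm (f x * g x) \<le> norm ((f x)\<^sup>2 + (g x)\<^sup>2)" by (simp add: abs_mult)
  qed
qed (use assms in \<open>auto simp: square_integrable_def\<close>)

lemma square_integrable_cmult:
  "square_integrable N f \<Longrightarrow> square_integrable N (\<lambda>x. c * f x)"
  by (auto simp: square_integrable_def power_mult_distrib)

lemma square_integrable_add:
  assumes "square_integrable N f" "square_integrable N g"
  shows "square_integrable N (\<lambda>x. f x + g x)"
proof -
  have "integrable N (\<lambda>x. (f x)\<^sup>2 + 2 * (f x * g x) + (g x)\<^sup>2)"
    using square_integrable_mult[OF assms] assms unfolding square_integrable_def
    by (intro Bochner_Integration.integrable_add integrable_mult_right) auto
  then show ?thesis
    using assms by (auto simp: square_integrable_def power2_sum algebra_simps)
qed

lemma square_integrable_diff: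
  assumes "square_integrable N f" "square_integrable N g"
  shows "square_integrable N (\<lambda>x. f x - g x)"
  using square_integrable_add[OF assms(1) square_integrable_cmult[OF assms(2), of "-1"]] by simp

lemma square_integrable_sum:
  assumes "\<And>i. i \<in> I \<Longrightarrow> square_integrable N (f i)"
  shows "square_integrable N (\<lambda>x. \<Sum>i\<in>I. f i x)"
proof (cases "finite I")
  case True
  then show ?thesis using assms
  proof (induction I)
    case (insert i I)
    then show ?case using square_integrable_add[of N "f i" "\<lambda>x. \<Sum>i\<in>I. f i x"] by simp
  qed (simp add: square_integrable_def)
qed (simp add: square_integrable_def)

lemma square_integrable_abs:
  "square_integrable N f \<Longrightarrow> square_integrable N (\<lambda>x. \<bar>f x\<bar>)"
  by (auto simp: square_integrable_def)

lemma (in finite_measure) square_integrable_const: "square_integrable M (\<lambda>x. c)"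
  by (simp add: square_integrable_def)

lemma (in finite_measure) square_integrable_integrable:
  "square_integrable M f \<Longrightarrow> integrable M f"
  using square_integrable_mult[OF _ square_integrable_const[of 1]] by simp

text \<open>Expand \<open>0 \<le> \<integral> (m f - \<integral> f)\<^sup>2\<close>, where \<open>m\<close> is the total mass.\<close>

lemma (in finite_measure) Cauchy_Schwarz_integral:
  assumes f: "square_integrable M f"
  shows "(\<integral>x. f x \<partial>M)\<^sup>2 \<le> measure M (space M) * (\<integral>x. (f x)\<^sup>2 \<partial>M)"
proof -
  define m I S where "m = measure M (space M)" and "I = (\<integral>x. f x \<partial>M)" and "S = (\<integral>x. (f x)\<^sup>2 \<partial>M)"
  have i: "integrable M f" "integrable M (\<lambda>x. (f x)\<^sup>2)"
    using square_integrable_integrable[OF f] f by (auto simp: square_integrable_def)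
  have "0 \<le> (\<integral>x. (m * f x - I)\<^sup>2 \<partial>M)" by simp
  also have "\<dots> = (\<integral>x. m\<^sup>2 * (f x)\<^sup>2 - 2 * m * I * f x + I\<^sup>2 \<partial>M)"
    by (intro Bochner_Integration.integral_cong) (auto simp: power2_eq_square algebra_simps)
  also have "\<dots> = m\<^sup>2 * S - 2 * m * I * I + I\<^sup>2 * m"
    using i by (simp add: S_def I_def m_def)
  also have "\<dots> = m * (m * S - I\<^sup>2)" by (simp add: power2_eq_square algebra_simps)
  finally have *: "0 \<le> m * (m * S - I\<^sup>2)" .
  show ?thesis
  proof (cases "m = 0")
    case True
    then have "emeasure M (space M) = 0" by (simp add: m_def emeasure_eq_measure)
    then have "AE x in M. f x = 0" by (intro AE_I'[of "space M"]) (auto simp: null_sets_def)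
    then have "I = 0" unfolding I_def by (simp add: integral_eq_zero_AE)
    then show ?thesis by (simp add: m_def[symmetric] I_def[symmetric] S_def[symmetric] True)
  next
    case False
    then have "m > 0" by (simp add: m_def zero_less_measure_iff measure_nonneg less_le)
    with * show ?thesis by (simp add: m_def[symmetric] I_def[symmetric] S_def[symmetric] zero_le_mult_iff)
  qed
qed

context brownian_family
begin

lemma time_pair: "pair_sigma_finite (time T) M"
  by (intro pair_sigma_finite.intro finite_measure.sigma_finite_measure finite_measure_time sigma_finite_measure_axioms)

lemma measurable_time_weight:
  fixes f :: "real \<Rightarrow> real"
  assumes "continuous_on {0..T} f"
  shows "(\<lambda>z. f (fst z)) \<in> borel_measurable (time T \<Otimes>\<^sub>M M)"
  by (rule measurable_compose[OF measurable_fst])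
    (use borel_measurable_continuous_on_restrict[OF assms] in
      \<open>simp add: measurable_cong_sets[OF sets_restrict_space_cong[OF sets_lborel] refl]\<close>)

lemma integrable_time_weight:
  fixes f :: "real \<Rightarrow> real" and g :: "real \<times> 'w \<Rightarrow> real"
  assumes f: "continuous_on {0..T} f" and g: "integrable (time T \<Otimes>\<^sub>M M) g"
  shows "integrable (time T \<Otimes>\<^sub>M M) (\<lambda>z. f (fst z) * g z)"
proof -
  obtain C where C: "C \<ge> 0" "\<And>s. s \<in> {0..T} \<Longrightarrow> norm (f s) \<le> C"
    using continuous_on_interval_bound[OF f] by metis
  show ?thesis
  proof (rule Bochner_Integration.integrable_bound[where f = "\<lambda>z. C * g z"])
    show "AE z in time T \<Otimes>\<^sub>M M. norm (f (fst z) * g z) \<le> norm (C * g z)"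
      using C by (intro AE_I2) (auto simp: space_pair_measure space_restrict_space abs_mult intro!: mult_right_mono)
    show "(\<lambda>z. f (fst z) * g z) \<in> borel_measurable (time T \<Otimes>\<^sub>M M)"
      using g by (intro borel_measurable_times measurable_time_weight f) simp
  qed (use g in simp)
qed

lemma square_integrable_time_weight:
  assumes f: "continuous_on {0..T} f" and g: "square_integrable (time T \<Otimes>\<^sub>M M) g"
  shows "square_integrable (time T \<Otimes>\<^sub>M M) (\<lambda>z. f (fst z) * g z)"
proof -
  have "continuous_on {0..T} (\<lambda>s. (f s)\<^sup>2)" by (intro continuous_intros f)
  from integrable_time_weight[OF this, of "\<lambda>z. (g z)\<^sup>2"] show ?thesis
    using g by (auto simp: square_integrable_def power_mult_distrib intro!: borel_measurable_times measurable_time_weight f)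
qed

lemma square_integrable_random_variable:
  assumes "square_integrable M Z" "T \<ge> 0"
  shows "square_integrable (time T \<Otimes>\<^sub>M M) (\<lambda>z. Z (snd z))"
proof -
  interpret P: pair_sigma_finite "time T" M by (rule time_pair)
  interpret time: finite_measure "time T" by (rule finite_measure_time)
  have [measurable]: "Z \<in> borel_measurable M" and Z: "integrable M (\<lambda>\<omega>. (Z \<omega>)\<^sup>2)"
    using assms by (auto simp: square_integrable_def)
  have "integrable (time T \<Otimes>\<^sub>M M) (\<lambda>z. (Z (snd z))\<^sup>2)"
    by (rule P.Fubini_integrable) (use Z in auto)
  then show ?thesis by (simp add: square_integrable_def)
qed

lemma square_integrable_W:
  assumes "t \<ge> 0"
  shows "square_integrable M (W i t)" "expectation (\<lambda>\<omega>. (W i t \<omega>)\<^sup>2) = t"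
proof -
  have [measurable]: "W i t \<in> borel_measurable M" "W i 0 \<in> borel_measurable M" using W_measurable assms by auto
  have eq: "AE \<omega> in M. (W i t \<omega> - W i 0 \<omega>)\<^sup>2 = (W i t \<omega>)\<^sup>2"
    using W_zero[of i] by eventually_elim simp
  have "integrable M (\<lambda>\<omega>. (W i t \<omega>)\<^sup>2)"
    by (rule integrable_cong_AE_imp[OF brownian_motion_increment(2)[OF bm _ assms] _ eq]) auto
  then show "square_integrable M (W i t)" by (simp add: square_integrable_def)
  have "expectation (\<lambda>\<omega>. (W i t \<omega>)\<^sup>2) = expectation (\<lambda>\<omega>. (W i t \<omega> - W i 0 \<omega>)\<^sup>2)"
    using eq by (intro integral_cong_AE) auto
  then show "expectation (\<lambda>\<omega>. (W i t \<omega>)\<^sup>2) = t"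
    using brownian_motion_increment(4)[OF bm[of i] order_refl assms] by simp
qed

lemma square_integrable_W_process:
  assumes T: "T \<ge> 0"
  shows "square_integrable (time T \<Otimes>\<^sub>M M) (\<lambda>z. W i (fst z) (snd z))"
proof -
  interpret P: pair_sigma_finite "time T" M by (rule time_pair)
  have [measurable]: "(\<lambda>z. W i (fst z) (snd z)) \<in> borel_measurable (time T \<Otimes>\<^sub>M M)"
    by (rule progressive_jointly_measurable[OF progressive_W T])
  have "integrable (time T \<Otimes>\<^sub>M M) (\<lambda>z. (W i (fst z) (snd z))\<^sup>2)"
  proof (rule P.Fubini_integrable)
    have "set_integrable lborel {0..T} (\<lambda>t. t)"
      by (intro borel_integrable_atLeastAtMost' continuous_on_id)
    then have "integrable (time T) (\<lambda>t. t)" unfolding integrable_time .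
    also have "?this \<longleftrightarrow> integrable (time T) (\<lambda>t. \<integral>\<omega>. norm ((W i (fst (t, \<omega>)) (snd (t, \<omega>)))\<^sup>2) \<partial>M)"
      by (rule Bochner_Integration.integrable_cong) (auto simp: square_integrable_W space_restrict_space)
    finally show "integrable (time T) (\<lambda>t. \<integral>\<omega>. norm ((W i (fst (t, \<omega>)) (snd (t, \<omega>)))\<^sup>2) \<partial>M)" .
    show "AE t in time T. integrable M (\<lambda>\<omega>. (W i (fst (t, \<omega>)) (snd (t, \<omega>)))\<^sup>2)"
      using square_integrable_W(1) by (intro AE_I2) (auto simp: space_restrict_space square_integrable_def)
  qed simp
  then show ?thesis by (simp add: square_integrable_def)
qed

lemma square_integrable_time_integral:
  assumes Y: "square_integrable (time T \<Otimes>\<^sub>M M) (\<lambda>z. Y (fst z) (snd z))" and T: "T \<ge> 0"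
  shows "AE \<omega> in M. set_integrable lborel {0..T} (\<lambda>s. Y s \<omega>)"
    and "square_integrable M (\<lambda>\<omega>. LINT s:{0..T}|lborel. \<bar>Y s \<omega>\<bar>)"
proof -
  interpret P: pair_sigma_finite "time T" M by (rule time_pair)
  interpret time: finite_measure "time T" by (rule finite_measure_time)
  have meas [measurable]: "(\<lambda>z. Y (fst z) (snd z)) \<in> borel_measurable (time T \<Otimes>\<^sub>M M)"
    and i: "integrable (time T \<Otimes>\<^sub>M M) (\<lambda>(s, \<omega>). (Y s \<omega>)\<^sup>2)"
    using Y by (auto simp: square_integrable_def case_prod_unfold)
  have sq: "AE \<omega> in M. square_integrable (time T) (\<lambda>s. Y s \<omega>)"
    using P.AE_integrable_snd[OF i] AE_space
  proof eventually_elim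
    case (elim \<omega>)
    have "(\<lambda>s. (s, \<omega>)) \<in> measurable (time T) (time T \<Otimes>\<^sub>M M)" using elim by (intro measurable_Pair2') auto
    from measurable_compose[OF this meas] have "(\<lambda>s. Y s \<omega>) \<in> borel_measurable (time T)" by simp
    with elim show ?case by (simp add: square_integrable_def)
  qed
  then show "AE \<omega> in M. set_integrable lborel {0..T} (\<lambda>s. Y s \<omega>)"
    by eventually_elim (simp add: time.square_integrable_integrable integrable_time[symmetric])
  have "(\<lambda>z. \<bar>Y (fst z) (snd z)\<bar>) \<in> borel_measurable (time T \<Otimes>\<^sub>M M)" by measurable
  then have "(\<lambda>z. \<bar>Y (snd z) (fst z)\<bar>) \<in> borel_measurable (M \<Otimes>\<^sub>M time T)"
    using measurable_compose[OF measurable_pair_swap', of "\<lambda>z. \<bar>Y (fst z) (snd z)\<bar>" "time T" M borel]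
    by (simp add: case_prod_unfold)
  then have Zm: "(\<lambda>\<omega>. \<integral>s. \<bar>Y s \<omega>\<bar> \<partial>time T) \<in> borel_measurable M"
    by (intro P.M1.borel_measurable_lebesgue_integral) (simp add: case_prod_unfold)
  have "integrable M (\<lambda>\<omega>. (\<integral>s. \<bar>Y s \<omega>\<bar> \<partial>time T)\<^sup>2)"
  proof (rule Bochner_Integration.integrable_bound)
    show "integrable M (\<lambda>\<omega>. measure (time T) (space (time T)) * (\<integral>s. (Y s \<omega>)\<^sup>2 \<partial>time T))"
      using P.integrable_snd[OF i] by (rule integrable_mult_right)
    show "AE \<omega> in M. norm ((\<integral>s. \<bar>Y s \<omega>\<bar> \<partial>time T)\<^sup>2) \<le> norm (measure (time T) (space (time T)) * (\<integral>s. (Y s \<omega>)\<^sup>2 \<partial>time T))"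
      using sq
    proof eventually_elim
      case (elim \<omega>)
      from time.Cauchy_Schwarz_integral[OF square_integrable_abs[OF elim]]
      show ?case by simp
    qed
  qed (use Zm in simp)
  then show "square_integrable M (\<lambda>\<omega>. LINT s:{0..T}|lborel. \<bar>Y s \<omega>\<bar>)"
    using Zm by (simp add: square_integrable_def integral_time)
qed

lemma admissible_controls_iff:
  assumes "T \<ge> 0"
  shows "\<alpha> \<in> admissible_controls T M W \<longleftrightarrow>
    progressive T \<alpha> \<and> square_integrable (time T \<Otimes>\<^sub>M M) (\<lambda>z. \<alpha> (fst z) (snd z))"
proof -
  interpret P: pair_sigma_finite "time T" M by (rule time_pair)
  have "(\<integral>\<^sup>+\<omega>. (\<integral>\<^sup>+t\<in>{0..T}. ennreal ((\<alpha> t \<omega>)\<^sup>2) \<partial>lborel) \<partial>M) < \<infinity> \<longleftrightarrow>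
    integrable (time T \<Otimes>\<^sub>M M) (\<lambda>z. (\<alpha> (fst z) (snd z))\<^sup>2)" if "progressive T \<alpha>"
  proof -
    have [measurable]: "(\<lambda>z. \<alpha> (fst z) (snd z)) \<in> borel_measurable (time T \<Otimes>\<^sub>M M)"
      by (rule progressive_jointly_measurable[OF that assms])
    have "(\<integral>\<^sup>+\<omega>. (\<integral>\<^sup>+t\<in>{0..T}. ennreal ((\<alpha> t \<omega>)\<^sup>2) \<partial>lborel) \<partial>M)
       = (\<integral>\<^sup>+\<omega>. (\<integral>\<^sup>+t. ennreal ((\<alpha> t \<omega>)\<^sup>2) \<partial>time T) \<partial>M)"
      by (simp add: nn_integral_restrict_space)
    also have "\<dots> = (\<integral>\<^sup>+z. ennreal ((\<alpha> (fst z) (snd z))\<^sup>2) \<partial>(time T \<Otimes>\<^sub>M M))"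
      using P.nn_integral_snd[of "\<lambda>z. ennreal ((\<alpha> (fst z) (snd z))\<^sup>2)"] by simp
    finally show ?thesis by (simp add: integrable_iff_bounded)
  qed
  then show ?thesis
    using progressive_jointly_measurable[OF _ assms, of \<alpha>]
    by (auto simp: admissible_controls_def square_integrable_def)
qed

text \<open>One random variable \<open>Z\<close> bounds the state at all times, up to the noise at the same time. This
  gives square-integrability at every fixed time, in particular at \<open>T\<close>, and not only for almost
  every time.\<close>

lemma state_bound:
  assumes T: "T \<ge> 0" and B: "continuous_on {0..T} B"
    and v: "\<And>i. square_integrable (time T \<Otimes>\<^sub>M M) (\<lambda>z. v i (fst z) (snd z))"
    and X: "AE \<omega> in M. continuous_on {0..T} (\<lambda>t. X t \<omega>) \<and>
      (\<forall>t\<in>{0..T}. X t \<omega> = forcing x0 \<sigma> v t \<omega> + integral {0..t} (\<lambda>s. B s *v X s \<omega>))"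
  obtains Z where "square_integrable M Z"
    "AE \<omega> in M. \<forall>t\<in>{0..T}. norm (X t \<omega>) \<le> Z \<omega> + \<bar>\<sigma>\<bar> * (\<Sum>i\<in>UNIV. \<bar>W i t \<omega>\<bar>)"
proof (rule linear_volterra_bound[OF T B])
  fix C :: real
  assume C: "C \<ge> 0" and bound: "\<And>h x t. \<lbrakk>continuous_on {0..T} h; continuous_on {0..T} x;
       \<And>t. t \<in> {0..T} \<Longrightarrow> x t = h t + integral {0..t} (\<lambda>s. B s *v x s); t \<in> {0..T}\<rbrakk>
      \<Longrightarrow> norm (x t) \<le> norm (h t) + C * integral {0..T} (\<lambda>s. norm (h s))"
  define V where "V i \<omega> = (LINT s:{0..T}|lborel. \<bar>v i s \<omega>\<bar>)" for i \<omega>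
  define U where "U i \<omega> = (LINT s:{0..T}|lborel. \<bar>W i s \<omega>\<bar>)" for i \<omega>
  define K where "K \<omega> = (\<Sum>i\<in>UNIV. \<bar>x0 $ i\<bar>) + (\<Sum>i\<in>UNIV. V i \<omega>)" for \<omega>
  define Z where "Z \<omega> = (1 + C * T) * K \<omega> + C * \<bar>\<sigma>\<bar> * (\<Sum>i\<in>UNIV. U i \<omega>)" for \<omega>
  show ?thesis
  proof
    have "square_integrable M (V i)" "square_integrable M (U i)" for i
      unfolding V_def[abs_def] U_def[abs_def]
      using square_integrable_time_integral(2)[OF v T] square_integrable_time_integral(2)[OF square_integrable_W_process[OF T] T]
      by auto
    then show "square_integrable M Z"
      unfolding Z_def[abs_def] K_def[abs_def]
      by (intro square_integrable_add square_integrable_cmult square_integrable_sum square_integrable_const)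
    have "AE \<omega> in M. \<forall>i. set_integrable lborel {0..T} (\<lambda>s. v i s \<omega>)"
      using square_integrable_time_integral(1)[OF v T] by (simp add: AE_all_countable)
    with X show "AE \<omega> in M. \<forall>t\<in>{0..T}. norm (X t \<omega>) \<le> Z \<omega> + \<bar>\<sigma>\<bar> * (\<Sum>i\<in>UNIV. \<bar>W i t \<omega>\<bar>)"
      using AE_space
    proof eventually_elim
      case (elim \<omega>)
      note vi = elim(2)[rule_format]
      let ?w = "\<lambda>t. \<Sum>i\<in>UNIV. \<bar>W i t \<omega>\<bar>"
      let ?h = "\<lambda>t. forcing x0 \<sigma> v t \<omega>"
      have hc: "continuous_on {0..T} ?h" by (rule forcing_continuous[of T v \<omega>, OF vi elim(3)])
      have h: "norm (?h t) \<le> K \<omega> + \<bar>\<sigma>\<bar> * ?w t" if t: "t \<in> {0..T}" for t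
      proof -
        have "\<bar>?h t $ i\<bar> \<le> \<bar>x0 $ i\<bar> + V i \<omega> + \<bar>\<sigma>\<bar> * \<bar>W i t \<omega>\<bar>" for i
        proof -
          have vit: "set_integrable lborel {0..t} (\<lambda>s. v i s \<omega>)"
            using t by (intro set_integrable_subset[OF vi]) auto
          have "\<bar>LINT s:{0..t}|lborel. v i s \<omega>\<bar> \<le> (LINT s:{0..t}|lborel. \<bar>v i s \<omega>\<bar>)"
            using set_integral_norm_bound[OF vit] by simp
          also have "\<dots> \<le> V i \<omega>"
            unfolding V_def set_lebesgue_integral_def
            using set_integrable_abs[OF vit] set_integrable_abs[OF vi[of i]] t
            by (intro integral_mono) (auto simp: set_integrable_def indicator_def)
          finally have "\<bar>LINT s:{0..t}|lborel. v i s \<omega>\<bar> \<le> V i \<omega>" .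
          moreover have "?h t $ i = x0 $ i + (LINT s:{0..t}|lborel. v i s \<omega>) + \<sigma> * W i t \<omega>"
            by (simp add: forcing_def)
          ultimately show ?thesis by (simp add: abs_mult[symmetric])
        qed
        then have "(\<Sum>i\<in>UNIV. \<bar>?h t $ i\<bar>) \<le> (\<Sum>i\<in>UNIV. \<bar>x0 $ i\<bar> + V i \<omega> + \<bar>\<sigma>\<bar> * \<bar>W i t \<omega>\<bar>)"
          by (intro sum_mono) auto
        also have "\<dots> = K \<omega> + \<bar>\<sigma>\<bar> * ?w t" by (simp add: K_def sum.distrib sum_distrib_left)
        finally show ?thesis using norm_le_l1_cart[of "?h t"] by linarith
      qed
      have wc: "continuous_on {0..T} (\<lambda>t. \<bar>W i t \<omega>\<bar>)" for i
        by (intro continuous_intros continuous_W elim)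
      have "integral {0..T} (\<lambda>s. norm (?h s)) \<le> integral {0..T} (\<lambda>s. K \<omega> + \<bar>\<sigma>\<bar> * ?w s)"
        using h by (intro integral_le integrable_continuous_interval continuous_intros hc wc) auto
      also have "\<dots> = T * K \<omega> + \<bar>\<sigma>\<bar> * (\<Sum>i\<in>UNIV. integral {0..T} (\<lambda>s. \<bar>W i s \<omega>\<bar>))"
      proof -
        have "((\<lambda>s. K \<omega> + \<bar>\<sigma>\<bar> * ?w s) has_integral T * K \<omega> + \<bar>\<sigma>\<bar> * (\<Sum>i\<in>UNIV. integral {0..T} (\<lambda>s. \<bar>W i s \<omega>\<bar>))) {0..T}"
          using has_integral_const_real[of "K \<omega>" 0 T] T
          by (intro has_integral_add has_integral_mult_right has_integral_sum integrable_integral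
              integrable_continuous_interval wc) auto
        then show ?thesis by (rule integral_unique)
      qed
      also have "(\<Sum>i\<in>UNIV. integral {0..T} (\<lambda>s. \<bar>W i s \<omega>\<bar>)) = (\<Sum>i\<in>UNIV. U i \<omega>)"
        unfolding U_def
        by (intro sum.cong refl set_borel_integral_eq_integral(2)[symmetric] borel_integrable_atLeastAtMost' wc)
      finally have hi: "integral {0..T} (\<lambda>s. norm (?h s)) \<le> T * K \<omega> + \<bar>\<sigma>\<bar> * (\<Sum>i\<in>UNIV. U i \<omega>)" .
      show ?case
      proof
        fix t assume t: "t \<in> {0..T}"
        have "norm (X t \<omega>) \<le> norm (?h t) + C * integral {0..T} (\<lambda>s. norm (?h s))"
          by (rule bound[OF hc conjunct1[OF elim(1)] bspec[OF conjunct2[OF elim(1)]] t])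
        also have "\<dots> \<le> (K \<omega> + \<bar>\<sigma>\<bar> * ?w t) + C * (T * K \<omega> + \<bar>\<sigma>\<bar> * (\<Sum>i\<in>UNIV. U i \<omega>))"
          using h[OF t] hi C by (intro add_mono mult_left_mono)
        also have "\<dots> = Z \<omega> + \<bar>\<sigma>\<bar> * ?w t" by (simp add: Z_def algebra_simps)
        finally show "norm (X t \<omega>) \<le> Z \<omega> + \<bar>\<sigma>\<bar> * ?w t" .
      qed
    qed
  qed
qed

lemma state_square_integrable:
  fixes X :: "real \<Rightarrow> 'w \<Rightarrow> real^'n"
  assumes T: "T \<ge> 0" and B: "continuous_on {0..T} B"
    and v: "\<And>i. square_integrable (time T \<Otimes>\<^sub>M M) (\<lambda>z. v i (fst z) (snd z))"
    and X_prog: "progressive T X"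
    and X: "AE \<omega> in M. continuous_on {0..T} (\<lambda>t. X t \<omega>) \<and>
      (\<forall>t\<in>{0..T}. X t \<omega> = forcing x0 \<sigma> v t \<omega> + integral {0..t} (\<lambda>s. B s *v X s \<omega>))"
  shows "square_integrable (time T \<Otimes>\<^sub>M M) (\<lambda>z. X (fst z) (snd z) $ i)"
    and "\<And>t. t \<in> {0..T} \<Longrightarrow> square_integrable M (\<lambda>\<omega>. X t \<omega> $ i)"
proof -
  interpret P: pair_sigma_finite "time T" M by (rule time_pair)
  obtain Z where Z: "square_integrable M Z" and
    bound: "AE \<omega> in M. \<forall>t\<in>{0..T}. norm (X t \<omega>) \<le> Z \<omega> + \<bar>\<sigma>\<bar> * (\<Sum>i\<in>UNIV. \<bar>W i t \<omega>\<bar>)"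
    by (rule state_bound[OF T B v X])
  have comp: "\<bar>x $ i\<bar> \<le> \<bar>b\<bar>" if "norm x \<le> b" for x :: "real^'n" and b
    using component_le_norm_cart[of x i] that by linarith
  have Wabs: "square_integrable M (\<lambda>\<omega>. Z \<omega> + \<bar>\<sigma>\<bar> * (\<Sum>i\<in>UNIV. \<bar>W i t \<omega>\<bar>))" if "t \<in> {0..T}" for t
    using that by (intro square_integrable_add square_integrable_cmult square_integrable_sum square_integrable_abs
        square_integrable_W Z) auto
  have prod: "square_integrable (time T \<Otimes>\<^sub>M M) (\<lambda>z. Z (snd z) + \<bar>\<sigma>\<bar> * (\<Sum>i\<in>UNIV. \<bar>W i (fst z) (snd z)\<bar>))"
    by (intro square_integrable_add square_integrable_cmult square_integrable_sum square_integrable_abs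
        square_integrable_W_process square_integrable_random_variable Z T)
  note Xi = progressive_component[OF X_prog, of i]
  show "square_integrable M (\<lambda>\<omega>. X t \<omega> $ i)" if t: "t \<in> {0..T}" for t
  proof (rule square_integrable_bound[OF Wabs[OF t]])
    show "(\<lambda>\<omega>. X t \<omega> $ i) \<in> borel_measurable M"
      by (rule measurable_filtration_M[OF progressive_adapted[OF Xi t]])
    show "AE \<omega> in M. \<bar>X t \<omega> $ i\<bar> \<le> \<bar>Z \<omega> + \<bar>\<sigma>\<bar> * (\<Sum>i\<in>UNIV. \<bar>W i t \<omega>\<bar>)\<bar>"
      using bound by eventually_elim (use t comp in blast)
  qed
  show "square_integrable (time T \<Otimes>\<^sub>M M) (\<lambda>z. X (fst z) (snd z) $ i)"
  proof (rule square_integrable_bound[OF prod])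
    show Xm: "(\<lambda>z. X (fst z) (snd z) $ i) \<in> borel_measurable (time T \<Otimes>\<^sub>M M)"
      by (rule progressive_jointly_measurable[OF Xi T])
    show "AE z in time T \<Otimes>\<^sub>M M. \<bar>X (fst z) (snd z) $ i\<bar> \<le> \<bar>Z (snd z) + \<bar>\<sigma>\<bar> * (\<Sum>i\<in>UNIV. \<bar>W i (fst z) (snd z)\<bar>)\<bar>"
    proof (rule P.AE_pair_measure)
      have "(\<lambda>z. Z (snd z) + \<bar>\<sigma>\<bar> * (\<Sum>i\<in>UNIV. \<bar>W i (fst z) (snd z)\<bar>)) \<in> borel_measurable (time T \<Otimes>\<^sub>M M)"
        using prod by (simp add: square_integrable_def)
      then show "{z \<in> space (time T \<Otimes>\<^sub>M M). \<bar>X (fst z) (snd z) $ i\<bar> \<le> \<bar>Z (snd z) + \<bar>\<sigma>\<bar> * (\<Sum>i\<in>UNIV. \<bar>W i (fst z) (snd z)\<bar>)\<bar>}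
          \<in> sets (time T \<Otimes>\<^sub>M M)"
        using Xm by (intro borel_measurable_le borel_measurable_abs)
      show "AE t in time T. AE \<omega> in M. \<bar>X (fst (t, \<omega>)) (snd (t, \<omega>)) $ i\<bar> \<le> \<bar>Z (snd (t, \<omega>)) + \<bar>\<sigma>\<bar> * (\<Sum>i\<in>UNIV. \<bar>W i (fst (t, \<omega>)) (snd (t, \<omega>))\<bar>)\<bar>"
      proof (rule AE_I2)
        fix t assume "t \<in> space (time T)"
        then have t: "t \<in> {0..T}" by (simp add: space_restrict_space)
        show "AE \<omega> in M. \<bar>X (fst (t, \<omega>)) (snd (t, \<omega>)) $ i\<bar> \<le> \<bar>Z (snd (t, \<omega>)) + \<bar>\<sigma>\<bar> * (\<Sum>i\<in>UNIV. \<bar>W i (fst (t, \<omega>)) (snd (t, \<omega>))\<bar>)\<bar>"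
          using bound by eventually_elim (use t comp in auto)
      qed
    qed
  qed
qed

end

section \<open>A product rule in expectation\<close>

context brownian_family
begin

text \<open>A product rule without stochastic integrals. Write \<open>X = U + \<sigma> W\<close> with \<open>U\<close> continuously
  differentiable. Pathwise by parts, \<open>D\<^sub>t U\<^sub>t = \<integral> (d U + D b)\<close>, while \<open>D\<^sub>t W\<^sub>t = \<integral> d\<^sub>s W\<^sub>t\<close>. In expectation
  \<open>W\<^sub>t\<close> may be replaced by \<open>W\<^sub>s\<close>, since \<open>d\<^sub>s\<close> is uncorrelated with the increment, which restores
  \<open>X\<^sub>s\<close>.\<close>

lemma expectation_product_rule:
  fixes X D b d :: "real \<Rightarrow> 'w \<Rightarrow> real"
  assumes t: "t \<in> {0..T}"
    and d_prog: "progressive T d"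
    and sqX: "square_integrable (time T \<Otimes>\<^sub>M M) (\<lambda>z. X (fst z) (snd z))"
    and sqb: "square_integrable (time T \<Otimes>\<^sub>M M) (\<lambda>z. b (fst z) (snd z))"
    and sqD: "square_integrable (time T \<Otimes>\<^sub>M M) (\<lambda>z. D (fst z) (snd z))"
    and sqd: "square_integrable (time T \<Otimes>\<^sub>M M) (\<lambda>z. d (fst z) (snd z))"
    and X: "AE \<omega> in M. continuous_on {0..T} (\<lambda>s. b s \<omega>) \<and>
      (\<forall>s\<in>{0..T}. X s \<omega> = x + (LINT r:{0..s}|lborel. b r \<omega>) + \<sigma> * W l s \<omega>)"
    and D: "AE \<omega> in M. set_integrable lborel {0..T} (\<lambda>s. d s \<omega>) \<and>
      (\<forall>s\<in>{0..T}. D s \<omega> = (LINT r:{0..s}|lborel. d r \<omega>))"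
    and Xt: "X t \<in> borel_measurable M" and Dt: "D t \<in> borel_measurable M"
  shows "expectation (\<lambda>\<omega>. D t \<omega> * X t \<omega>)
    = (LINT s:{0..t}|lborel. expectation (\<lambda>\<omega>. d s \<omega> * X s \<omega> + D s \<omega> * b s \<omega>))"
proof -
  interpret P: pair_sigma_finite "time T" M by (rule time_pair)
  have T: "T \<ge> 0" using t by auto
  have sub: "{0..t} \<subseteq> {0..T}" using t by auto
  let ?A = "{0..t} \<times> space M"
  have A: "?A \<in> sets (time T \<Otimes>\<^sub>M M)"
    using sub by (intro pair_measureI) (auto simp: sets_restrict_space_iff)
  define g1 where "g1 s \<omega> = d s \<omega> * X s \<omega> + D s \<omega> * b s \<omega>" for s \<omega>
  define g2 where "g2 s \<omega> = d s \<omega> * (W l t \<omega> - W l s \<omega>)" for s \<omega>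
  have Wt: "square_integrable (time T \<Otimes>\<^sub>M M) (\<lambda>z. W l t (snd z))"
    using t by (intro square_integrable_random_variable square_integrable_W T) auto
  have i1: "integrable (time T \<Otimes>\<^sub>M M) (\<lambda>z. g1 (fst z) (snd z))"
    unfolding g1_def by (intro Bochner_Integration.integrable_add square_integrable_mult sqX sqb sqD sqd)
  have i2: "integrable (time T \<Otimes>\<^sub>M M) (\<lambda>z. g2 (fst z) (snd z))"
    unfolding g2_def by (intro square_integrable_mult square_integrable_diff Wt sqd square_integrable_W_process T)
  define g where "g s \<omega> = indicator {0..t} s * (g1 s \<omega> + \<sigma> * g2 s \<omega>)" for s \<omega>
  have ig: "integrable (time T \<Otimes>\<^sub>M M) (\<lambda>(s, \<omega>). g s \<omega>)"
  proof -
    have "integrable (time T \<Otimes>\<^sub>M M) (\<lambda>z. indicator ?A z *\<^sub>R (g1 (fst z) (snd z) + \<sigma> * g2 (fst z) (snd z)))"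
      by (intro integrable_mult_indicator A Bochner_Integration.integrable_add i1 integrable_mult_right i2)
    also have "?this \<longleftrightarrow> ?thesis"
      by (rule Bochner_Integration.integrable_cong) (auto simp: g_def space_pair_measure indicator_def)
    finally show ?thesis .
  qed
  have path: "AE \<omega> in M. D t \<omega> * X t \<omega> = (\<integral>s. g s \<omega> \<partial>time T)"
    using X D AE_space
  proof eventually_elim
    case (elim \<omega>)
    have b: "continuous_on {0..t} (\<lambda>s. b s \<omega>)" and bT: "continuous_on {0..T} (\<lambda>s. b s \<omega>)"
      using elim(1) sub continuous_on_subset by blast+
    have d: "set_integrable lborel {0..t} (\<lambda>s. d s \<omega>)"
      by (rule set_integrable_subset[OF conjunct1[OF elim(2)]]) (use sub in auto)
    \<comment> \<open>Removing the noise leaves a continuously differentiable path.\<close>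
    define U where "U s = X s \<omega> - \<sigma> * W l s \<omega>" for s
    have U: "U s = x + integral {0..s} (\<lambda>r. b r \<omega>)" if "s \<in> {0..t}" for s
    proof -
      have "set_integrable lborel {0..s} (\<lambda>r. b r \<omega>)"
        using that by (intro borel_integrable_atLeastAtMost' continuous_on_subset[OF b]) auto
      then show ?thesis
        using elim(1) that sub set_borel_integral_eq_integral(2) by (auto simp: U_def subset_iff)
    qed
    have dU: "(U has_real_derivative b s \<omega>) (at s within {0..t})" if s: "s \<in> {0..t}" for s
    proof -
      have "((\<lambda>s. integral {0..s} (\<lambda>r. b r \<omega>)) has_vector_derivative b s \<omega>) (at s within {0..t})"
        by (intro integral_has_vector_derivative b s)
      then have "((\<lambda>s. x + integral {0..s} (\<lambda>r. b r \<omega>)) has_vector_derivative 0 + b s \<omega>) (at s within {0..t})"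
        by (intro has_vector_derivative_add has_vector_derivative_const)
      then have "((\<lambda>s. x + integral {0..s} (\<lambda>r. b r \<omega>)) has_real_derivative b s \<omega>) (at s within {0..t})"
        by (simp add: has_real_derivative_iff_has_vector_derivative)
      then show ?thesis
        by (rule has_field_derivative_transform_within[OF _ zero_less_one s]) (simp add: U)
    qed
    have t0: "t \<ge> 0" using t by auto
    note parts = absolutely_continuous_by_parts[OF dU b d t0]
    have Ds: "D s \<omega> = (LINT r:{0..s}|lborel. d r \<omega>)" if "s \<in> {0..t}" for s
      using elim(2) that sub by auto
    have dW: "set_integrable lborel {0..t} (\<lambda>s. W l t \<omega> * d s \<omega>)"
      using d by (simp add: set_integrable_mult_right)
    have bD: "set_integrable lborel {0..t} (\<lambda>s. D s \<omega> * b s \<omega>)"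
      by (rule set_integrable_cong[THEN iffD1, OF refl refl _ parts(2)]) (simp add: Ds)
    have "D t \<omega> * X t \<omega> = U t * D t \<omega> + \<sigma> * (W l t \<omega> * D t \<omega>)"
      by (simp add: U_def algebra_simps)
    also have "U t * D t \<omega> = (LINT s:{0..t}|lborel. U s * d s \<omega>) + (LINT s:{0..t}|lborel. D s \<omega> * b s \<omega>)"
    proof -
      have "(LINT s:{0..t}|lborel. b s \<omega> * (LINT r:{0..s}|lborel. d r \<omega>)) = (LINT s:{0..t}|lborel. D s \<omega> * b s \<omega>)"
        by (rule set_lebesgue_integral_cong) (auto simp: Ds)
      then show ?thesis using parts(3) t0 by (simp add: Ds)
    qed
    also have "W l t \<omega> * D t \<omega> = (LINT s:{0..t}|lborel. W l t \<omega> * d s \<omega>)"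
      using t0 by (simp add: Ds)
    also have "(LINT s:{0..t}|lborel. U s * d s \<omega>) + (LINT s:{0..t}|lborel. D s \<omega> * b s \<omega>)
        + \<sigma> * (LINT s:{0..t}|lborel. W l t \<omega> * d s \<omega>)
      = (LINT s:{0..t}|lborel. U s * d s \<omega> + D s \<omega> * b s \<omega> + \<sigma> * (W l t \<omega> * d s \<omega>))"
    proof -
      have m: "set_integrable lborel {0..t} (\<lambda>s. \<sigma> * (W l t \<omega> * d s \<omega>))"
        using dW by (simp add: set_integrable_mult_right)
      show ?thesis
        using set_integral_add(2)[OF set_integral_add(1)[OF parts(1) bD] m] set_integral_add(2)[OF parts(1) bD]
        by simp
    qed
    also have "\<dots> = (\<integral>s. g s \<omega> \<partial>time T)"
    proof -
      have "indicator {0..t} s *\<^sub>R (U s * d s \<omega> + D s \<omega> * b s \<omega> + \<sigma> * (W l t \<omega> * d s \<omega>))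
          = indicator {0..T} s *\<^sub>R g s \<omega>" for s
        using sub by (auto simp: indicator_def g_def g1_def g2_def U_def algebra_simps)
      then show ?thesis by (simp add: integral_time set_lebesgue_integral_def)
    qed
    finally show ?case .
  qed
  have "expectation (\<lambda>\<omega>. D t \<omega> * X t \<omega>) = (\<integral>\<omega>. (\<integral>s. g s \<omega> \<partial>time T) \<partial>M)"
  proof (rule integral_cong_AE[OF _ _ path])
    show "(\<lambda>\<omega>. D t \<omega> * X t \<omega>) \<in> borel_measurable M" using Xt Dt by simp
    show "(\<lambda>\<omega>. \<integral>s. g s \<omega> \<partial>time T) \<in> borel_measurable M"
      by (rule borel_measurable_integrable[OF P.integrable_snd[OF ig]])
  qed
  also have "\<dots> = (\<integral>s. (\<integral>\<omega>. g s \<omega> \<partial>M) \<partial>time T)"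
    by (rule P.Fubini_integral[OF ig])
  also have "\<dots> = (\<integral>s. indicator {0..t} s * expectation (g1 s) \<partial>time T)"
  proof (rule integral_cong_AE)
    show "(\<lambda>s. \<integral>\<omega>. g s \<omega> \<partial>M) \<in> borel_measurable (time T)"
      by (rule borel_measurable_integrable[OF P.integrable_fst[OF ig]])
    have "(\<lambda>s. expectation (g1 s)) \<in> borel_measurable (time T)"
      using P.integrable_fst'[OF i1] by (auto dest: borel_measurable_integrable)
    moreover have "(\<lambda>s. indicator {0..t} s :: real) \<in> borel_measurable (time T)"
      by (intro measurable_restrict_space1) simp
    ultimately show "(\<lambda>s. indicator {0..t} s * expectation (g1 s)) \<in> borel_measurable (time T)"
      by (rule borel_measurable_times[rotated])
    have "integrable (time T \<Otimes>\<^sub>M M) (\<lambda>(s, \<omega>). (d s \<omega>)\<^sup>2)"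
      using sqd by (simp add: square_integrable_def case_prod_unfold)
    then have sq_ae: "AE s in time T. integrable M (\<lambda>\<omega>. (d s \<omega>)\<^sup>2)" by (rule P.AE_integrable_fst)
    have i1': "AE s in time T. integrable M (g1 s)" and i2': "AE s in time T. integrable M (g2 s)"
      using P.AE_integrable_fst'[OF i1] P.AE_integrable_fst'[OF i2] by auto
    show "AE s in time T. (\<integral>\<omega>. g s \<omega> \<partial>M) = indicator {0..t} s * expectation (g1 s)"
      using sq_ae i1' i2' AE_space
    proof eventually_elim
      case (elim s)
      show ?case
      proof (cases "s \<in> {0..t}")
        case True
        then have s: "s \<in> {0..T}" using sub by auto
        note ds = progressive_adapted[OF d_prog s]
        have "square_integrable M (d s)"
          using elim(1) measurable_filtration_M[OF ds] by (simp add: square_integrable_def)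
        then have "expectation (g2 s) = 0"
          unfolding g2_def using True
          by (intro expectation_times_increment(2) ds square_integrable_integrable) auto
        then show ?thesis
          using True elim(2,3) by (simp add: g_def)
      qed (simp add: g_def)
    qed
  qed
  also have "\<dots> = (LINT s:{0..t}|lborel. expectation (g1 s))"
  proof -
    have "indicator {0..T} s *\<^sub>R (indicator {0..t} s * expectation (g1 s)) = indicator {0..t} s *\<^sub>R expectation (g1 s)" for s
      using sub by (auto simp: indicator_def)
    then show ?thesis by (simp only: integral_time set_lebesgue_integral_def)
  qed
  finally show ?thesis unfolding g1_def .
qed

text \<open>Apply the product rule to every pair of components and integrate against the entries of \<open>F\<close>.\<close>

lemma expectation_bilinear_form:
  fixes X D b d :: "real \<Rightarrow> 'w \<Rightarrow> real^'n" and F F' :: "real \<Rightarrow> real^'n^'n"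
  assumes T: "T \<ge> 0"
    and d_prog: "progressive T d" and X_prog: "progressive T X" and D_prog: "progressive T D"
    and sqX: "\<And>i. square_integrable (time T \<Otimes>\<^sub>M M) (\<lambda>z. X (fst z) (snd z) $ i)"
    and sqb: "\<And>i. square_integrable (time T \<Otimes>\<^sub>M M) (\<lambda>z. b (fst z) (snd z) $ i)"
    and sqD: "\<And>i. square_integrable (time T \<Otimes>\<^sub>M M) (\<lambda>z. D (fst z) (snd z) $ i)"
    and sqd: "\<And>i. square_integrable (time T \<Otimes>\<^sub>M M) (\<lambda>z. d (fst z) (snd z) $ i)"
    and sqXT: "\<And>i. square_integrable M (\<lambda>\<omega>. X T \<omega> $ i)"
    and sqDT: "\<And>i. square_integrable M (\<lambda>\<omega>. D T \<omega> $ i)"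
    and X: "AE \<omega> in M. continuous_on {0..T} (\<lambda>s. b s \<omega>) \<and>
      (\<forall>i. \<forall>s\<in>{0..T}. X s \<omega> $ i = x $ i + (LINT r:{0..s}|lborel. b r \<omega> $ i) + \<sigma> * W i s \<omega>)"
    and D: "AE \<omega> in M. \<forall>i. set_integrable lborel {0..T} (\<lambda>s. d s \<omega> $ i) \<and>
      (\<forall>s\<in>{0..T}. D s \<omega> $ i = (LINT r:{0..s}|lborel. d r \<omega> $ i))"
    and F: "\<And>s. s \<in> {0..T} \<Longrightarrow> (F has_vector_derivative F' s) (at s within {0..T})"
    and F': "continuous_on {0..T} F'"
  shows "expectation (\<lambda>\<omega>. D T \<omega> \<bullet> (F T *v X T \<omega>))
    = (\<integral>(s, \<omega>). d s \<omega> \<bullet> (F s *v X s \<omega>) + D s \<omega> \<bullet> (F s *v b s \<omega>) + D s \<omega> \<bullet> (F' s *v X s \<omega>)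
        \<partial>(time T \<Otimes>\<^sub>M M))"
proof -
  interpret P: pair_sigma_finite "time T" M by (rule time_pair)
  have bil: "y \<bullet> (A *v z) = (\<Sum>k\<in>UNIV. \<Sum>l\<in>UNIV. A $ k $ l * (y $ k * z $ l))" for A :: "real^'n^'n" and y z
    by (simp add: inner_vec_def matrix_vector_mult_def sum_distrib_left algebra_simps)
  define w where "w k l s \<omega> = d s \<omega> $ k * X s \<omega> $ l + D s \<omega> $ k * b s \<omega> $ l" for k l s \<omega>
  have iw: "integrable (time T \<Otimes>\<^sub>M M) (\<lambda>z. w k l (fst z) (snd z))" for k l
    unfolding w_def by (intro Bochner_Integration.integrable_add square_integrable_mult sqX sqb sqD sqd)
  have iDX: "integrable (time T \<Otimes>\<^sub>M M) (\<lambda>z. D (fst z) (snd z) $ k * X (fst z) (snd z) $ l)" for k l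
    by (intro square_integrable_mult sqX sqD)
  have Fc: "continuous_on {0..T} F" using F by (rule continuous_on_vector_derivative)
  have cF: "continuous_on {0..T} (\<lambda>s. F s $ k $ l)" "continuous_on {0..T} (\<lambda>s. F' s $ k $ l)" for k l
    by (intro continuous_on_component Fc F')+
  have dF: "((\<lambda>s. F s $ k $ l) has_real_derivative F' s $ k $ l) (at s within {0..T})" if "s \<in> {0..T}" for k l s
    using bounded_linear.has_vector_derivative[OF bounded_linear_vec_nth[of l]
        bounded_linear.has_vector_derivative[OF bounded_linear_vec_nth[of k] F[OF that]]]
    by (simp add: has_real_derivative_iff_has_vector_derivative)
  have rule: "expectation (\<lambda>\<omega>. D t \<omega> $ k * X t \<omega> $ l) = (LINT s:{0..t}|lborel. expectation (w k l s))"
    if t: "t \<in> {0..T}" for t k l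
    unfolding w_def
  proof (rule expectation_product_rule[OF t progressive_component[OF d_prog] sqX sqb sqD sqd])
    show "AE \<omega> in M. continuous_on {0..T} (\<lambda>s. b s \<omega> $ l) \<and>
      (\<forall>s\<in>{0..T}. X s \<omega> $ l = x $ l + (LINT r:{0..s}|lborel. b r \<omega> $ l) + \<sigma> * W l s \<omega>)"
      using X by eventually_elim (auto intro: continuous_on_component)
    show "AE \<omega> in M. set_integrable lborel {0..T} (\<lambda>s. d s \<omega> $ k) \<and>
      (\<forall>s\<in>{0..T}. D s \<omega> $ k = (LINT r:{0..s}|lborel. d r \<omega> $ k))"
      using D by eventually_elim auto
  qed (auto intro!: measurable_filtration_M progressive_adapted[OF progressive_component[OF X_prog] t]
      progressive_adapted[OF progressive_component[OF D_prog] t])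
  have kl: "F T $ k $ l * expectation (\<lambda>\<omega>. D T \<omega> $ k * X T \<omega> $ l)
     = (\<integral>z. F (fst z) $ k $ l * w k l (fst z) (snd z) \<partial>(time T \<Otimes>\<^sub>M M))
       + (\<integral>z. F' (fst z) $ k $ l * (D (fst z) (snd z) $ k * X (fst z) (snd z) $ l) \<partial>(time T \<Otimes>\<^sub>M M))" for k l
  proof -
    have "set_integrable lborel {0..T} (\<lambda>s. expectation (w k l s))"
      using P.integrable_fst'[OF iw[of k l]] by (simp add: integrable_time)
    note parts = absolutely_continuous_by_parts[OF dF cF(2) this T]
    have "F T $ k $ l * expectation (\<lambda>\<omega>. D T \<omega> $ k * X T \<omega> $ l)
      = (LINT s:{0..T}|lborel. F s $ k $ l * expectation (w k l s))
        + (LINT s:{0..T}|lborel. F' s $ k $ l * (LINT r:{0..s}|lborel. expectation (w k l r)))"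
      using rule[of T k l] parts(3)[of k l] T by simp
    also have "(LINT s:{0..T}|lborel. F' s $ k $ l * (LINT r:{0..s}|lborel. expectation (w k l r)))
      = (LINT s:{0..T}|lborel. F' s $ k $ l * expectation (\<lambda>\<omega>. D s \<omega> $ k * X s \<omega> $ l))"
      by (rule set_lebesgue_integral_cong) (auto simp: rule)
    also have "\<dots> = (\<integral>z. F' (fst z) $ k $ l * (D (fst z) (snd z) $ k * X (fst z) (snd z) $ l) \<partial>(time T \<Otimes>\<^sub>M M))"
      using P.integral_fst'[OF integrable_time_weight[OF cF(2) iDX], of k l k l] by (simp add: integral_time)
    also have "(LINT s:{0..T}|lborel. F s $ k $ l * expectation (w k l s))
      = (\<integral>z. F (fst z) $ k $ l * w k l (fst z) (snd z) \<partial>(time T \<Otimes>\<^sub>M M))"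
      using P.integral_fst'[OF integrable_time_weight[OF cF(1) iw], of k l k l] by (simp add: integral_time)
    finally show ?thesis .
  qed
  have iT: "integrable M (\<lambda>\<omega>. D T \<omega> $ k * X T \<omega> $ l)" for k l
    by (intro square_integrable_mult sqDT sqXT)
  have "expectation (\<lambda>\<omega>. D T \<omega> \<bullet> (F T *v X T \<omega>))
     = (\<Sum>k\<in>UNIV. \<Sum>l\<in>UNIV. F T $ k $ l * expectation (\<lambda>\<omega>. D T \<omega> $ k * X T \<omega> $ l))"
    unfolding bil using iT by (simp add: Bochner_Integration.integral_sum)
  also have "\<dots> = (\<Sum>k\<in>UNIV. \<Sum>l\<in>UNIV. \<integral>z. F (fst z) $ k $ l * w k l (fst z) (snd z)
       + F' (fst z) $ k $ l * (D (fst z) (snd z) $ k * X (fst z) (snd z) $ l) \<partial>(time T \<Otimes>\<^sub>M M))"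
    unfolding kl by (intro sum.cong refl Bochner_Integration.integral_add[symmetric] integrable_time_weight cF iw iDX)
  also have "\<dots> = (\<integral>z. (\<Sum>k\<in>UNIV. \<Sum>l\<in>UNIV. F (fst z) $ k $ l * w k l (fst z) (snd z)
       + F' (fst z) $ k $ l * (D (fst z) (snd z) $ k * X (fst z) (snd z) $ l)) \<partial>(time T \<Otimes>\<^sub>M M))"
    using Bochner_Integration.integrable_add[OF integrable_time_weight[OF cF(1) iw] integrable_time_weight[OF cF(2) iDX]]
    by (simp add: Bochner_Integration.integral_sum Bochner_Integration.integrable_sum)
  also have "\<dots> = (\<integral>(s, \<omega>). d s \<omega> \<bullet> (F s *v X s \<omega>) + D s \<omega> \<bullet> (F s *v b s \<omega>) + D s \<omega> \<bullet> (F' s *v X s \<omega>)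
        \<partial>(time T \<Otimes>\<^sub>M M))"
    by (rule Bochner_Integration.integral_cong) (auto simp: bil w_def sum.distrib algebra_simps)
  finally show ?thesis .
qed

end

section \<open>Riccati solutions are Nash equilibria\<close>

context
  fixes L :: "real^'n^'n" and a q \<epsilon> c T :: real and F :: "'n \<Rightarrow> real \<Rightarrow> real^'n^'n"
  assumes L: "transpose L = L" and q: "q\<^sup>2 = \<epsilon>" and F: "solves_riccati L a q \<epsilon> c T F"
begin

text \<open>The drift matrix of the state when all players use the feedback: \<open>- (a + q) L\<close>
  with the \<open>j\<close>-th row of \<open>F\<^sup>j\<close> subtracted from the \<open>j\<close>-th row.\<close>

definition closed_loop :: "real \<Rightarrow> real^'n^'n" where
  "closed_loop t = - ((a + q) *\<^sub>R L) - (\<chi> j. F j t $ j)"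

definition riccati_rhs :: "'n \<Rightarrow> real \<Rightarrow> real^'n^'n" where
  "riccati_rhs i t = - (transpose (closed_loop t) ** F i t) - F i t ** closed_loop t - F i t ** unit_outer i ** F i t"

lemma F_symmetric: "t \<in> {0..T} \<Longrightarrow> transpose (F i t) = F i t"
  using F by (auto simp: solves_riccati_def)

lemma F_terminal: "F i T = c *\<^sub>R (L ** unit_outer i ** L)"
  using F by (auto simp: solves_riccati_def)

lemma F_derivative:
  assumes t: "t \<in> {0..T}"
  shows "(F i has_vector_derivative riccati_rhs i t) (at t within {0..T})"
proof -
  obtain D where D: "(F i has_vector_derivative D) (at t within {0..T})"
    and eq: "D + (\<Sum>j\<in>UNIV. (- ((a + q) *\<^sub>R L) - F j t) ** unit_outer j ** F i t)
        + (\<Sum>j\<in>UNIV. F i t ** unit_outer j ** (- ((a + q) *\<^sub>R L) - F j t))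
        + (\<epsilon> - q\<^sup>2) *\<^sub>R (L ** unit_outer i ** L) + F i t ** unit_outer i ** F i t = 0"
    using F[unfolded solves_riccati_def, THEN conjunct2, THEN conjunct2, THEN spec[of _ i], THEN bspec[OF _ t]]
    by (elim exE conjE)
  have "(\<Sum>j\<in>UNIV. (- ((a + q) *\<^sub>R L) - F j t) ** unit_outer j ** F i t) = transpose (closed_loop t) ** F i t"
  proof -
    have "(\<Sum>j\<in>UNIV. (- ((a + q) *\<^sub>R L) - F j t) ** unit_outer j) = transpose (closed_loop t)"
      unfolding sum_mult_unit_outer closed_loop_def
      using L F_symmetric[OF t] by (simp add: vec_eq_iff transpose_def)
    then show ?thesis by (simp add: matrix_mult.sum_left[symmetric])
  qed
  moreover have "(\<Sum>j\<in>UNIV. F i t ** unit_outer j ** (- ((a + q) *\<^sub>R L) - F j t)) = F i t ** closed_loop t"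
  proof -
    have "(\<Sum>j\<in>UNIV. unit_outer j ** (- ((a + q) *\<^sub>R L) - F j t)) = closed_loop t"
      unfolding sum_mult_unit_outer closed_loop_def by (simp add: vec_eq_iff)
    then show ?thesis by (simp add: matrix_mult.sum_right[symmetric] matrix_mul_assoc[symmetric])
  qed
  ultimately have "D = riccati_rhs i t"
    using eq q by (simp add: riccati_rhs_def algebra_simps eq_neg_iff_add_eq_0)
  with D show ?thesis by simp
qed

lemma F_continuous: "continuous_on {0..T} (F i)"
  using F_derivative by (rule continuous_on_vector_derivative)

lemma closed_loop_continuous: "continuous_on {0..T} closed_loop"
  unfolding closed_loop_def[abs_def]
  by (intro continuous_intros continuous_on_vec_lambda F_continuous continuous_on_component)

lemma riccati_rhs_continuous: "continuous_on {0..T} (riccati_rhs i)"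
proof -
  have "continuous_on {0..T} (\<lambda>t. transpose (closed_loop t))"
    unfolding transpose_def
    by (intro continuous_on_vec_lambda continuous_on_component closed_loop_continuous)
  then show ?thesis
    unfolding riccati_rhs_def[abs_def]
    by (intro continuous_on_diff continuous_on_minus matrix_mult.continuous_on F_continuous closed_loop_continuous continuous_on_const)
qed

lemma closed_loop_component:
  "(closed_loop t *v x) $ j = - q * (L *v x) $ j - (F j t *v x) $ j - a * (L *v x) $ j"
proof -
  have "((\<chi> j. F j t $ j) *v x) $ j = (F j t *v x) $ j" by (simp add: matrix_vector_mult_def)
  then show ?thesis
    by (simp add: closed_loop_def matrix_vector.diff_left matrix_vector.minus_left matrix_vector.scaleR_left algebra_simps)
qed

text \<open>The Riccati equation in the form in which it is used: a deviation \<open>u\<close> of player \<open>i\<close> changes the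
  drift of \<open>y\<close> by \<open>u e\<^sub>i\<close>, and the integrand of the product rule collapses to the cross term of the running
  cost, up to sign.\<close>

lemma riccati_quadratic:
  assumes t: "t \<in> {0..T}"
  shows "(closed_loop t *v y + u *\<^sub>R axis i 1) \<bullet> (F i t *v x) + y \<bullet> (F i t *v (closed_loop t *v x))
      + y \<bullet> (riccati_rhs i t *v x) = (u - (F i t *v y) $ i) * (F i t *v x) $ i"
proof -
  have "y \<bullet> (riccati_rhs i t *v x) = - (y \<bullet> ((transpose (closed_loop t) ** F i t) *v x))
    - y \<bullet> (F i t *v (closed_loop t *v x)) - y \<bullet> ((F i t ** unit_outer i ** F i t) *v x)"
    by (simp add: riccati_rhs_def matrix_vector.diff_left matrix_vector.minus_left inner_diff_right
        matrix_vector_mul_assoc)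
  also have "y \<bullet> ((transpose (closed_loop t) ** F i t) *v x) = (closed_loop t *v y) \<bullet> (F i t *v x)"
    by (simp only: matrix_vector_mul_assoc[symmetric] inner_matrix_vector_transpose[of y] transpose_transpose)
  also have "y \<bullet> ((F i t ** unit_outer i ** F i t) *v x) = (F i t *v y) $ i * (F i t *v x) $ i"
    by (simp add: inner_rank_one F_symmetric[OF t])
  finally show ?thesis
    by (simp add: inner_add_left inner_axis' algebra_simps)
qed

end

context brownian_family
begin

lemma square_integrable_matrix_vector:
  fixes X :: "real \<Rightarrow> 'w \<Rightarrow> real^'n"
  assumes A: "continuous_on {0..T} A" and X: "\<And>l. square_integrable (time T \<Otimes>\<^sub>M M) (\<lambda>z. X (fst z) (snd z) $ l)"
  shows "square_integrable (time T \<Otimes>\<^sub>M M) (\<lambda>z. (A (fst z) *v X (fst z) (snd z)) $ k)"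
  unfolding matrix_vector_mult_def
  by (simp, intro square_integrable_sum square_integrable_time_weight[where f = "\<lambda>s. A s $ k $ l" for l]
      continuous_on_component A X)

text \<open>As \<open>\<epsilon> = q\<^sup>2\<close>, the running cost is half the square of \<open>\<beta> + q (L X)\<^sub>i\<close>.\<close>

lemma cost_eq:
  assumes T: "T \<ge> 0" and q: "q\<^sup>2 = \<epsilon>" and c: "c \<ge> 0"
    and \<eta>: "square_integrable (time T \<Otimes>\<^sub>M M) (\<lambda>z. \<beta> i (fst z) (snd z) + q * (L *v X (fst z) (snd z)) $ i)"
    and \<zeta>: "square_integrable M (\<lambda>\<omega>. (L *v X T \<omega>) $ i)"
  shows "cost M L q \<epsilon> c T i \<beta> X = ennreal
    ((\<integral>z. 1/2 * (\<beta> i (fst z) (snd z) + q * (L *v X (fst z) (snd z)) $ i)\<^sup>2 \<partial>(time T \<Otimes>\<^sub>M M))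
      + expectation (\<lambda>\<omega>. c/2 * ((L *v X T \<omega>) $ i)\<^sup>2))"
proof -
  interpret P: pair_sigma_finite "time T" M by (rule time_pair)
  define \<eta>' where "\<eta>' z = \<beta> i (fst z) (snd z) + q * (L *v X (fst z) (snd z)) $ i" for z
  have \<eta>'m [measurable]: "\<eta>' \<in> borel_measurable (time T \<Otimes>\<^sub>M M)" and \<eta>'i: "integrable (time T \<Otimes>\<^sub>M M) (\<lambda>z. 1/2 * (\<eta>' z)\<^sup>2)"
    using \<eta> by (auto simp: square_integrable_def \<eta>'_def[abs_def])
  have run: "1 / 2 * (\<beta> i t \<omega>)\<^sup>2 + q * \<beta> i t \<omega> * (L *v X t \<omega>) $ i + \<epsilon> / 2 * ((L *v X t \<omega>) $ i)\<^sup>2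
    = 1/2 * (\<eta>' (t, \<omega>))\<^sup>2" for t \<omega>
    unfolding \<eta>'_def q[symmetric] by (simp add: power2_eq_square algebra_simps)
  have swap: "(\<lambda>(\<omega>, t). ennreal (1/2 * (\<eta>' (t, \<omega>))\<^sup>2)) \<in> borel_measurable (M \<Otimes>\<^sub>M time T)"
    using measurable_compose[OF measurable_pair_swap' \<eta>'m] by (simp add: case_prod_unfold)
  have "cost M L q \<epsilon> c T i \<beta> X = (\<integral>\<^sup>+\<omega>. (\<integral>\<^sup>+t. ennreal (1/2 * (\<eta>' (t, \<omega>))\<^sup>2) \<partial>time T)
     + ennreal (c / 2 * ((L *v X T \<omega>) $ i)\<^sup>2) \<partial>M)"
    unfolding cost_def run by (simp add: nn_integral_restrict_space)
  also have "\<dots> = (\<integral>\<^sup>+\<omega>. (\<integral>\<^sup>+t. ennreal (1/2 * (\<eta>' (t, \<omega>))\<^sup>2) \<partial>time T) \<partial>M)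
     + (\<integral>\<^sup>+\<omega>. ennreal (c / 2 * ((L *v X T \<omega>) $ i)\<^sup>2) \<partial>M)"
    by (rule nn_integral_add[OF P.M1.borel_measurable_nn_integral[OF swap]], rule measurable_compose[OF _ measurable_ennreal])
      (use \<zeta> in \<open>auto simp: square_integrable_def\<close>)
  also have "(\<integral>\<^sup>+\<omega>. (\<integral>\<^sup>+t. ennreal (1/2 * (\<eta>' (t, \<omega>))\<^sup>2) \<partial>time T) \<partial>M) = (\<integral>\<^sup>+z. ennreal (1/2 * (\<eta>' z)\<^sup>2) \<partial>(time T \<Otimes>\<^sub>M M))"
    by (rule P.nn_integral_snd) simp
  also have "\<dots> = ennreal (\<integral>z. 1/2 * (\<eta>' z)\<^sup>2 \<partial>(time T \<Otimes>\<^sub>M M))"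
    by (rule nn_integral_eq_integral[OF \<eta>'i]) simp
  also have "(\<integral>\<^sup>+\<omega>. ennreal (c / 2 * ((L *v X T \<omega>) $ i)\<^sup>2) \<partial>M) = ennreal (expectation (\<lambda>\<omega>. c/2 * ((L *v X T \<omega>) $ i)\<^sup>2))"
    using \<zeta> c by (intro nn_integral_eq_integral) (auto simp: square_integrable_def)
  finally show ?thesis
    unfolding \<eta>'_def using c by (simp add: ennreal_plus[symmetric] integral_nonneg_AE del: ennreal_plus)
qed

text \<open>The deviation \<open>\<alpha>\<close> is compared with the feedback evaluated along the deviated state: \<open>u\<close> is their
  difference. With \<open>G = (F\<^sup>i X)\<^sub>i\<close> and \<open>\<delta> = u - (F\<^sup>i D)\<^sub>i\<close> the running costs are \<open>G\<^sup>2 / 2\<close> and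
  \<open>(\<delta> - G)\<^sup>2 / 2\<close>, so the running cross term is \<open>- \<integral> \<delta> G\<close>. By \<open>expectation_bilinear_form\<close> and the
  Riccati equation \<open>E[\<integral> \<delta> G] = E[D\<^sub>T \<bullet> F\<^sup>i\<^sub>T X\<^sub>T]\<close>, and by the terminal condition the latter is the terminal
  cross term. The cost difference is the expectation of the two squares that remain.\<close>

theorem riccati_solution_nash:
  fixes L :: "real^'n^'n" and F :: "'n \<Rightarrow> real \<Rightarrow> real^'n^'n"
  assumes T: "T > 0" and c: "c \<ge> 0"
    and L: "transpose L = L" and q: "q\<^sup>2 = \<epsilon>" and F: "solves_riccati L a q \<epsilon> c T F"
  shows "markovian_nash_equilibrium M W L a q \<epsilon> c \<sigma> T x0 (\<lambda>i t x. - q * (L *v x) $ i - (F i t *v x) $ i)"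
proof -
  have T0: "T \<ge> 0" using T by simp
  interpret P: pair_sigma_finite "time T" M by (rule time_pair)
  define \<phi> where "\<phi> i t x = - q * (L *v x) $ i - (F i t *v x) $ i" for i t x
  define B where "B = closed_loop L a q F"
  note fc = F_continuous[OF L q F]
  have Bc: "continuous_on {0..T} B" unfolding B_def by (rule closed_loop_continuous[OF L q F])
  have B: "\<phi> j t x - a * (L *v x) $ j = (B t *v x) $ j" for j t x
    unfolding B_def closed_loop_component[OF L q F] \<phi>_def ..
  have zero_prog: "progressive T (\<lambda>t \<omega>. 0 :: real)" by (rule progressive_const)
  have markov: "markovian_strategy T (\<phi> i)" for i
  proof -
    define A where "A t = - (q *\<^sub>R L) - F i t" for t
    have A: "\<phi> i t x = (A t *v x) $ i" for t x
      by (simp add: \<phi>_def A_def matrix_vector.diff_left matrix_vector.minus_left matrix_vector.scaleR_left)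
    have Ac: "continuous_on {0..T} A" unfolding A_def by (intro continuous_intros fc)
    have "continuous_on ({0..T} \<times> UNIV) (\<lambda>z. A (fst z))"
      by (rule continuous_on_compose2[OF Ac]) (auto intro!: continuous_intros)
    then have "continuous_on ({0..T} \<times> UNIV) (\<lambda>(t, x). \<phi> i t x)"
      unfolding A case_prod_unfold
      by (intro continuous_on_component matrix_vector.continuous_on continuous_on_snd continuous_on_id)
    then have "(\<lambda>(t, x). \<phi> i t x) \<in> borel_measurable (restrict_space borel ({0..T} \<times> UNIV))"
      by (rule borel_measurable_continuous_on_restrict)
    moreover obtain b where b: "b \<ge> 0" "\<And>t. t \<in> {0..T} \<Longrightarrow> norm (A t) \<le> b"
      using continuous_on_interval_bound[OF Ac] by metis
    obtain K where K: "K \<ge> 0" "\<And>(A::real^'n^'n) (X::real^'n). norm (A *v X) \<le> norm A * norm X * K"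
      using matrix_vector.nonneg_bounded by blast
    have "\<bar>\<phi> i t x\<bar> / (1 + norm x) \<le> b * K" if t: "t \<in> {0..T}" for t x
    proof -
      have "\<bar>\<phi> i t x\<bar> \<le> norm (A t *v x)" unfolding A by (rule component_le_norm_cart)
      also have "\<dots> \<le> norm (A t) * norm x * K" by (rule K)
      also have "\<dots> \<le> b * (1 + norm x) * K"
        using b(1) b(2)[OF t] K(1) by (intro mult_right_mono mult_mono) auto
      finally show ?thesis by (simp add: divide_le_eq add_pos_nonneg ac_simps)
    qed
    ultimately show ?thesis unfolding markovian_strategy_def by (auto intro!: bdd_aboveI2[where M = "b * K"])
  qed
  have fb: "feedback \<phi> X j t \<omega> - a * (L *v X t \<omega>) $ j = (B t *v X t \<omega>) $ j + 0" for X j t and \<omega> :: 'w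
    by (simp add: feedback_def B)
  have zero_int: "AE \<omega> in M. \<forall>i::'n. set_integrable lborel {0..T} (\<lambda>s. 0 :: real)"
    by (simp add: set_integrable_def)
  have wp: "well_posed M W L a \<sigma> T x0 (feedback \<phi>)"
    by (rule affine_profile_well_posed[where v = "\<lambda>_ _ _. 0" and B = B]) (rule T0 Bc zero_int zero_prog fb)+
  have "well_posed M W L a \<sigma> T x0 (deviate \<phi> i \<alpha>) \<and>
      (\<forall>X Y. state_process M W L a \<sigma> T x0 (feedback \<phi> X) X \<longrightarrow>
             state_process M W L a \<sigma> T x0 (deviate \<phi> i \<alpha> Y) Y \<longrightarrow>
             cost M L q \<epsilon> c T i (deviate \<phi> i \<alpha> Y) Y \<ge> cost M L q \<epsilon> c T i (feedback \<phi> X) X)"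
    if \<alpha>: "\<alpha> \<in> admissible_controls T M W" for i \<alpha>
  proof -
    have \<alpha>_prog: "progressive T \<alpha>" and \<alpha>_sq: "square_integrable (time T \<Otimes>\<^sub>M M) (\<lambda>z. \<alpha> (fst z) (snd z))"
      using \<alpha> admissible_controls_iff[OF T0] by auto
    define v where "v j t \<omega> = (if j = i then \<alpha> t \<omega> else 0)" for j t \<omega>
    define Bd where "Bd t = (\<chi> j. if j = i then - a *\<^sub>R L $ i else B t $ j)" for t
    have Bdc: "continuous_on {0..T} Bd"
      unfolding Bd_def
    proof (rule continuous_on_vec_lambda)
      show "continuous_on {0..T} (\<lambda>t. if j = i then - a *\<^sub>R L $ i else B t $ j)" for j
        by (cases "j = i") (auto intro: continuous_on_component Bc)
    qed
    have Bd: "(Bd t *v x) $ j = (if j = i then - a * (L *v x) $ i else (B t *v x) $ j)" for t j x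
      by (simp add: Bd_def matrix_vector_mult_def sum_distrib_left mult.assoc)
    have v_prog: "progressive T (v j)" for j
      unfolding v_def[abs_def] by (cases "j = i") (auto intro: \<alpha>_prog zero_prog)
    have v_sq: "square_integrable (time T \<Otimes>\<^sub>M M) (\<lambda>z. v j (fst z) (snd z))" for j
      unfolding v_def using \<alpha>_sq by (cases "j = i") (simp_all add: square_integrable_def)
    have v_int: "AE \<omega> in M. \<forall>j. set_integrable lborel {0..T} (\<lambda>s. v j s \<omega>)"
      using square_integrable_time_integral(1)[OF v_sq T0] by (simp add: AE_all_countable)
    have dv: "deviate \<phi> i \<alpha> Y j t \<omega> - a * (L *v Y t \<omega>) $ j = (Bd t *v Y t \<omega>) $ j + v j t \<omega>" for Y j t \<omega>
      by (simp add: deviate_def feedback_def Bd v_def B)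
    have wpd: "well_posed M W L a \<sigma> T x0 (deviate \<phi> i \<alpha>)"
      by (rule affine_profile_well_posed[where v = v and B = Bd]) (rule T0 Bdc v_int v_prog dv)+
    have "cost M L q \<epsilon> c T i (deviate \<phi> i \<alpha> Y) Y \<ge> cost M L q \<epsilon> c T i (feedback \<phi> X) X"
      if X: "state_process M W L a \<sigma> T x0 (feedback \<phi> X) X"
        and Y: "state_process M W L a \<sigma> T x0 (deviate \<phi> i \<alpha> Y) Y" for X Y
    proof -
      from X have X_prog: "progressive T X" and X_eq: "AE \<omega> in M. continuous_on {0..T} (\<lambda>t. X t \<omega>) \<and>
        (\<forall>t\<in>{0..T}. X t \<omega> = forcing x0 \<sigma> (\<lambda>_ _ _. 0) t \<omega> + integral {0..t} (\<lambda>s. B s *v X s \<omega>))"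
        by (auto simp: state_process_iff[where \<beta> = "feedback \<phi> X" and X = X and v = "\<lambda>_ _ _. 0", OF Bc zero_int fb])
      from Y have Y_prog: "progressive T Y" and Y_eq: "AE \<omega> in M. continuous_on {0..T} (\<lambda>t. Y t \<omega>) \<and>
        (\<forall>t\<in>{0..T}. Y t \<omega> = forcing x0 \<sigma> v t \<omega> + integral {0..t} (\<lambda>s. Bd s *v Y s \<omega>))"
        by (auto simp: state_process_iff[where \<beta> = "deviate \<phi> i \<alpha> Y" and X = Y and v = v, OF Bdc v_int dv])
      have zero_sq: "square_integrable (time T \<Otimes>\<^sub>M M) (\<lambda>z. 0)" by (simp add: square_integrable_def)
      note sqX = state_square_integrable[OF T0 Bc zero_sq X_prog X_eq]
      note sqY = state_square_integrable[OF T0 Bdc v_sq Y_prog Y_eq]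
      have TT: "T \<in> {0..T}" using T0 by simp
      define D where "D t \<omega> = Y t \<omega> - X t \<omega>" for t \<omega>
      define u where "u t \<omega> = \<alpha> t \<omega> - \<phi> i t (Y t \<omega>)" for t \<omega>
      define d where "d t \<omega> = B t *v D t \<omega> + u t \<omega> *\<^sub>R axis i 1" for t \<omega>
      have D_prog: "progressive T D"
        using progressive_add[OF Y_prog progressive_scaleR[OF X_prog, of "-1"]] by (simp add: D_def[abs_def])
      have u_eq: "u t \<omega> = \<alpha> t \<omega> + q * (L *v Y t \<omega>) $ i + (F i t *v Y t \<omega>) $ i" for t \<omega>
        by (simp add: u_def \<phi>_def)
      have u_prog: "progressive T u"
        unfolding u_eq[abs_def]
        by (intro progressive_add \<alpha>_prog progressive_component progressive_matrix_vector fc continuous_on_const Y_prog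
            progressive_scaleR[where 'b = real, simplified])
      have d_eq: "d t \<omega> $ k = (B t *v D t \<omega>) $ k + (if k = i then u t \<omega> else 0)" for t \<omega> k
        by (simp add: d_def axis_def)
      have ui_prog: "progressive T (\<lambda>t \<omega>. if k = i then u t \<omega> else 0)" for k
        by (cases "k = i") (auto intro: u_prog zero_prog)
      have d_prog: "progressive T d"
      proof -
        have "progressive T (\<lambda>t \<omega>. \<chi> k. (B t *v D t \<omega>) $ k + (if k = i then u t \<omega> else 0))"
          by (intro progressive_vec_lambda progressive_add progressive_component progressive_matrix_vector Bc D_prog ui_prog)
        also have "(\<lambda>t \<omega>. \<chi> k. (B t *v D t \<omega>) $ k + (if k = i then u t \<omega> else 0)) = d"
          by (simp add: fun_eq_iff vec_eq_iff d_eq)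
        finally show ?thesis .
      qed
      have sqD: "square_integrable (time T \<Otimes>\<^sub>M M) (\<lambda>z. D (fst z) (snd z) $ k)" for k
        unfolding D_def vector_minus_component by (intro square_integrable_diff sqX sqY)
      have sqDT: "square_integrable M (\<lambda>\<omega>. D T \<omega> $ k)" for k
        unfolding D_def vector_minus_component by (intro square_integrable_diff sqX(2) sqY(2) TT)
      note sqm = square_integrable_matrix_vector
      have squ: "square_integrable (time T \<Otimes>\<^sub>M M) (\<lambda>z. u (fst z) (snd z))"
        unfolding u_eq
        by (intro square_integrable_add square_integrable_cmult \<alpha>_sq sqm fc sqY sqm[OF continuous_on_const])
      have sqd: "square_integrable (time T \<Otimes>\<^sub>M M) (\<lambda>z. d (fst z) (snd z) $ k)" for k
      proof -
        have "square_integrable (time T \<Otimes>\<^sub>M M) (\<lambda>z. if k = i then u (fst z) (snd z) else 0)"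
          by (cases "k = i") (auto simp: squ zero_sq)
        then show ?thesis unfolding d_eq by (intro square_integrable_add sqm Bc sqD)
      qed
      have X_int: "AE \<omega> in M. continuous_on {0..T} (\<lambda>s. B s *v X s \<omega>) \<and>
        (\<forall>j. \<forall>s\<in>{0..T}. X s \<omega> $ j = x0 $ j + (LINT r:{0..s}|lborel. (B r *v X r \<omega>) $ j) + \<sigma> * W j s \<omega>)"
      proof -
        from X have "AE \<omega> in M. \<forall>j. \<forall>t\<in>{0..T}. X t \<omega> $ j = x0 $ j
            + (LINT s:{0..t}|lborel. feedback \<phi> X j s \<omega> - a * (L *v X s \<omega>) $ j) + \<sigma> * W j t \<omega>"
          unfolding state_process_def by auto
        with X_eq show ?thesis
          unfolding fb by eventually_elim (auto intro: matrix_vector.continuous_on Bc)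
      qed
      have D_int: "AE \<omega> in M. \<forall>k. set_integrable lborel {0..T} (\<lambda>s. d s \<omega> $ k) \<and>
        (\<forall>s\<in>{0..T}. D s \<omega> $ k = (LINT r:{0..s}|lborel. d r \<omega> $ k))"
      proof -
        from X have "AE \<omega> in M. \<forall>j. \<forall>t\<in>{0..T}.
            set_integrable lborel {0..t} (\<lambda>s. (B s *v X s \<omega>) $ j) \<and>
            X t \<omega> $ j = x0 $ j + (LINT s:{0..t}|lborel. (B s *v X s \<omega>) $ j) + \<sigma> * W j t \<omega>"
          unfolding state_process_def fb by auto
        moreover from Y have "AE \<omega> in M. \<forall>j. \<forall>t\<in>{0..T}.
            set_integrable lborel {0..t} (\<lambda>s. (Bd s *v Y s \<omega>) $ j + v j s \<omega>) \<and>
            Y t \<omega> $ j = x0 $ j + (LINT s:{0..t}|lborel. (Bd s *v Y s \<omega>) $ j + v j s \<omega>) + \<sigma> * W j t \<omega>"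
          unfolding state_process_def dv by auto
        ultimately show ?thesis
        proof eventually_elim
          case (elim \<omega>)
          have dk: "(Bd s *v Y s \<omega>) $ k + v k s \<omega> - (B s *v X s \<omega>) $ k = d s \<omega> $ k" for s k
            using B[of i s "Y s \<omega>"]
            by (auto simp: d_eq Bd v_def D_def u_def matrix_vector.diff_right)
          have i: "set_integrable lborel {0..t} (\<lambda>s. (Bd s *v Y s \<omega>) $ k + v k s \<omega>)"
            "set_integrable lborel {0..t} (\<lambda>s. (B s *v X s \<omega>) $ k)" if "t \<in> {0..T}" for t k
            using elim that by blast+
          show ?case
          proof (intro allI conjI ballI)
            fix k
            show "set_integrable lborel {0..T} (\<lambda>s. d s \<omega> $ k)"
              using set_integral_diff(1)[OF i[OF TT, of k]] by (simp add: dk)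
            fix s assume s: "s \<in> {0..T}"
            have "D s \<omega> $ k = (LINT r:{0..s}|lborel. (Bd r *v Y r \<omega>) $ k + v k r \<omega>) - (LINT r:{0..s}|lborel. (B r *v X r \<omega>) $ k)"
              using elim s by (simp add: D_def)
            also have "\<dots> = (LINT r:{0..s}|lborel. d r \<omega> $ k)"
              using set_integral_diff(2)[OF i[OF s, of k]] by (simp add: dk)
            finally show "D s \<omega> $ k = (LINT r:{0..s}|lborel. d r \<omega> $ k)" .
          qed
        qed
      qed
      define G where "G z = (F i (fst z) *v X (fst z) (snd z)) $ i" for z
      define \<delta> where "\<delta> z = u (fst z) (snd z) - (F i (fst z) *v D (fst z) (snd z)) $ i" for z
      have sqG: "square_integrable (time T \<Otimes>\<^sub>M M) G"
        unfolding G_def[abs_def] by (intro sqm fc sqX)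
      have sq\<delta>: "square_integrable (time T \<Otimes>\<^sub>M M) \<delta>"
        unfolding \<delta>_def[abs_def] by (intro square_integrable_diff squ sqm fc sqD)
      have "expectation (\<lambda>\<omega>. D T \<omega> \<bullet> (F i T *v X T \<omega>))
        = (\<integral>(s, \<omega>). d s \<omega> \<bullet> (F i s *v X s \<omega>) + D s \<omega> \<bullet> (F i s *v (B s *v X s \<omega>))
            + D s \<omega> \<bullet> (riccati_rhs L a q F i s *v X s \<omega>) \<partial>(time T \<Otimes>\<^sub>M M))"
        by (rule expectation_bilinear_form[OF T0 d_prog X_prog D_prog sqX(1) sqm[OF Bc sqX(1)] sqD sqd sqX(2)[OF TT] sqDT
              X_int D_int F_derivative[OF L q F] riccati_rhs_continuous[OF L q F]])
      also have "\<dots> = (\<integral>z. \<delta> z * G z \<partial>(time T \<Otimes>\<^sub>M M))"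
        by (rule Bochner_Integration.integral_cong)
          (auto simp: space_pair_measure space_restrict_space d_def B_def riccati_quadratic[OF L q F] \<delta>_def G_def)
      finally have cross: "expectation (\<lambda>\<omega>. D T \<omega> \<bullet> (F i T *v X T \<omega>)) = (\<integral>z. \<delta> z * G z \<partial>(time T \<Otimes>\<^sub>M M))" .
      define \<zeta>X where "\<zeta>X \<omega> = (L *v X T \<omega>) $ i" for \<omega>
      define \<zeta>D where "\<zeta>D \<omega> = (L *v D T \<omega>) $ i" for \<omega>
      have sqL: "square_integrable M (\<lambda>\<omega>. (L *v Z \<omega>) $ i)" if "\<And>k. square_integrable M (\<lambda>\<omega>. Z \<omega> $ k)" for Z :: "'w \<Rightarrow> real^'n"
        unfolding matrix_vector_mult_def by (simp, intro square_integrable_sum square_integrable_cmult that)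
      have sq\<zeta>: "square_integrable M \<zeta>X" "square_integrable M \<zeta>D" "square_integrable M (\<lambda>\<omega>. (L *v Y T \<omega>) $ i)"
        unfolding \<zeta>X_def[abs_def] \<zeta>D_def[abs_def] by (intro sqL sqX(2) sqY(2) sqDT TT)+
      have term_eq: "D T \<omega> \<bullet> (F i T *v X T \<omega>) = c * (\<zeta>D \<omega> * \<zeta>X \<omega>)" for \<omega>
        by (simp add: F_terminal[OF L q F] matrix_vector.scaleR_left inner_rank_one L \<zeta>D_def \<zeta>X_def)
      have \<eta>X: "feedback \<phi> X i (fst z) (snd z) + q * (L *v X (fst z) (snd z)) $ i = - G z" for z
        by (simp add: feedback_def \<phi>_def G_def)
      have \<eta>Y: "deviate \<phi> i \<alpha> Y i (fst z) (snd z) + q * (L *v Y (fst z) (snd z)) $ i = \<delta> z - G z" for z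
        by (simp add: deviate_def \<delta>_def G_def u_eq D_def matrix_vector.diff_right)
      have \<zeta>Y: "(L *v Y T \<omega>) $ i = \<zeta>X \<omega> + \<zeta>D \<omega>" for \<omega>
        by (simp add: \<zeta>X_def \<zeta>D_def D_def matrix_vector.diff_right)
      have cX: "cost M L q \<epsilon> c T i (feedback \<phi> X) X = ennreal
          ((\<integral>z. 1/2 * (G z)\<^sup>2 \<partial>(time T \<Otimes>\<^sub>M M)) + expectation (\<lambda>\<omega>. c/2 * (\<zeta>X \<omega>)\<^sup>2))"
        using cost_eq[OF T0 q c, of "feedback \<phi> X" i L X] sqG sq\<zeta>
        unfolding \<eta>X by (simp add: \<zeta>X_def[abs_def] square_integrable_def)
      have cY: "cost M L q \<epsilon> c T i (deviate \<phi> i \<alpha> Y) Y = ennreal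
          ((\<integral>z. 1/2 * (\<delta> z - G z)\<^sup>2 \<partial>(time T \<Otimes>\<^sub>M M)) + expectation (\<lambda>\<omega>. c/2 * (\<zeta>X \<omega> + \<zeta>D \<omega>)\<^sup>2))"
        using cost_eq[OF T0 q c, of "deviate \<phi> i \<alpha> Y" i L Y] square_integrable_diff[OF sq\<delta> sqG] sq\<zeta>
        unfolding \<eta>Y \<zeta>Y by simp
      have "(\<integral>z. 1/2 * (\<delta> z - G z)\<^sup>2 \<partial>(time T \<Otimes>\<^sub>M M))
        = (\<integral>z. 1/2 * (\<delta> z)\<^sup>2 + 1/2 * (G z)\<^sup>2 - \<delta> z * G z \<partial>(time T \<Otimes>\<^sub>M M))"
        by (intro Bochner_Integration.integral_cong) (auto simp: power2_diff algebra_simps)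
      also have "\<dots> = (\<integral>z. 1/2 * (\<delta> z)\<^sup>2 \<partial>(time T \<Otimes>\<^sub>M M)) + (\<integral>z. 1/2 * (G z)\<^sup>2 \<partial>(time T \<Otimes>\<^sub>M M))
          - (\<integral>z. \<delta> z * G z \<partial>(time T \<Otimes>\<^sub>M M))"
        using sq\<delta> sqG square_integrable_mult[OF sq\<delta> sqG] by (simp add: square_integrable_def)
      finally have 1: "(\<integral>z. 1/2 * (\<delta> z - G z)\<^sup>2 \<partial>(time T \<Otimes>\<^sub>M M)) = \<dots>" .
      have "expectation (\<lambda>\<omega>. c/2 * (\<zeta>X \<omega> + \<zeta>D \<omega>)\<^sup>2)
        = expectation (\<lambda>\<omega>. c/2 * (\<zeta>X \<omega>)\<^sup>2 + c/2 * (\<zeta>D \<omega>)\<^sup>2 + c * (\<zeta>D \<omega> * \<zeta>X \<omega>))"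
        by (intro Bochner_Integration.integral_cong) (auto simp: power2_sum algebra_simps)
      also have "\<dots> = expectation (\<lambda>\<omega>. c/2 * (\<zeta>X \<omega>)\<^sup>2) + expectation (\<lambda>\<omega>. c/2 * (\<zeta>D \<omega>)\<^sup>2)
          + expectation (\<lambda>\<omega>. c * (\<zeta>D \<omega> * \<zeta>X \<omega>))"
        using sq\<zeta> square_integrable_mult[OF sq\<zeta>(2,1)] by (simp add: square_integrable_def)
      finally have 2: "expectation (\<lambda>\<omega>. c/2 * (\<zeta>X \<omega> + \<zeta>D \<omega>)\<^sup>2) = \<dots>" .
      have "0 \<le> (\<integral>z. 1/2 * (\<delta> z)\<^sup>2 \<partial>(time T \<Otimes>\<^sub>M M))" by simp
      moreover have "0 \<le> expectation (\<lambda>\<omega>. c/2 * (\<zeta>D \<omega>)\<^sup>2)" using c by simp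
      ultimately show ?thesis
        unfolding cX cY 1 2 using cross unfolding term_eq by (intro ennreal_leI) linarith
    qed
    with wpd show ?thesis by blast
  qed
  then have "markovian_nash_equilibrium M W L a q \<epsilon> c \<sigma> T x0 \<phi>"
    unfolding markovian_nash_equilibrium_def using markov wp by blast
  then show ?thesis by (simp add: \<phi>_def[abs_def])
qed

end

section \<open>Games on vertex-transitive graphs\<close>

theorem theorem4p2:
  fixes adj :: "'n::finite \<Rightarrow> 'n \<Rightarrow> bool"
    and a q \<epsilon> c \<sigma> T :: real
    and x0 :: "real^'n"
    and M :: "'w measure"
    and W :: "'n \<Rightarrow> real \<Rightarrow> 'w \<Rightarrow> real"
  assumes "simple_graph adj" and "connected_graph adj" and "vertex_transitive adj"
    and "T > 0" and "a \<ge> 0" and "q \<ge> 0" and "\<epsilon> \<ge> 0" and "c > 0" and "\<sigma> > 0"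
    and "q\<^sup>2 = \<epsilon>"
    and "prob_space M" and "independent_brownian_motions M W"
  shows "let L = normalized_laplacian adj in
    \<exists>R. solves_R_ode L a q c T R \<and>
      (\<forall>S. solves_R_ode L a q c T S \<longrightarrow> (\<forall>t\<in>{0..T}. S t = R t)) \<and>
      (let P = P_of L a q c T R; F = F_of L a q P in
        solves_riccati L a q \<epsilon> c T F \<and>
        (\<forall>G. solves_riccati L a q \<epsilon> c T G \<longrightarrow> (\<forall>i. \<forall>t\<in>{0..T}. G i t = F i t)) \<and>
        markovian_nash_equilibrium M W L a q \<epsilon> c \<sigma> T x0
          (\<lambda>i t x. - q * (L *v x) $ i - (F i t *v x) $ i))"
proof -
  define L where "L = normalized_laplacian adj"
  have graph: "symp adj" "irreflp adj" using assms(1) by (auto simp: simple_graph_def)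
  have L_sym: "transpose L = L" unfolding L_def by (rule transpose_laplacian[OF graph(1)])
  obtain e l where frame: "orthonormal_frame e" and L: "L = spectral e l"
    by (rule spectral_theorem[OF L_sym])
  have l: "0 \<le> l k" for k
    using laplacian_quadratic_nonneg[OF graph assms(3), of "e k"]
    unfolding L_def[symmetric] L spectral_coefficient[OF frame] .
  have tr: "trace L = real CARD('n)" unfolding L_def by (rule trace_laplacian)
  have pos: "\<exists>k. l k > 0"
  proof (rule ccontr)
    assume "\<not> (\<exists>k. l k > 0)"
    then have "l k = 0" for k using l[of k] by (simp add: less_le)
    then show False using tr by (simp add: L spectral_trace[OF frame])
  qed
  interpret rate_equation l "a + q" c
    by unfold_locales (use l assms in auto)
  obtain \<rho> where \<rho>: "solves_rate T \<rho>"
    using solves_rate_exists[of T] assms(4) by (meson less_imp_le)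
  have diag: "mat_poly p L $ i $ i = trace (mat_poly p L) / real CARD('n)" for p i
    unfolding L_def by (rule vertex_transitive_constant_diagonal[OF assms(3) refl])
  interpret transitive_game l "a + q" c T \<rho> e L a q
    by unfold_locales (use pos \<rho> frame L assms(4) tr diag in auto)
  interpret brownian_family M W
    using assms(11,12) by (simp add: brownian_family_def brownian_family_axioms_def)
  define R where "R = ode_solution"
  have R_eq: "R t = spectral e (\<lambda>k. \<rho> t $ k)" for t
    by (simp add: R_def ode_solution_def)
  define F where "F = F_of L a q (P_of L a q c T R)"
  have R: "solves_R_ode L a q c T R"
    unfolding R_eq[abs_def] by (rule solves_R_ode_spectral[OF frame L assms(4) refl \<rho>])
  have R_unique: "S t = R t" if S: "solves_R_ode L a q c T S" and t: "t \<in> {0..T}" for S t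
    using solves_R_ode_coefficients[OF frame L S refl] solves_rate_unique[OF \<rho> _ t] t by (simp add: R_eq)
  have F: "solves_riccati L a q \<epsilon> c T F"
    using F_of_solves_riccati[OF assms(10)]
    unfolding F_def R_def .
  have "markovian_nash_equilibrium M W L a q \<epsilon> c \<sigma> T x0 (\<lambda>i t x. - q * (L *v x) $ i - (F i t *v x) $ i)"
    using assms by (intro riccati_solution_nash L_sym F) auto
  then show ?thesis
    unfolding Let_def L_def[symmetric]
    by (intro exI[of _ R] conjI allI impI ballI) (use R R_unique F solves_riccati_unique[OF F] in \<open>simp_all add: F_def\<close>)
qed

end
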